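(* Assume the following: $H\in C^1(\overline\Omega;\mathbb R^d)$; $\varphi_*\in C^2(\overline\Omega)$ satisfies $H(\mathbf x)\cdot\nabla\varphi_*(\mathbf x)\ge\mu_0>0$ for all $\mathbf x\in\overline\Omega$; $c,f\in C^1(\overline\Omega\times\mathbb R)$; $c(\mathbf x,\sigma)\ge\kappa_0>0$ for all $(\mathbf x,\sigma)\in\overline\Omega\times\mathbb R$; $\alpha\in L^\infty(\Omega\times(0,T))$; $s>d/2+1$; and $M>0$. Let $\lambda_1>0$ and $C>0$ be constants such that for every $\varepsilon>0$, all $\lambda\ge\lambda_1$ and all $\Phi,\Psi\in B_M$, $$\left\|\mathcal T^{\lambda,\varepsilon}(\Phi)-\mathcal T^{\lambda,\varepsilon}(\Psi)\right\|_{\lambda,\varepsilon,\varphi_*}\le\sqrt{\frac{C}{\lambda}}\,\|\Phi-\Psi\|_{\lambda,\varepsilon,\varphi_*}$$ (such constants exist under the hypotheses above). Let $\varepsilon>0$ and choose $\lambda\ge\lambda_1$ so that $\mu:=\sqrt{C/\lambda}<1$. For arbitrary $U^{(0)}\in B_M$, define $U^{(k+1)}=\mathcal T^{\lambda,\varepsilon}(U^{(k)})$, $k\ge0$. Then $\mathcal T^{\lambda,\varepsilon}$ has a unique fixed point $U^{\lambda,\varepsilon}\in B_M$, the sequence $U^{(k)}$ converges to $U^{\lambda,\varepsilon}$ in $\|\cdot\|_{\lambda,\varepsilon,\varphi_*}$, and for all $k\ge0$ $$\|U^{(k)}-U^{\lambda,\varepsilon}\|_{\lambda,\varepsilon,\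varphi_*}\le\mu^k\|U^{(0)}-U^{\lambda,\varepsilon}\|_{\lambda,\varepsilon,\varphi_*}.$$
   Context: Setting. $\Omega\subset\mathbb R^d$, $d\ge1$, is a bounded domain with smooth boundary and outward unit normal $\nu$; $T>0$; $N\ge0$ is an integer. $H:\overline\Omega\to\mathbb R^d$ is a vector field, $\Gamma_-=\{\mathbf x\in\partial\Omega: H\cdot\nu\le0\}$, $\Gamma_+=\{\mathbf x\in\partial\Omega:H\cdot\nu>0\}$. $c,f:\overline\Omega\times\mathbb R\to\mathbb R$ and $\alpha$ are given functions. For a vector $U=(u_0,\dots,u_N)^\top$ of functions, $H\cdot\nabla U$ is taken componentwise and $|U|^2=\sum_m|u_m|^2$. Temporal basis. With $P_n$ the Legendre polynomial of degree $n$ on $[-1,1]$ ($\int_{-1}^1P_nP_m=\frac{2}{2n+1}\delta_{nm}$), set $\Psi_n(t)=\sqrt{\frac{2n+1}{T}}\,e^tP_n(\frac{2t}{T}-1)$, $t\in[0,T]$. (The scalar functions $\Psi_n$ are unrelated to a vector $\Psi\in B_M$.) Frozen nonlinearity. For $\Phi=(\phi_0,\dots,\phi_N)^\top$ and $V=(v_0,\dots,v_N)^\top$, put $\phi(\mathbf x,t)=\sum_{j=0}^N\phi_j(\mathbf x)\Psi_j(t)$ and define $\mathcal N(\mathbf x;\Phi,V)\in\mathbb R^{N+1}$ by $$[\mathcal N(\mathbf x;\Phi,V)]_m=\sum_{n=0}^N\big(S_{mn}(\mathbf x,\Phi)+M_{mn}(\mathbf x,\Phi)\big)v_n(\mathbf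 x)+F_m(\mathbf x,\Phi),\quad m=0,\dots,N,$$ $$S_{mn}=\int_0^T\frac{e^{-2t}\Psi_n'(t)\Psi_m(t)}{c(\mathbf x,\phi(\mathbf x,t))}dt,\quad M_{mn}=\int_0^T\frac{e^{-2t}\Psi_m(t)}{c(\mathbf x,\phi(\mathbf x,t))}\Big(\int_0^t\alpha(\mathbf x,t-t')\Psi_n(t')dt'\Big)dt,$$ $$F_m=\int_0^T\frac{e^{-2t}f(\mathbf x,\phi(\mathbf x,t))}{c(\mathbf x,\phi(\mathbf x,t))}\Psi_m(t)\,dt.$$ Data. $g$ on $\Gamma_-\times(0,T)$ and $h$ on $\Gamma_+\times(0,T)$ are given square-integrable boundary data; $G=(g_0,\dots,g_N)^\top$ and $D^{\mathrm{obs}}=(h_0,\dots,h_N)^\top$ with $g_m(\mathbf x)=\int_0^Te^{-2t}g(\mathbf x,t)\Psi_m(t)dt$, $h_m(\mathbf x)=\int_0^Te^{-2t}h(\mathbf x,t)\Psi_m(t)dt$, so $G\in[L^2(\Gamma_-)]^{N+1}$ and $D^{\mathrm{obs}}\in[L^2(\Gamma_+)]^{N+1}$. Admissible set, functional and map. $B_M=\{V\in[H^s(\Omega)]^{N+1}:\|V\|_{[H^s(\Omega)]^{N+1}}\le M\}$. For $\Phi\in B_M$, $\lambda,\varepsilon>0$ and $U\in B_M$, $$J_\Phi^{\lambda,\varepsilon}(U)=\int_\Omega e^{2\lambda\varphi_*}|H\cdot\nabla U+\mathcal N(\mathbf x;\Phi,U)|^2d\mathbf x+\lambda^2\int_{\Gamma_-}e^{2\lambda\varphi_*}|U-G|^2dS+\lambda^2\int_{\Gamma_+}e^{2\lambda\varphi_*}|U-D^{\mathrm{obs}}|^2dS+\varepsilon\|U\|^2_{[H^s(\Omega)]^{N+1}}.$$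 $J_\Phi^{\lambda,\varepsilon}$ has a unique minimizer in $B_M$, and $\mathcal T^{\lambda,\varepsilon}(\Phi):=\operatorname{argmin}_{U\in B_M}J_\Phi^{\lambda,\varepsilon}(U)$, a map $B_M\to B_M$. Weighted norm. $$\|Z\|^2_{\lambda,\varepsilon,\varphi_*}=\int_\Omega e^{2\lambda\varphi_*}|Z|^2d\mathbf x+\int_{\Gamma_+}e^{2\lambda\varphi_*}|Z|^2dS+\frac\varepsilon\lambda\|Z\|^2_{[H^s(\Omega)]^{N+1}}.$$ *)

theory Defs
  imports "HOL-Analysis.Analysis" "HOL-Computational_Algebra.Polynomial"
begin

section \<open>Classical smoothness\<close>

definition grad :: "('a::euclidean_space \<Rightarrow> real) \<Rightarrow> 'a \<Rightarrow> 'a" where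
  "grad f x = (\<Sum>b\<in>Basis. frechet_derivative f (at x) b *\<^sub>R b)"

text \<open>\<open>C\<^sup>k\<close> functions on an open set \<open>S\<close>.\<close>

primrec Ck_on :: "nat \<Rightarrow> 'a::euclidean_space set \<Rightarrow> ('a \<Rightarrow> real) \<Rightarrow> bool" where
  "Ck_on 0 S f \<longleftrightarrow> continuous_on S f"
| "Ck_on (Suc k) S f \<longleftrightarrow> (\<forall>x\<in>S. f differentiable (at x)) \<and>
     (\<forall>b\<in>Basis. Ck_on k S (\<lambda>x. frechet_derivative f (at x) b))"

text \<open>All partial derivatives of order at most \<open>k\<close> exist in the open set \<open>S\<close> and extend
  continuously to the closure of \<open>S\<close>.\<close>

primrec Ck_ext :: "nat \<Rightarrow> 'a::euclidean_space set \<Rightarrow> ('a \<Rightarrow> real) \<Rightarrow> bool" where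
  "Ck_ext 0 S f \<longleftrightarrow> (\<exists>g. continuous_on (closure S) g \<and> (\<forall>x\<in>S. g x = f x))"
| "Ck_ext (Suc k) S f \<longleftrightarrow> (\<exists>g. continuous_on (closure S) g \<and> (\<forall>x\<in>S. g x = f x)) \<and>
     (\<forall>x\<in>S. f differentiable (at x)) \<and>
     (\<forall>b\<in>Basis. Ck_ext k S (\<lambda>x. frechet_derivative f (at x) b))"

text \<open>\<open>C\<^sup>k\<close> of the closure of the open set \<open>S\<close>, for functions that are given on the closure.
  Their gradient on the closure is the continuous extension of the gradient in \<open>S\<close>.\<close>

definition Ck_closure :: "nat \<Rightarrow> 'a::euclidean_space set \<Rightarrow> ('a \<Rightarrow> real) \<Rightarrow> bool" where
  "Ck_closure k S f \<longleftrightarrow> continuous_on (closure S) f \<and> Ck_ext k S f"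

definition grad_closure :: "'a::euclidean_space set \<Rightarrow> ('a \<Rightarrow> real) \<Rightarrow> 'a \<Rightarrow> 'a" where
  "grad_closure S f x = Lim (at x within S) (grad f)"


section \<open>Smooth bounded domains, outward normal, surface measure\<close>

definition local_defining_function ::
    "'a::euclidean_space set \<Rightarrow> 'a \<Rightarrow> 'a set \<Rightarrow> ('a \<Rightarrow> real) \<Rightarrow> bool" where
  "local_defining_function \<Omega> p W \<rho> \<longleftrightarrow> open W \<and> p \<in> W \<and> (\<forall>k. Ck_on k W \<rho>) \<and>
     (\<forall>x\<in>W. grad \<rho> x \<noteq> 0) \<and> \<Omega> \<inter> W = {x\<in>W. \<rho> x < 0}"

definition smooth_bounded_domain :: "'a::euclidean_space set \<Rightarrow> bool" where
  "smooth_bounded_domain \<Omega> \<longleftrightarrow> open \<Omega> \<and> connected \<Omega> \<and> \<Omega> \<noteq> {} \<and> bounded \<Omega> \<and>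
     (\<forall>p\<in>frontier \<Omega>. \<exists>W \<rho>. local_defining_function \<Omega> p W \<rho>)"

text \<open>The normalized gradient does not depend on the choice of the defining function.\<close>

definition outward_normal :: "'a::euclidean_space set \<Rightarrow> 'a \<Rightarrow> 'a" where
  "outward_normal \<Omega> p =
     (THE n. \<exists>W \<rho>. local_defining_function \<Omega> p W \<rho> \<and> n = grad \<rho> p /\<^sub>R norm (grad \<rho> p))"

text \<open>The \<open>k\<close>-dimensional Hausdorff measure, normalized so that it gives the surface area of
  \<open>k\<close>-dimensional surfaces. The library's \<open>diameter\<close> is meaningful for bounded sets only. The
  empty set contributes \<open>0\<close> also for \<open>k = 0\<close>, where \<open>0 ^ 0 = 1\<close>.\<close>

definition hausdorff_pre :: "nat \<Rightarrow> real \<Rightarrow> 'a::metric_space set \<Rightarrow> ennreal" where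
  "hausdorff_pre k \<delta> A =
     (INF C \<in> {C :: nat \<Rightarrow> 'a set. A \<subseteq> (\<Union>i. C i) \<and> (\<forall>i. bounded (C i) \<and> diameter (C i) \<le> \<delta>)}.
        \<Sum>i. if C i = {} then 0
            else ennreal (unit_ball_vol (real k) * (diameter (C i) / 2) ^ k))"

definition hausdorff :: "nat \<Rightarrow> 'a::metric_space set \<Rightarrow> ennreal" where
  "hausdorff k A = (SUP \<delta> \<in> {0<..}. hausdorff_pre k \<delta> A)"

definition surface_measure :: "'a::euclidean_space set \<Rightarrow> 'a measure" where
  "surface_measure \<Omega> =
     measure_of UNIV (sets borel) (\<lambda>A. hausdorff (DIM('a) - 1) (A \<inter> frontier \<Omega>))"

definition Gamma_minus :: "'a::euclidean_space set \<Rightarrow> ('a \<Rightarrow> 'a) \<Rightarrow> 'a set" where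
  "Gamma_minus \<Omega> H = {x \<in> frontier \<Omega>. H x \<bullet> outward_normal \<Omega> x \<le> 0}"

definition Gamma_plus :: "'a::euclidean_space set \<Rightarrow> ('a \<Rightarrow> 'a) \<Rightarrow> 'a set" where
  "Gamma_plus \<Omega> H = {x \<in> frontier \<Omega>. H x \<bullet> outward_normal \<Omega> x > 0}"

definition L2_boundary_data ::
    "'a::euclidean_space set \<Rightarrow> real \<Rightarrow> 'a set \<Rightarrow> ('a \<Rightarrow> real \<Rightarrow> real) \<Rightarrow> bool" where
  "L2_boundary_data \<Omega> T \<Gamma> g \<longleftrightarrow>
     set_borel_measurable (surface_measure \<Omega> \<Otimes>\<^sub>M lborel) (\<Gamma> \<times> {0<..<T}) (\<lambda>(x, t). g x t) \<and>
     set_integrable (surface_measure \<Omega> \<Otimes>\<^sub>M lborel) (\<Gamma> \<times> {0<..<T}) (\<lambda>(x, t). (g x t)\<^sup>2)"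

definition Linfty_space_time ::
    "'a::euclidean_space set \<Rightarrow> real \<Rightarrow> ('a \<Rightarrow> real \<Rightarrow> real) \<Rightarrow> bool" where
  "Linfty_space_time \<Omega> T \<alpha> \<longleftrightarrow>
     set_borel_measurable lborel (\<Omega> \<times> {0<..<T}) (\<lambda>(x, t). \<alpha> x t) \<and>
     (\<exists>K. AE p in lborel. p \<in> \<Omega> \<times> {0<..<T} \<longrightarrow> \<bar>\<alpha> (fst p) (snd p)\<bar> \<le> K)"


section \<open>Sobolev spaces of real order\<close>

text \<open>
  \<open>H\<^sup>s(\<Omega>)\<close> consists of the restrictions to \<open>\<Omega>\<close> of the elements of the Bessel potential space
  \<open>H\<^sup>s(\<real>\<^sup>d)\<close>, with the quotient norm, that is, the infimum of
  \<open>(\<integral> (1 + |\<xi>|\<^sup>2)\<^sup>s |a(\<xi>)|\<^sup>2 d\<xi>)\<^bsup>1/2\<^esup>\<close> over the Fourier transforms \<open>a\<close> of all extensions.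

  The definitions below are meant for \<open>s > d/2\<close>. Then such an \<open>a\<close> is integrable, and the
  elements of \<open>H\<^sup>s(\<real>\<^sup>d)\<close> are exactly the functions with a continuous representative given by the
  absolutely convergent inverse Fourier integral of \<open>a\<close>. An element of \<open>H\<^sup>s(\<Omega>)\<close> is represented
  by its unique continuous representative on the closure of \<open>\<Omega>\<close>, set to \<open>0\<close> elsewhere, so that
  equality of functions is equality in \<open>H\<^sup>s(\<Omega>)\<close> and the boundary trace is given by the
  values on the boundary. For \<open>s > d/2 + 1\<close> it is of class \<open>C\<^sup>1\<close>, and its weak gradient in \<open>\<Omega>\<close> is
  the classical one.
\<close>

definition inverse_fourier :: "('a::euclidean_space \<Rightarrow> complex) \<Rightarrow> 'a \<Rightarrow> complex" where
  "inverse_fourier a x =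
     of_real ((2 * pi) powr (- real DIM('a) / 2)) * (LINT \<xi>|lborel. cis (x \<bullet> \<xi>) * a \<xi>)"

definition bessel_sq_norm :: "real \<Rightarrow> ('a::euclidean_space \<Rightarrow> complex) \<Rightarrow> real" where
  "bessel_sq_norm s a = (LINT \<xi>|lborel. (1 + (norm \<xi>)\<^sup>2) powr s * (cmod (a \<xi>))\<^sup>2)"

definition Hs_extensions ::
    "real \<Rightarrow> 'a::euclidean_space set \<Rightarrow> ('a \<Rightarrow> real) \<Rightarrow> ('a \<Rightarrow> complex) set" where
  "Hs_extensions s \<Omega> u = {a. a \<in> borel_measurable lborel \<and>
     integrable lborel (\<lambda>\<xi>. (1 + (norm \<xi>)\<^sup>2) powr s * (cmod (a \<xi>))\<^sup>2) \<and>
     (\<forall>x\<in>closure \<Omega>. inverse_fourier a x = complex_of_real (u x))}"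

definition Hs :: "real \<Rightarrow> 'a::euclidean_space set \<Rightarrow> ('a \<Rightarrow> real) set" where
  "Hs s \<Omega> = {u. (\<forall>x. x \<notin> closure \<Omega> \<longrightarrow> u x = 0) \<and> Hs_extensions s \<Omega> u \<noteq> {}}"

definition Hs_norm :: "real \<Rightarrow> 'a::euclidean_space set \<Rightarrow> ('a \<Rightarrow> real) \<Rightarrow> real" where
  "Hs_norm s \<Omega> u = (INF a \<in> Hs_extensions s \<Omega> u. sqrt (bessel_sq_norm s a))"

text \<open>A vector \<open>(u\<^sub>0, \<dots>, u\<^sub>N)\<close> of functions is a sequence of functions whose entries with
  index above \<open>N\<close> are \<open>0\<close>.\<close>

definition Hs_vec_norm ::
    "nat \<Rightarrow> real \<Rightarrow> 'a::euclidean_space set \<Rightarrow> (nat \<Rightarrow> 'a \<Rightarrow> real) \<Rightarrow> real" where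
  "Hs_vec_norm N s \<Omega> U = sqrt (\<Sum>m\<le>N. (Hs_norm s \<Omega> (U m))\<^sup>2)"

definition admissible_ball ::
    "nat \<Rightarrow> real \<Rightarrow> 'a::euclidean_space set \<Rightarrow> real \<Rightarrow> (nat \<Rightarrow> 'a \<Rightarrow> real) set" where
  "admissible_ball N s \<Omega> M = {V. (\<forall>m\<le>N. V m \<in> Hs s \<Omega>) \<and> (\<forall>m>N. V m = (\<lambda>_. 0)) \<and>
     Hs_vec_norm N s \<Omega> V \<le> M}"


section \<open>Temporal basis and frozen nonlinearity\<close>

text \<open>Rodrigues' formula.\<close>

definition legendre :: "nat \<Rightarrow> real poly" where
  "legendre n = smult (1 / (2 ^ n * fact n)) ((pderiv ^^ n) ([:-1, 0, 1:] ^ n))"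

definition Psi :: "real \<Rightarrow> nat \<Rightarrow> real \<Rightarrow> real" where
  "Psi T n t = sqrt ((2 * real n + 1) / T) * exp t * poly (legendre n) (2 * t / T - 1)"

definition synth :: "nat \<Rightarrow> real \<Rightarrow> (nat \<Rightarrow> 'a \<Rightarrow> real) \<Rightarrow> 'a \<Rightarrow> real \<Rightarrow> real" where
  "synth N T \<Phi> x t = (\<Sum>j\<le>N. \<Phi> j x * Psi T j t)"

definition coeff_S ::
    "nat \<Rightarrow> real \<Rightarrow> ('a \<Rightarrow> real \<Rightarrow> real) \<Rightarrow> (nat \<Rightarrow> 'a \<Rightarrow> real) \<Rightarrow> nat \<Rightarrow> nat \<Rightarrow> 'a \<Rightarrow> real" where
  "coeff_S N T c \<Phi> m n x =
     (LINT t:{0..T}|lborel. exp (-2 * t) * deriv (Psi T n) t * Psi T m t / c x (synth N T \<Phi> x t))"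

definition coeff_M ::
    "nat \<Rightarrow> real \<Rightarrow> ('a \<Rightarrow> real \<Rightarrow> real) \<Rightarrow> ('a \<Rightarrow> real \<Rightarrow> real) \<Rightarrow> (nat \<Rightarrow> 'a \<Rightarrow> real) \<Rightarrow>
     nat \<Rightarrow> nat \<Rightarrow> 'a \<Rightarrow> real" where
  "coeff_M N T c \<alpha> \<Phi> m n x =
     (LINT t:{0..T}|lborel. exp (-2 * t) * Psi T m t / c x (synth N T \<Phi> x t) *
        (LINT t':{0<..<t}|lborel. \<alpha> x (t - t') * Psi T n t'))"

definition coeff_F ::
    "nat \<Rightarrow> real \<Rightarrow> ('a \<Rightarrow> real \<Rightarrow> real) \<Rightarrow> ('a \<Rightarrow> real \<Rightarrow> real) \<Rightarrow> (nat \<Rightarrow> 'a \<Rightarrow> real) \<Rightarrow>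
     nat \<Rightarrow> 'a \<Rightarrow> real" where
  "coeff_F N T c f \<Phi> m x =
     (LINT t:{0..T}|lborel. exp (-2 * t) * f x (synth N T \<Phi> x t) / c x (synth N T \<Phi> x t) *
        Psi T m t)"

definition frozen_nonlinearity ::
    "nat \<Rightarrow> real \<Rightarrow> ('a \<Rightarrow> real \<Rightarrow> real) \<Rightarrow> ('a \<Rightarrow> real \<Rightarrow> real) \<Rightarrow> ('a \<Rightarrow> real \<Rightarrow> real) \<Rightarrow>
     (nat \<Rightarrow> 'a \<Rightarrow> real) \<Rightarrow> (nat \<Rightarrow> 'a \<Rightarrow> real) \<Rightarrow> nat \<Rightarrow> 'a \<Rightarrow> real" where
  "frozen_nonlinearity N T c f \<alpha> \<Phi> V m x =
     (\<Sum>n\<le>N. (coeff_S N T c \<Phi> m n x + coeff_M N T c \<alpha> \<Phi> m n x) * V n x) + coeff_F N T c f \<Phi> m x"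

definition data_coeff :: "real \<Rightarrow> ('a \<Rightarrow> real \<Rightarrow> real) \<Rightarrow> nat \<Rightarrow> 'a \<Rightarrow> real" where
  "data_coeff T g m x = (LINT t:{0<..<T}|lborel. exp (-2 * t) * g x t * Psi T m t)"


section \<open>Functional, solution map and weighted norm\<close>

definition carleman_functional ::
    "'a::euclidean_space set \<Rightarrow> real \<Rightarrow> nat \<Rightarrow> real \<Rightarrow> ('a \<Rightarrow> 'a) \<Rightarrow> ('a \<Rightarrow> real) \<Rightarrow>
     ('a \<Rightarrow> real \<Rightarrow> real) \<Rightarrow> ('a \<Rightarrow> real \<Rightarrow> real) \<Rightarrow> ('a \<Rightarrow> real \<Rightarrow> real) \<Rightarrow>
     ('a \<Rightarrow> real \<Rightarrow> real) \<Rightarrow> ('a \<Rightarrow> real \<Rightarrow> real) \<Rightarrow> real \<Rightarrow> real \<Rightarrow>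
     (nat \<Rightarrow> 'a \<Rightarrow> real) \<Rightarrow> (nat \<Rightarrow> 'a \<Rightarrow> real) \<Rightarrow> real" where
  "carleman_functional \<Omega> T N s H \<phi> c f \<alpha> g h lam eps \<Phi> U =
     (LINT x:\<Omega>|lborel. exp (2 * lam * \<phi> x) *
        (\<Sum>m\<le>N. (H x \<bullet> grad (U m) x + frozen_nonlinearity N T c f \<alpha> \<Phi> U m x)\<^sup>2)) +
     lam\<^sup>2 * (LINT x:Gamma_minus \<Omega> H|surface_measure \<Omega>. exp (2 * lam * \<phi> x) *
        (\<Sum>m\<le>N. (U m x - data_coeff T g m x)\<^sup>2)) +
     lam\<^sup>2 * (LINT x:Gamma_plus \<Omega> H|surface_measure \<Omega>. exp (2 * lam * \<phi> x) *
        (\<Sum>m\<le>N. (U m x - data_coeff T h m x)\<^sup>2)) +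
     eps * (Hs_vec_norm N s \<Omega> U)\<^sup>2"

definition solution_map ::
    "'a::euclidean_space set \<Rightarrow> real \<Rightarrow> nat \<Rightarrow> real \<Rightarrow> ('a \<Rightarrow> 'a) \<Rightarrow> ('a \<Rightarrow> real) \<Rightarrow>
     ('a \<Rightarrow> real \<Rightarrow> real) \<Rightarrow> ('a \<Rightarrow> real \<Rightarrow> real) \<Rightarrow> ('a \<Rightarrow> real \<Rightarrow> real) \<Rightarrow>
     ('a \<Rightarrow> real \<Rightarrow> real) \<Rightarrow> ('a \<Rightarrow> real \<Rightarrow> real) \<Rightarrow> real \<Rightarrow> real \<Rightarrow> real \<Rightarrow>
     (nat \<Rightarrow> 'a \<Rightarrow> real) \<Rightarrow> (nat \<Rightarrow> 'a \<Rightarrow> real)" where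
  "solution_map \<Omega> T N s H \<phi> c f \<alpha> g h M lam eps \<Phi> =
     arg_min_on (carleman_functional \<Omega> T N s H \<phi> c f \<alpha> g h lam eps \<Phi>) (admissible_ball N s \<Omega> M)"

definition weighted_norm ::
    "'a::euclidean_space set \<Rightarrow> nat \<Rightarrow> real \<Rightarrow> ('a \<Rightarrow> 'a) \<Rightarrow> ('a \<Rightarrow> real) \<Rightarrow> real \<Rightarrow> real \<Rightarrow>
     (nat \<Rightarrow> 'a \<Rightarrow> real) \<Rightarrow> real" where
  "weighted_norm \<Omega> N s H \<phi> lam eps Z = sqrt (
     (LINT x:\<Omega>|lborel. exp (2 * lam * \<phi> x) * (\<Sum>m\<le>N. (Z m x)\<^sup>2)) +
     (LINT x:Gamma_plus \<Omega> H|surface_measure \<Omega>. exp (2 * lam * \<phi> x) * (\<Sum>m\<le>N. (Z m x)\<^sup>2)) +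
     eps / lam * (Hs_vec_norm N s \<Omega> Z)\<^sup>2)"

end

theory Submission
  imports Defs
begin

text \<open>
  The theorem is Banach's fixed point theorem for the solution map on the ball of \<open>H\<^sup>s\<close>. Two facts
  make it applicable: the solution map sends the ball into itself, and the ball is complete for a
  norm that is equivalent to the weighted norm.

  The weighted norm contains the term \<open>(eps / lam) * Hs_vec_norm\<^sup>2\<close>, and its two integrals are bounded
  by a multiple of \<open>Hs_vec_norm\<^sup>2\<close>, because functions in \<open>H\<^sup>s\<close> are bounded for \<open>s > d/2\<close>, \<Omega> is bounded
  and its boundary has finite area. Hence both norms are equivalent
  (\<open>weighted_norm_lower\<close>, \<open>weighted_norm_upper\<close>). The contraction property makes the
  increments of the iteration decay geometrically in \<open>H\<^sup>s\<close>, the iteration converges in the ball,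
  and the limit is the fixed point (\<open>admissible_ball_fixed_point\<close>).

  The solution map is an \<open>arg_min\<close>, which is an arbitrary object when no minimizer exists, so its
  values lie in the ball only because the minimum is attained (\<open>solution_map_in_ball\<close>).
  The functional is a sum of three weighted \<open>L\<^sup>2\<close> norms of residuals that are affine in the
  unknown, plus \<open>eps\<close> times the squared \<open>H\<^sup>s\<close> norm. The parallelogram inequality for the last term
  gives uniform midpoint convexity. Minimizing sequences are therefore Cauchy in \<open>H\<^sup>s\<close>, they
  converge in the ball, and the functional is continuous along them
  (\<open>uniformly_midpoint_convex_minimizer\<close>).

  Completeness of \<open>H\<^sup>s(\<Omega>)\<close> comes from a Riesz-Fischer argument for the Fourier transforms of
  extensions (\<open>weighted_L2_series\<close>, \<open>Hs_complete\<close>). Continuity of the residual terms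
  needs three more inputs. The first is the embedding of \<open>H\<^sup>s(\<Omega>)\<close> into \<open>C\<^sup>1\<close> for \<open>s > d/2 + 1\<close>
  (\<open>Hs_sup_bound\<close>, \<open>Hs_C1_bound\<close>). The second is that the coefficients of the
  frozen nonlinearity are measurable and essentially bounded. The third is that the inflow and
  outflow parts of the boundary are Borel sets of finite surface measure
  (\<open>Gamma_measurable\<close>, \<open>finite_surface_measure\<close>).
\<close>

section \<open>Fourier integrals of weighted square-integrable functions\<close>

text \<open>
  Dominated convergence for the difference quotients: the Lipschitz bound and the bound on \<open>F'\<close>
  together dominate the normalized remainder by \<open>2 * D\<close>. Fourier integrals satisfy both bounds with
  \<open>D \<xi> = |\<xi>| |a \<xi>|\<close>.
\<close>

lemma has_derivative_lebesgue_integral: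
  fixes F :: "'a::real_normed_vector \<Rightarrow> 'b \<Rightarrow> 'c::{banach,second_countable_topology}"
  assumes int: "\<And>y. integrable M (F y)"
    and int': "\<And>h. integrable M (\<lambda>\<xi>. F' \<xi> h)"
    and D: "integrable M D"
    and deriv: "\<And>\<xi>. ((\<lambda>y. F y \<xi>) has_derivative F' \<xi>) (at x)"
    and lip: "\<And>y \<xi>. norm (F y \<xi> - F x \<xi>) \<le> norm (y - x) * D \<xi>"
    and bnd: "\<And>h \<xi>. norm (F' \<xi> h) \<le> norm h * D \<xi>"
  shows "((\<lambda>y. \<integral>\<xi>. F y \<xi> \<partial>M) has_derivative (\<lambda>h. \<integral>\<xi>. F' \<xi> h \<partial>M)) (at x)"
proof -
  have lin: "bounded_linear (F' \<xi>)" for \<xi>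
    using deriv has_derivative_bounded_linear by blast
  have "bounded_linear (\<lambda>h. \<integral>\<xi>. F' \<xi> h \<partial>M)"
  proof (rule bounded_linear_intro[where K = "\<integral>\<xi>. D \<xi> \<partial>M"])
    fix u v show "(\<integral>\<xi>. F' \<xi> (u + v) \<partial>M) = (\<integral>\<xi>. F' \<xi> u \<partial>M) + (\<integral>\<xi>. F' \<xi> v \<partial>M)"
      using int' by (simp add: linear_add[OF bounded_linear.linear[OF lin]])
  next
    fix r u show "(\<integral>\<xi>. F' \<xi> (r *\<^sub>R u) \<partial>M) = r *\<^sub>R (\<integral>\<xi>. F' \<xi> u \<partial>M)"
      using int' by (simp add: linear_cmul[OF bounded_linear.linear[OF lin]])
  next
    fix u :: 'a
    have i: "integrable M (\<lambda>\<xi>. norm u * D \<xi>)" using D by simp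
    have "norm (\<integral>\<xi>. F' \<xi> u \<partial>M) \<le> (\<integral>\<xi>. norm u * D \<xi> \<partial>M)"
      using integral_norm_bound[of M "\<lambda>\<xi>. F' \<xi> u"] integral_mono[OF integrable_norm[OF int'[of u]] i bnd]
      by (meson order_trans)
    then show "norm (\<integral>\<xi>. F' \<xi> u \<partial>M) \<le> norm u * (\<integral>\<xi>. D \<xi> \<partial>M)" using D by simp
  qed
  moreover have "((\<lambda>y. ((\<integral>\<xi>. F y \<xi> \<partial>M) - (\<integral>\<xi>. F x \<xi> \<partial>M) - (\<integral>\<xi>. F' \<xi> (y - x) \<partial>M)) /\<^sub>R norm (y - x))
      \<longlongrightarrow> 0) (at x)"
    unfolding tendsto_at_iff_sequentially
  proof (intro allI impI)
    fix X :: "nat \<Rightarrow> 'a" assume X: "\<forall>i. X i \<in> UNIV - {x}" "X \<longlonglongrightarrow> x"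
    define R where "R i \<xi> = (F (X i) \<xi> - F x \<xi> - F' \<xi> (X i - x)) /\<^sub>R norm (X i - x)" for i \<xi>
    have "(\<lambda>i. \<integral>\<xi>. R i \<xi> \<partial>M) \<longlonglongrightarrow> (\<integral>\<xi>. 0 \<partial>M)"
    proof (rule integral_dominated_convergence[where w = "\<lambda>\<xi>. 2 * D \<xi>"])
      show "AE \<xi> in M. (\<lambda>i. R i \<xi>) \<longlonglongrightarrow> 0"
      proof (intro AE_I2)
        fix \<xi>
        have "((\<lambda>y. (F y \<xi> - F x \<xi> - F' \<xi> (y - x)) /\<^sub>R norm (y - x)) \<longlongrightarrow> 0) (at x)"
          using deriv[of \<xi>] unfolding has_derivative_at_within by simp
        then show "(\<lambda>i. R i \<xi>) \<longlonglongrightarrow> 0"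
          using X unfolding tendsto_at_iff_sequentially R_def comp_def by auto
      qed
      fix i
      have "norm (F (X i) \<xi> - F x \<xi> - F' \<xi> (X i - x)) \<le> norm (X i - x) * (2 * D \<xi>)" for \<xi>
        using lip[of "X i" \<xi>] bnd[of \<xi> "X i - x"] norm_triangle_ineq4[of "F (X i) \<xi> - F x \<xi>" "F' \<xi> (X i - x)"]
        by (simp add: algebra_simps)
      moreover have "norm (X i - x) > 0" using X(1) by simp
      ultimately have "norm (R i \<xi>) \<le> 2 * D \<xi>" for \<xi>
        unfolding R_def norm_scaleR abs_inverse abs_norm_cancel
        by (simp add: pos_divide_le_eq mult_ac flip: divide_inverse_commute)
      then show "AE \<xi> in M. norm (R i \<xi>) \<le> 2 * D \<xi>" by simp
      have "R i = (\<lambda>\<xi>. (F (X i) \<xi> - F x \<xi> - F' \<xi> (X i - x)) /\<^sub>R norm (X i - x))"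
        by (simp add: R_def fun_eq_iff)
      then show "R i \<in> borel_measurable M"
        using int int' by (auto intro!: borel_measurable_integrable)
    qed (use D in auto)
    moreover have "(\<integral>\<xi>. R i \<xi> \<partial>M) = ((\<integral>\<xi>. F (X i) \<xi> \<partial>M) - (\<integral>\<xi>. F x \<xi> \<partial>M) - (\<integral>\<xi>. F' \<xi> (X i - x) \<partial>M)) /\<^sub>R norm (X i - x)" for i
      unfolding R_def using int int' by simp
    ultimately show "((\<lambda>y. ((\<integral>\<xi>. F y \<xi> \<partial>M) - (\<integral>\<xi>. F x \<xi> \<partial>M) - (\<integral>\<xi>. F' \<xi> (y - x) \<partial>M)) /\<^sub>R norm (y - x)) \<circ> X) \<longlonglongrightarrow> 0"
      by (simp add: comp_def)
  qed
  ultimately show ?thesis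
    unfolding has_derivative_at_within by simp
qed

lemma dyadic_weight_bound:
  fixes \<xi> :: "'a::euclidean_space"
  assumes "r \<ge> 0"
  shows "\<exists>n. norm \<xi> < 2 ^ n \<and> (1 + (norm \<xi>)\<^sup>2) powr (- r) \<le> 4 powr r * (4 powr (- r)) ^ n"
proof -
  have "\<exists>n. norm \<xi> < 2 ^ n" using real_arch_pow[of 2] by simp
  define n where "n = (LEAST n. norm \<xi> < 2 ^ n)"
  have n: "norm \<xi> < 2 ^ n" unfolding n_def using \<open>\<exists>n. norm \<xi> < 2 ^ n\<close> by (rule LeastI_ex)
  have "(1 + (norm \<xi>)\<^sup>2) powr (- r) \<le> 4 powr r * (4 powr (- r)) ^ n"
  proof (cases n)
    case 0
    have "(1 + (norm \<xi>)\<^sup>2) powr (- r) \<le> 1 powr (-r)"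
      using assms by (intro powr_mono2') auto
    also have "\<dots> \<le> 4 powr r" using assms by (simp add: ge_one_powr_ge_zero)
    finally show ?thesis using 0 by simp
  next
    case (Suc k)
    then have "2 ^ k \<le> norm \<xi>" using not_less_Least[of k "\<lambda>n. norm \<xi> < 2 ^ n"] unfolding n_def[symmetric] by simp
    then have "(2 ^ k)\<^sup>2 \<le> (norm \<xi>)\<^sup>2" by (intro power_mono) auto
    then have "4 ^ k \<le> 1 + (norm \<xi>)\<^sup>2"
      by (simp add: power_mult[symmetric] mult.commute[of k 2]) (simp add: power_mult)
    then have "(1 + (norm \<xi>)\<^sup>2) powr (- r) \<le> (4 ^ k) powr (-r)"
      using assms by (intro powr_mono2') auto
    also have "\<dots> = (4 powr (-r)) ^ k" by (simp add: powr_realpow[symmetric] powr_powr mult.commute)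
    also have "\<dots> = 4 powr r * (4 powr (- r)) ^ n" by (simp add: Suc powr_minus field_simps)
    finally show ?thesis .
  qed
  with n show ?thesis by blast
qed

text \<open>
  Summation over dyadic balls: on the ball of radius \<open>2\<^sup>n\<close> outside the previous one the weight is
  at most a multiple of \<open>4\<^bsup>-rn\<^esup>\<close>, while the volume is a multiple of \<open>2\<^bsup>nd\<^esup>\<close>. The resulting
  geometric series has ratio \<open>2\<^bsup>d-2r\<^esup>\<close>, which is below 1 exactly when \<open>r > d/2\<close>.
\<close>

lemma integrable_bessel_weight:
  assumes "r > real DIM('a::euclidean_space) / 2"
  shows "integrable lborel (\<lambda>\<xi>::'a. (1 + (norm \<xi>)\<^sup>2) powr (- r))"
proof -
  have r: "r > 0" using assms by (smt (verit) of_nat_0_le_iff divide_nonneg_pos)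
  let ?V = "unit_ball_vol (real DIM('a))"
  define t where "t n = 4 powr r * (4 powr (- r)) ^ n" for n :: nat
  define q where "q = 4 powr (- r) * 2 ^ DIM('a)"
  have t0: "t n \<ge> 0" for n by (simp add: t_def)
  have "q = 2 powr (- (2 * r)) * 2 powr (real DIM('a))"
    using powr_powr[of 2 2 "-r"] by (simp add: q_def powr_realpow)
  also have "\<dots> < 1"
    using assms by (simp add: powr_add[symmetric] powr_less_one)
  finally have q: "q < 1" "q \<ge> 0" by (auto simp: q_def)
  have b: "ennreal ((1 + (norm \<xi>)\<^sup>2) powr (- r)) \<le> (\<Sum>n. ennreal (t n) * indicator (ball 0 (2 ^ n)) \<xi>)" for \<xi> :: 'a
  proof -
    obtain n where n: "norm \<xi> < 2 ^ n" "(1 + (norm \<xi>)\<^sup>2) powr (- r) \<le> t n"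
      using dyadic_weight_bound[of r \<xi>] r unfolding t_def by auto
    then have "ennreal ((1 + (norm \<xi>)\<^sup>2) powr (- r)) \<le> (\<Sum>k\<in>{n}. ennreal (t k) * indicator (ball 0 (2 ^ k)) \<xi>)"
      by (auto intro: ennreal_leI)
    also have "\<dots> \<le> (\<Sum>k. ennreal (t k) * indicator (ball 0 (2 ^ k)) \<xi>)"
      by (intro sum_le_suminf) auto
    finally show ?thesis .
  qed
  have "(\<integral>\<^sup>+(\<xi>::'a). ennreal ((1 + (norm \<xi>)\<^sup>2) powr (- r)) \<partial>lborel)
      \<le> (\<integral>\<^sup>+(\<xi>::'a). (\<Sum>n. ennreal (t n) * indicator (ball 0 (2 ^ n)) \<xi>) \<partial>lborel)"
    by (intro nn_integral_mono b)
  also have "\<dots> = (\<Sum>n. \<integral>\<^sup>+(\<xi>::'a). ennreal (t n) * indicator (ball 0 (2 ^ n)) \<xi> \<partial>lborel)"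
    by (rule nn_integral_suminf) (intro borel_measurable_times_ennreal borel_measurable_const borel_measurable_indicator, simp)
  also have "\<dots> = (\<Sum>n. ennreal (4 powr r * ?V * q ^ n))"
  proof (intro suminf_cong)
    fix n
    have "(\<integral>\<^sup>+(\<xi>::'a). ennreal (t n) * indicator (ball 0 (2 ^ n)) \<xi> \<partial>lborel) = ennreal (t n) * emeasure lborel (ball (0::'a) (2 ^ n))"
      by (rule nn_integral_cmult_indicator) simp
    also have "\<dots> = ennreal (t n * (?V * (2 ^ n) ^ DIM('a)))"
      by (subst emeasure_ball) (auto simp: ennreal_mult t0)
    also have "t n * (?V * (2 ^ n) ^ DIM('a)) = 4 powr r * ?V * q ^ n"
    proof -
      have "((2::real) ^ n) ^ DIM('a) = (2 ^ DIM('a)) ^ n" by (simp add: mult.commute flip: power_mult)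
      then show ?thesis unfolding t_def q_def power_mult_distrib by simp
    qed
    finally show "(\<integral>\<^sup>+(\<xi>::'a). ennreal (t n) * indicator (ball 0 (2 ^ n)) \<xi> \<partial>lborel) = ennreal (4 powr r * ?V * q ^ n)" .
  qed
  also have "\<dots> = ennreal (\<Sum>n. 4 powr r * ?V * q ^ n)"
    using q by (intro suminf_ennreal2 summable_mult summable_geometric) auto
  finally have "(\<integral>\<^sup>+(\<xi>::'a). ennreal ((1 + (norm \<xi>)\<^sup>2) powr (- r)) \<partial>lborel) < \<infinity>"
    by (simp add: le_less_trans)
  then show ?thesis by (intro integrableI_bounded) auto
qed

lemma integrable_product_of_squares:
  fixes f g :: "'b \<Rightarrow> real"
  assumes [measurable]: "f \<in> borel_measurable M" "g \<in> borel_measurable M"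
    and f2: "integrable M (\<lambda>x. (f x)\<^sup>2)" and g2: "integrable M (\<lambda>x. (g x)\<^sup>2)"
  shows "integrable M (\<lambda>x. f x * g x)"
    "(\<integral>x. f x * g x \<partial>M)\<^sup>2 \<le> (\<integral>x. (f x)\<^sup>2 \<partial>M) * (\<integral>x. (g x)\<^sup>2 \<partial>M)"
proof -
  have "\<bar>f x * g x\<bar> \<le> (f x)\<^sup>2 + (g x)\<^sup>2" for x
  proof -
    have "2 * \<bar>f x * g x\<bar> \<le> (f x)\<^sup>2 + (g x)\<^sup>2"
      using sum_squares_bound[of "\<bar>f x\<bar>" "\<bar>g x\<bar>"] by (simp add: abs_mult)
    then show ?thesis using abs_ge_zero[of "f x * g x"] by linarith
  qed
  then show i: "integrable M (\<lambda>x. f x * g x)"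
    by (intro Bochner_Integration.integrable_bound[OF Bochner_Integration.integrable_add[OF f2 g2]]) auto
  let ?I = "\<integral>x. \<bar>f x * g x\<bar> \<partial>M"
  have "(\<integral>\<^sup>+x. ennreal \<bar>f x\<bar> * ennreal \<bar>g x\<bar> \<partial>M) = ennreal ?I"
    using integrable_abs[OF i] by (subst nn_integral_eq_integral[symmetric]) (auto simp: ennreal_mult abs_mult)
  moreover have "(\<integral>\<^sup>+x. (ennreal \<bar>f x\<bar>)\<^sup>2 \<partial>M) = ennreal (\<integral>x. (f x)\<^sup>2 \<partial>M)"
    using f2 by (subst nn_integral_eq_integral[symmetric]) (auto simp: ennreal_power)
  moreover have "(\<integral>\<^sup>+x. (ennreal \<bar>g x\<bar>)\<^sup>2 \<partial>M) = ennreal (\<integral>x. (g x)\<^sup>2 \<partial>M)"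
    using g2 by (subst nn_integral_eq_integral[symmetric]) (auto simp: ennreal_power)
  ultimately have "(ennreal ?I)\<^sup>2 \<le> ennreal (\<integral>x. (f x)\<^sup>2 \<partial>M) * ennreal (\<integral>x. (g x)\<^sup>2 \<partial>M)"
    using Cauchy_Schwarz_nn_integral[of "\<lambda>x. ennreal \<bar>f x\<bar>" M "\<lambda>x. ennreal \<bar>g x\<bar>"] by simp
  then have "?I\<^sup>2 \<le> (\<integral>x. (f x)\<^sup>2 \<partial>M) * (\<integral>x. (g x)\<^sup>2 \<partial>M)"
    by (simp add: ennreal_power ennreal_mult[symmetric])
  moreover have "(\<integral>x. f x * g x \<partial>M)\<^sup>2 \<le> ?I\<^sup>2"
    using integral_norm_bound[of M "\<lambda>x. f x * g x"] by (intro abs_le_square_iff[THEN iffD1]) simp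
  ultimately show "(\<integral>x. f x * g x \<partial>M)\<^sup>2 \<le> (\<integral>x. (f x)\<^sup>2 \<partial>M) * (\<integral>x. (g x)\<^sup>2 \<partial>M)" by linarith
qed

abbreviation bessel_density :: "real \<Rightarrow> ('a::euclidean_space \<Rightarrow> complex) \<Rightarrow> 'a \<Rightarrow> real" where
  "bessel_density s a \<xi> \<equiv> (1 + (norm \<xi>)\<^sup>2) powr s * (cmod (a \<xi>))\<^sup>2"

definition weighted_L2 :: "real \<Rightarrow> ('a::euclidean_space \<Rightarrow> complex) set" where
  "weighted_L2 s = {a. a \<in> borel_measurable lborel \<and>
     integrable lborel (\<lambda>\<xi>. bessel_density s a \<xi>)}"

lemma Hs_extensions_eq:
  "Hs_extensions s \<Omega> u = {a \<in> weighted_L2 s. \<forall>x\<in>closure \<Omega>. inverse_fourier a x = complex_of_real (u x)}"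
  by (auto simp: Hs_extensions_def weighted_L2_def)

lemma bessel_sq_norm_nonneg: "bessel_sq_norm s a \<ge> 0"
  unfolding bessel_sq_norm_def by (intro Bochner_Integration.integral_nonneg) auto

text \<open>
  The constant that Cauchy-Schwarz gives for the \<open>p\<close>-th moment of a function in \<open>weighted_L2 s\<close>.
\<close>

definition moment_const :: "'a::euclidean_space itself \<Rightarrow> real \<Rightarrow> nat \<Rightarrow> real" where
  "moment_const _ s p = sqrt (LINT \<xi>::'a|lborel. (1 + (norm \<xi>)\<^sup>2) powr (real p - s))"

text \<open>
  Cauchy-Schwarz for \<open>(1 + |\<xi>|\<^sup>2)\<^bsup>s/2\<^esup> |a \<xi>|\<close> and \<open>|\<xi>|\<^sup>p (1 + |\<xi>|\<^sup>2)\<^bsup>-s/2\<^esup>\<close>. The square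
  of the second factor is at most \<open>(1 + |\<xi>|\<^sup>2)\<^bsup>p-s\<^esup>\<close>, integrable for \<open>s > d/2 + p\<close>. The case
  \<open>p = 0\<close> bounds functions in \<open>H\<^sup>s\<close>, the case \<open>p = 1\<close> their gradients.
\<close>

lemma moment_bound:
  fixes a :: "'a::euclidean_space \<Rightarrow> complex"
  assumes a: "a \<in> weighted_L2 s" and s: "s > real DIM('a) / 2 + real p"
  shows "integrable lborel (\<lambda>\<xi>. norm \<xi> ^ p * cmod (a \<xi>))"
    and "(LINT \<xi>|lborel. norm \<xi> ^ p * cmod (a \<xi>)) \<le> moment_const TYPE('a) s p * sqrt (bessel_sq_norm s a)"
proof -
  have [measurable]: "a \<in> borel_measurable lborel" and i: "integrable lborel (\<lambda>\<xi>. bessel_density s a \<xi>)"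
    using a by (auto simp: weighted_L2_def)
  define f where "f \<xi> = (1 + (norm \<xi>)\<^sup>2) powr (s/2) * cmod (a \<xi>)" for \<xi>
  define g where "g \<xi> = norm \<xi> ^ p * (1 + (norm \<xi>)\<^sup>2) powr (- s/2)" for \<xi> :: 'a
  have [measurable]: "f \<in> borel_measurable lborel" "g \<in> borel_measurable lborel"
    unfolding f_def g_def by measurable
  have pos: "1 + (norm \<xi>)\<^sup>2 > 0" for \<xi> :: 'a by (smt (verit) zero_le_power2)
  have fg: "f \<xi> * g \<xi> = norm \<xi> ^ p * cmod (a \<xi>)" for \<xi>
    using pos[of \<xi>] by (simp add: f_def g_def powr_minus field_simps)
  have f2: "(f \<xi>)\<^sup>2 = bessel_density s a \<xi>" for \<xi>
    using pos[of \<xi>] by (simp add: f_def power_mult_distrib power2_eq_square flip: powr_add)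
  have g2: "(g \<xi>)\<^sup>2 \<le> (1 + (norm \<xi>)\<^sup>2) powr (real p - s)" for \<xi>
  proof -
    have "(norm \<xi> ^ p)\<^sup>2 \<le> (1 + (norm \<xi>)\<^sup>2) ^ p"
      using power_mono[of "(norm \<xi>)\<^sup>2" "1 + (norm \<xi>)\<^sup>2" p] by (simp add: power_mult[symmetric] mult.commute)
    then have "(g \<xi>)\<^sup>2 \<le> (1 + (norm \<xi>)\<^sup>2) ^ p * ((1 + (norm \<xi>)\<^sup>2) powr (- s/2))\<^sup>2"
      by (simp add: g_def power_mult_distrib mult_right_mono)
    also have "\<dots> = (1 + (norm \<xi>)\<^sup>2) powr (real p - s)"
      using pos[of \<xi>] by (simp add: powr_realpow[symmetric] power2_eq_square flip: powr_add)
    finally show ?thesis .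
  qed
  have w: "integrable lborel (\<lambda>\<xi>::'a. (1 + (norm \<xi>)\<^sup>2) powr (real p - s))"
    using integrable_bessel_weight[of "s - real p"] s by (simp add: algebra_simps)
  have ig: "integrable lborel (\<lambda>\<xi>. (g \<xi>)\<^sup>2)"
    by (rule Bochner_Integration.integrable_bound[OF w]) (use g2 in auto)
  have if': "integrable lborel (\<lambda>\<xi>. (f \<xi>)\<^sup>2)" using i f2 by simp
  note CS = integrable_product_of_squares[of f lborel g, OF _ _ if' ig]
  show "integrable lborel (\<lambda>\<xi>. norm \<xi> ^ p * cmod (a \<xi>))" using CS(1) fg by simp
  have "(LINT \<xi>|lborel. norm \<xi> ^ p * cmod (a \<xi>))\<^sup>2 \<le> bessel_sq_norm s a * (LINT \<xi>|lborel. (g \<xi>)\<^sup>2)"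
    using CS(2) by (simp add: fg f2 bessel_sq_norm_def)
  also have "\<dots> \<le> bessel_sq_norm s a * (LINT \<xi>::'a|lborel. (1 + (norm \<xi>)\<^sup>2) powr (real p - s))"
    by (rule mult_left_mono[OF integral_mono[OF ig w g2] bessel_sq_norm_nonneg])
  finally have "(LINT \<xi>|lborel. norm \<xi> ^ p * cmod (a \<xi>))
      \<le> sqrt (bessel_sq_norm s a * (LINT \<xi>::'a|lborel. (1 + (norm \<xi>)\<^sup>2) powr (real p - s)))"
    by (rule real_le_rsqrt)
  then show "(LINT \<xi>|lborel. norm \<xi> ^ p * cmod (a \<xi>)) \<le> moment_const TYPE('a) s p * sqrt (bessel_sq_norm s a)"
    unfolding moment_const_def real_sqrt_mult by (simp only: mult.commute)
qed

lemma integrable_inverse_fourier: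
  fixes a :: "'a::euclidean_space \<Rightarrow> complex"
  assumes a: "a \<in> weighted_L2 s" and s: "s > real DIM('a) / 2"
  shows "integrable lborel (\<lambda>\<xi>. cis (x \<bullet> \<xi>) * a \<xi>)"
proof -
  have [measurable]: "a \<in> borel_measurable lborel"
    using a by (auto simp: weighted_L2_def)
  have [measurable]: "(\<lambda>\<xi>. cis (x \<bullet> \<xi>)) \<in> borel_measurable borel"
    by (intro borel_measurable_continuous_onI continuous_intros)
  show ?thesis
  proof (rule Bochner_Integration.integrable_bound)
    show "integrable lborel (\<lambda>\<xi>. norm \<xi> ^ 0 * cmod (a \<xi>))"
      by (rule moment_bound(1)[OF a]) (use s in simp)
  qed (simp_all add: norm_mult)
qed

definition embedding_const :: "'a::euclidean_space itself \<Rightarrow> real \<Rightarrow> nat \<Rightarrow> real" where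
  "embedding_const _ s p = (2 * pi) powr (- real DIM('a) / 2) * moment_const TYPE('a) s p"

lemma embedding_const_nonneg: "embedding_const t s p \<ge> 0"
  by (auto simp: embedding_const_def moment_const_def intro!: mult_nonneg_nonneg Bochner_Integration.integral_nonneg)

lemma norm_inverse_fourier_le:
  fixes a :: "'a::euclidean_space \<Rightarrow> complex"
  assumes a: "a \<in> weighted_L2 s" and s: "s > real DIM('a) / 2"
  shows "cmod (inverse_fourier a x) \<le> embedding_const TYPE('a) s 0 * sqrt (bessel_sq_norm s a)"
proof -
  have "cmod (LINT \<xi>|lborel. cis (x \<bullet> \<xi>) * a \<xi>) \<le> (LINT \<xi>|lborel. cmod (cis (x \<bullet> \<xi>) * a \<xi>))"
    by (rule integral_norm_bound)
  also have "\<dots> \<le> moment_const TYPE('a) s 0 * sqrt (bessel_sq_norm s a)"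
    using moment_bound(2)[OF a, of 0] s by (simp add: norm_mult)
  finally show ?thesis unfolding inverse_fourier_def embedding_const_def norm_mult norm_of_real
    by (simp add: mult.assoc mult_left_mono)
qed

section \<open>The Hilbert structure of \<open>H\<^sup>s\<close>\<close>

lemma weighted_L2_add:
  assumes a: "a \<in> weighted_L2 s" and b: "b \<in> weighted_L2 s"
  shows "(\<lambda>\<xi>. a \<xi> + b \<xi>) \<in> weighted_L2 s"
proof -
  have [measurable]: "a \<in> borel_measurable lborel" "b \<in> borel_measurable lborel"
    using a b by (auto simp: weighted_L2_def)
  have "integrable lborel (\<lambda>\<xi>. (1 + (norm \<xi>)\<^sup>2) powr s * (cmod (a \<xi> + b \<xi>))\<^sup>2)"
  proof (rule Bochner_Integration.integrable_bound)
    show "integrable lborel (\<lambda>\<xi>. 2 * (bessel_density s a \<xi>) + 2 * (bessel_density s b \<xi>))"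
      using a b by (auto simp: weighted_L2_def)
    have "(cmod (a \<xi> + b \<xi>))\<^sup>2 \<le> 2 * (cmod (a \<xi>))\<^sup>2 + 2 * (cmod (b \<xi>))\<^sup>2" for \<xi>
      using power_mono[OF norm_triangle_ineq[of "a \<xi>" "b \<xi>"], of 2] sum_squares_bound[of "cmod (a \<xi>)" "cmod (b \<xi>)"]
      by (simp add: power2_sum)
    then have "(1 + (norm \<xi>)\<^sup>2) powr s * (cmod (a \<xi> + b \<xi>))\<^sup>2 \<le> (1 + (norm \<xi>)\<^sup>2) powr s * (2 * (cmod (a \<xi>))\<^sup>2 + 2 * (cmod (b \<xi>))\<^sup>2)" for \<xi>
      by (intro mult_left_mono) auto
    then show "AE \<xi> in lborel. norm ((1 + (norm \<xi>)\<^sup>2) powr s * (cmod (a \<xi> + b \<xi>))\<^sup>2)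
        \<le> norm (2 * (bessel_density s a \<xi>) + 2 * (bessel_density s b \<xi>))"
      by (intro AE_I2) (simp add: algebra_simps)
  qed simp
  then show ?thesis unfolding weighted_L2_def by simp
qed

lemma weighted_L2_scale:
  assumes a: "a \<in> weighted_L2 s"
  shows "(\<lambda>\<xi>. complex_of_real k * a \<xi>) \<in> weighted_L2 s"
    and "bessel_sq_norm s (\<lambda>\<xi>. complex_of_real k * a \<xi>) = k\<^sup>2 * bessel_sq_norm s a"
proof -
  have e: "(1 + (norm \<xi>)\<^sup>2) powr s * (cmod (complex_of_real k * a \<xi>))\<^sup>2 = k\<^sup>2 * (bessel_density s a \<xi>)" for \<xi>
    by (simp add: norm_mult power_mult_distrib)
  show "(\<lambda>\<xi>. complex_of_real k * a \<xi>) \<in> weighted_L2 s"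
    using a unfolding weighted_L2_def mem_Collect_eq e by (auto intro!: borel_measurable_times)
  show "bessel_sq_norm s (\<lambda>\<xi>. complex_of_real k * a \<xi>) = k\<^sup>2 * bessel_sq_norm s a"
    unfolding bessel_sq_norm_def e by simp
qed

lemma weighted_L2_diff:
  assumes a: "a \<in> weighted_L2 s" and b: "b \<in> weighted_L2 s"
  shows "(\<lambda>\<xi>. a \<xi> - b \<xi>) \<in> weighted_L2 s"
  using weighted_L2_add[OF a weighted_L2_scale(1)[OF b, of "-1"]] by simp

lemma weighted_L2_sum:
  assumes "\<And>i. d i \<in> weighted_L2 s"
  shows "(\<lambda>\<xi>. \<Sum>i<(n::nat). d i \<xi>) \<in> weighted_L2 s"
proof (induction n)
  case 0 show ?case by (simp add: weighted_L2_def)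
next
  case (Suc n) then show ?case using weighted_L2_add[OF Suc assms[of n]] by simp
qed

lemma bessel_parallelogram:
  fixes a b :: "'a::euclidean_space \<Rightarrow> complex"
  assumes a: "a \<in> weighted_L2 s" and b: "b \<in> weighted_L2 s"
  shows "bessel_sq_norm s (\<lambda>\<xi>. a \<xi> + b \<xi>) + bessel_sq_norm s (\<lambda>\<xi>. a \<xi> - b \<xi>)
    = 2 * bessel_sq_norm s a + 2 * bessel_sq_norm s b"
proof -
  have e: "(1 + (norm \<xi>)\<^sup>2) powr s * (cmod (a \<xi> + b \<xi>))\<^sup>2 + (1 + (norm \<xi>)\<^sup>2) powr s * (cmod (a \<xi> - b \<xi>))\<^sup>2
    = 2 * (bessel_density s a \<xi>) + 2 * (bessel_density s b \<xi>)" for \<xi>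
  proof -
    have "(cmod (a \<xi> + b \<xi>))\<^sup>2 + (cmod (a \<xi> - b \<xi>))\<^sup>2 = 2 * (cmod (a \<xi>))\<^sup>2 + 2 * (cmod (b \<xi>))\<^sup>2"
      by (simp add: cmod_power2 power2_sum power2_diff)
    then show ?thesis by (metis (no_types, lifting) distrib_left mult.left_commute)
  qed
  define W where "W c \<xi> = (1 + (norm \<xi>)\<^sup>2) powr s * (cmod (c \<xi>))\<^sup>2" for c and \<xi> :: 'a
  have i: "integrable lborel (W c)" if "c \<in> weighted_L2 s" for c
    using that by (simp add: W_def[abs_def] weighted_L2_def)
  have B: "bessel_sq_norm s c = (LINT \<xi>|lborel. W c \<xi>)" for c
    by (simp add: W_def bessel_sq_norm_def)
  have "(LINT \<xi>|lborel. W (\<lambda>\<xi>. a \<xi> + b \<xi>) \<xi> + W (\<lambda>\<xi>. a \<xi> - b \<xi>) \<xi>) = (LINT \<xi>|lborel. 2 * W a \<xi> + 2 * W b \<xi>)"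
    using e by (simp add: W_def)
  then show ?thesis
    using i[OF a] i[OF b] i[OF weighted_L2_add[OF a b]] i[OF weighted_L2_diff[OF a b]] unfolding B by simp
qed

lemma bessel_young:
  assumes a: "a \<in> weighted_L2 s" and b: "b \<in> weighted_L2 s" and t: "t > 0"
  shows "bessel_sq_norm s (\<lambda>\<xi>. a \<xi> + b \<xi>) \<le> (1 + t) * bessel_sq_norm s a + (1 + 1 / t) * bessel_sq_norm s b"
proof -
  have "(cmod (a \<xi> + b \<xi>))\<^sup>2 \<le> (1 + t) * (cmod (a \<xi>))\<^sup>2 + (1 + 1 / t) * (cmod (b \<xi>))\<^sup>2" for \<xi>
  proof -
    have "0 \<le> (t * cmod (a \<xi>) - cmod (b \<xi>))\<^sup>2 / t" using t by simp
    also have "\<dots> = t * (cmod (a \<xi>))\<^sup>2 + (cmod (b \<xi>))\<^sup>2 / t - 2 * cmod (a \<xi>) * cmod (b \<xi>)"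
      using t by (simp add: field_simps power2_eq_square)
    finally show ?thesis
      using power_mono[OF norm_triangle_ineq[of "a \<xi>" "b \<xi>"], of 2]
      by (simp add: power2_sum algebra_simps)
  qed
  then have e: "(1 + (norm \<xi>)\<^sup>2) powr s * (cmod (a \<xi> + b \<xi>))\<^sup>2
      \<le> (1 + t) * (bessel_density s a \<xi>) + (1 + 1 / t) * (bessel_density s b \<xi>)" for \<xi>
    using mult_left_mono[of "(cmod (a \<xi> + b \<xi>))\<^sup>2" "(1 + t) * (cmod (a \<xi>))\<^sup>2 + (1 + 1 / t) * (cmod (b \<xi>))\<^sup>2" "(1 + (norm \<xi>)\<^sup>2) powr s"]
    by (simp add: distrib_left mult.left_commute)
  have ia: "integrable lborel (\<lambda>\<xi>. bessel_density s a \<xi>)"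
    and ib: "integrable lborel (\<lambda>\<xi>. bessel_density s b \<xi>)"
    and iab: "integrable lborel (\<lambda>\<xi>. (1 + (norm \<xi>)\<^sup>2) powr s * (cmod (a \<xi> + b \<xi>))\<^sup>2)"
    using a b weighted_L2_add[OF a b] by (auto simp: weighted_L2_def)
  have "bessel_sq_norm s (\<lambda>\<xi>. a \<xi> + b \<xi>) \<le> (LINT \<xi>|lborel. (1 + t) * (bessel_density s a \<xi>) + (1 + 1 / t) * (bessel_density s b \<xi>))"
    unfolding bessel_sq_norm_def
    by (rule integral_mono[OF iab _ e]) (use ia ib in simp)
  then show ?thesis unfolding bessel_sq_norm_def using ia ib by simp
qed

lemma inverse_fourier_add:
  fixes a b :: "'a::euclidean_space \<Rightarrow> complex"
  assumes "a \<in> weighted_L2 s" "b \<in> weighted_L2 s" "s > real DIM('a) / 2"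
  shows "inverse_fourier (\<lambda>\<xi>. a \<xi> + b \<xi>) x = inverse_fourier a x + inverse_fourier b x"
  using integrable_inverse_fourier[of a s x] integrable_inverse_fourier[of b s x] assms
  unfolding inverse_fourier_def by (simp add: distrib_left)

lemma inverse_fourier_scale:
  "inverse_fourier (\<lambda>\<xi>. k * a \<xi>) x = k * inverse_fourier a x"
  unfolding inverse_fourier_def by (simp add: mult.left_commute)

lemma inverse_fourier_diff:
  fixes a b :: "'a::euclidean_space \<Rightarrow> complex"
  assumes "a \<in> weighted_L2 s" "b \<in> weighted_L2 s" "s > real DIM('a) / 2"
  shows "inverse_fourier (\<lambda>\<xi>. a \<xi> - b \<xi>) x = inverse_fourier a x - inverse_fourier b x"
  using integrable_inverse_fourier[of a s x] integrable_inverse_fourier[of b s x] assms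
  unfolding inverse_fourier_def by (simp add: right_diff_distrib)

lemma Hs_extensions_add:
  fixes \<Omega> :: "'a::euclidean_space set"
  assumes "a \<in> Hs_extensions s \<Omega> u" "b \<in> Hs_extensions s \<Omega> v" "s > real DIM('a) / 2"
  shows "(\<lambda>\<xi>. a \<xi> + b \<xi>) \<in> Hs_extensions s \<Omega> (\<lambda>x. u x + v x)"
  using assms inverse_fourier_add[of a s b] by (auto simp: Hs_extensions_eq weighted_L2_add)

lemma Hs_extensions_diff:
  fixes \<Omega> :: "'a::euclidean_space set"
  assumes "a \<in> Hs_extensions s \<Omega> u" "b \<in> Hs_extensions s \<Omega> v" "s > real DIM('a) / 2"
  shows "(\<lambda>\<xi>. a \<xi> - b \<xi>) \<in> Hs_extensions s \<Omega> (\<lambda>x. u x - v x)"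
  using assms inverse_fourier_diff[of a s b] by (auto simp: Hs_extensions_eq weighted_L2_diff)

lemma Hs_extensions_scale:
  fixes \<Omega> :: "'a::euclidean_space set"
  assumes "a \<in> Hs_extensions s \<Omega> u"
  shows "(\<lambda>\<xi>. complex_of_real k * a \<xi>) \<in> Hs_extensions s \<Omega> (\<lambda>x. k * u x)"
  using assms by (auto simp: Hs_extensions_eq weighted_L2_scale(1) inverse_fourier_scale)

lemma Hs_norm_nonneg: "u \<in> Hs s \<Omega> \<Longrightarrow> Hs_norm s \<Omega> u \<ge> 0"
  unfolding Hs_norm_def Hs_def by (auto intro!: cINF_greatest bessel_sq_norm_nonneg)

lemma Hs_norm_le: "a \<in> Hs_extensions s \<Omega> u \<Longrightarrow> Hs_norm s \<Omega> u \<le> sqrt (bessel_sq_norm s a)"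
  unfolding Hs_norm_def
  by (rule cINF_lower) (auto intro!: bdd_belowI[of _ 0] bessel_sq_norm_nonneg)

lemma Hs_norm_sq_le:
  assumes "a \<in> Hs_extensions s \<Omega> u" "u \<in> Hs s \<Omega>"
  shows "(Hs_norm s \<Omega> u)\<^sup>2 \<le> bessel_sq_norm s a"
  using power_mono[OF Hs_norm_le[OF assms(1)] Hs_norm_nonneg[OF assms(2)], of 2]
  by (simp add: bessel_sq_norm_nonneg)

text \<open>
  Inequalities for \<open>Hs_norm\<close> are proved for almost optimal extensions and then pass to the infimum.
\<close>

lemma Hs_extension_near:
  assumes u: "u \<in> Hs s \<Omega>" and B: "(Hs_norm s \<Omega> u)\<^sup>2 < B"
  obtains a where "a \<in> Hs_extensions s \<Omega> u" "bessel_sq_norm s a < B"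
proof -
  have "Hs_norm s \<Omega> u < sqrt B" using B by (rule real_less_rsqrt)
  moreover have "Hs_extensions s \<Omega> u \<noteq> {}" using u by (simp add: Hs_def)
  ultimately obtain a where "a \<in> Hs_extensions s \<Omega> u" "sqrt (bessel_sq_norm s a) < sqrt B"
    unfolding Hs_norm_def
    by (subst (asm) cINF_less_iff) (auto intro!: bdd_belowI[of _ 0] bessel_sq_norm_nonneg)
  then show ?thesis using that by simp
qed

lemma Hs_add:
  fixes \<Omega> :: "'a::euclidean_space set"
  assumes "u \<in> Hs s \<Omega>" "v \<in> Hs s \<Omega>" "s > real DIM('a) / 2"
  shows "(\<lambda>x. u x + v x) \<in> Hs s \<Omega>"
  using assms Hs_extensions_add[of _ s \<Omega> u _ v] by (fastforce simp: Hs_def)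

lemma Hs_diff:
  fixes \<Omega> :: "'a::euclidean_space set"
  assumes "u \<in> Hs s \<Omega>" "v \<in> Hs s \<Omega>" "s > real DIM('a) / 2"
  shows "(\<lambda>x. u x - v x) \<in> Hs s \<Omega>"
  using assms Hs_extensions_diff[of _ s \<Omega> u _ v] by (fastforce simp: Hs_def)

lemma Hs_scale:
  fixes \<Omega> :: "'a::euclidean_space set"
  assumes "u \<in> Hs s \<Omega>"
  shows "(\<lambda>x. k * u x) \<in> Hs s \<Omega>"
  using assms Hs_extensions_scale[of _ s \<Omega> u k] by (fastforce simp: Hs_def)

lemma Hs_norm_uminus_le:
  fixes \<Omega> :: "'a::euclidean_space set"
  assumes u: "u \<in> Hs s \<Omega>"
  shows "Hs_norm s \<Omega> (\<lambda>x. - u x) \<le> Hs_norm s \<Omega> u"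
proof (rule ccontr)
  assume "\<not> ?thesis"
  then have less: "(Hs_norm s \<Omega> u)\<^sup>2 < (Hs_norm s \<Omega> (\<lambda>x. - u x))\<^sup>2"
    using Hs_norm_nonneg[OF u] by (simp add: power_strict_mono)
  obtain a where a: "a \<in> Hs_extensions s \<Omega> u" "bessel_sq_norm s a < (Hs_norm s \<Omega> (\<lambda>x. - u x))\<^sup>2"
    using Hs_extension_near[OF u less] .
  have "(Hs_norm s \<Omega> (\<lambda>x. - u x))\<^sup>2 \<le> bessel_sq_norm s (\<lambda>\<xi>. complex_of_real (-1) * a \<xi>)"
    using Hs_norm_sq_le[of "\<lambda>\<xi>. complex_of_real (-1) * a \<xi>" s \<Omega> "\<lambda>x. - u x"]
      Hs_extensions_scale[OF a(1), of "-1"] Hs_scale[OF u, of "-1"] by simp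
  also have "\<dots> = bessel_sq_norm s a"
    using weighted_L2_scale(2)[of a s "-1"] a(1) by (simp add: Hs_extensions_eq)
  finally show False using a(2) by simp
qed

lemma Hs_norm_minus_commute:
  fixes \<Omega> :: "'a::euclidean_space set"
  assumes "u \<in> Hs s \<Omega>" "v \<in> Hs s \<Omega>" "s > real DIM('a) / 2"
  shows "Hs_norm s \<Omega> (\<lambda>x. u x - v x) = Hs_norm s \<Omega> (\<lambda>x. v x - u x)"
  using Hs_norm_uminus_le[OF Hs_diff[OF assms]] Hs_norm_uminus_le[OF Hs_diff[OF assms(2,1,3)]] by simp

text \<open>
  For extensions \<open>a\<close> of \<open>u\<close> and \<open>b\<close> of \<open>v\<close>, the functions \<open>(a + b) / 2\<close> and \<open>a - b\<close> extend the
  midpoint and the difference. So the parallelogram law for the Fourier transforms passes to the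
  quotient norm as an inequality, in the direction that uniform convexity requires.
\<close>

lemma Hs_midpoint:
  fixes \<Omega> :: "'a::euclidean_space set"
  assumes u: "u \<in> Hs s \<Omega>" and v: "v \<in> Hs s \<Omega>" and s: "s > real DIM('a) / 2"
  shows "(\<lambda>x. (u x + v x) / 2) \<in> Hs s \<Omega>"
    and "(Hs_norm s \<Omega> (\<lambda>x. (u x + v x) / 2))\<^sup>2 + (Hs_norm s \<Omega> (\<lambda>x. u x - v x))\<^sup>2 / 4
      \<le> ((Hs_norm s \<Omega> u)\<^sup>2 + (Hs_norm s \<Omega> v)\<^sup>2) / 2"
proof -
  show mid: "(\<lambda>x. (u x + v x) / 2) \<in> Hs s \<Omega>"
    using Hs_scale[OF Hs_add[OF u v s], of "1/2"] by simp
  show "(Hs_norm s \<Omega> (\<lambda>x. (u x + v x) / 2))\<^sup>2 + (Hs_norm s \<Omega> (\<lambda>x. u x - v x))\<^sup>2 / 4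
      \<le> ((Hs_norm s \<Omega> u)\<^sup>2 + (Hs_norm s \<Omega> v)\<^sup>2) / 2"
  proof (rule field_le_epsilon)
    fix e :: real assume e: "e > 0"
    obtain a where a: "a \<in> Hs_extensions s \<Omega> u" "bessel_sq_norm s a < (Hs_norm s \<Omega> u)\<^sup>2 + e"
      using Hs_extension_near[OF u, of "(Hs_norm s \<Omega> u)\<^sup>2 + e"] e by auto
    obtain b where b: "b \<in> Hs_extensions s \<Omega> v" "bessel_sq_norm s b < (Hs_norm s \<Omega> v)\<^sup>2 + e"
      using Hs_extension_near[OF v, of "(Hs_norm s \<Omega> v)\<^sup>2 + e"] e by auto
    have ab: "a \<in> weighted_L2 s" "b \<in> weighted_L2 s" using a b by (auto simp: Hs_extensions_eq)
    have "(\<lambda>\<xi>. complex_of_real (1/2) * (a \<xi> + b \<xi>)) \<in> Hs_extensions s \<Omega> (\<lambda>x. 1/2 * (u x + v x))"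
      by (rule Hs_extensions_scale[OF Hs_extensions_add[OF a(1) b(1) s]])
    then have "(Hs_norm s \<Omega> (\<lambda>x. (u x + v x) / 2))\<^sup>2 \<le> bessel_sq_norm s (\<lambda>\<xi>. complex_of_real (1/2) * (a \<xi> + b \<xi>))"
      using Hs_norm_sq_le[OF _ mid] by simp
    also have "\<dots> = bessel_sq_norm s (\<lambda>\<xi>. a \<xi> + b \<xi>) / 4"
      using weighted_L2_scale(2)[OF weighted_L2_add[OF ab], of "1/2"] by (simp add: power2_eq_square)
    finally have 1: "(Hs_norm s \<Omega> (\<lambda>x. (u x + v x) / 2))\<^sup>2 \<le> bessel_sq_norm s (\<lambda>\<xi>. a \<xi> + b \<xi>) / 4" .
    have 2: "(Hs_norm s \<Omega> (\<lambda>x. u x - v x))\<^sup>2 \<le> bessel_sq_norm s (\<lambda>\<xi>. a \<xi> - b \<xi>)"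
      by (rule Hs_norm_sq_le[OF Hs_extensions_diff[OF a(1) b(1) s] Hs_diff[OF u v s]])
    show "(Hs_norm s \<Omega> (\<lambda>x. (u x + v x) / 2))\<^sup>2 + (Hs_norm s \<Omega> (\<lambda>x. u x - v x))\<^sup>2 / 4
      \<le> ((Hs_norm s \<Omega> u)\<^sup>2 + (Hs_norm s \<Omega> v)\<^sup>2) / 2 + e"
      using 1 2 bessel_parallelogram[OF ab] a(2) b(2) by (simp add: field_simps)
  qed
qed

text \<open>
  This family of inequalities replaces the triangle inequality: unlike Minkowski's inequality it
  follows from a pointwise estimate, and it adds up over the components of a vector.
\<close>

lemma Hs_norm_young:
  fixes \<Omega> :: "'a::euclidean_space set"
  assumes u: "u \<in> Hs s \<Omega>" and v: "v \<in> Hs s \<Omega>" and s: "s > real DIM('a) / 2" and t: "t > 0"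
  shows "(Hs_norm s \<Omega> (\<lambda>x. u x + v x))\<^sup>2 \<le> (1 + t) * (Hs_norm s \<Omega> u)\<^sup>2 + (1 + 1 / t) * (Hs_norm s \<Omega> v)\<^sup>2"
proof (rule field_le_epsilon)
  fix e :: real assume e: "e > 0"
  define e' where "e' = e / ((1 + t) + (1 + 1 / t))"
  have pos: "(1 + t) + (1 + 1 / t) > 0" using t by (simp add: add_pos_pos)
  have e': "e' > 0" "(1 + t) * e' + (1 + 1 / t) * e' = e"
  proof -
    show "e' > 0" using e pos by (simp add: e'_def)
    have "(1 + t) * e' + (1 + 1 / t) * e' = ((1 + t) + (1 + 1 / t)) * e'" by (simp only: distrib_right)
    then show "(1 + t) * e' + (1 + 1 / t) * e' = e" using pos unfolding e'_def by simp
  qed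
  obtain a where a: "a \<in> Hs_extensions s \<Omega> u" "bessel_sq_norm s a < (Hs_norm s \<Omega> u)\<^sup>2 + e'"
    using Hs_extension_near[OF u, of "(Hs_norm s \<Omega> u)\<^sup>2 + e'"] e' by auto
  obtain b where b: "b \<in> Hs_extensions s \<Omega> v" "bessel_sq_norm s b < (Hs_norm s \<Omega> v)\<^sup>2 + e'"
    using Hs_extension_near[OF v, of "(Hs_norm s \<Omega> v)\<^sup>2 + e'"] e' by auto
  have ab: "a \<in> weighted_L2 s" "b \<in> weighted_L2 s" using a b by (auto simp: Hs_extensions_eq)
  have "(Hs_norm s \<Omega> (\<lambda>x. u x + v x))\<^sup>2 \<le> bessel_sq_norm s (\<lambda>\<xi>. a \<xi> + b \<xi>)"
    by (rule Hs_norm_sq_le[OF Hs_extensions_add[OF a(1) b(1) s] Hs_add[OF u v s]])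
  also have "\<dots> \<le> (1 + t) * bessel_sq_norm s a + (1 + 1 / t) * bessel_sq_norm s b"
    by (rule bessel_young[OF ab t])
  also have "\<dots> \<le> (1 + t) * ((Hs_norm s \<Omega> u)\<^sup>2 + e') + (1 + 1 / t) * ((Hs_norm s \<Omega> v)\<^sup>2 + e')"
    using a(2) b(2) t by (intro add_mono mult_left_mono) auto
  also have "\<dots> = (1 + t) * (Hs_norm s \<Omega> u)\<^sup>2 + (1 + 1 / t) * (Hs_norm s \<Omega> v)\<^sup>2 + e"
    using e'(2) by (simp only: distrib_left)
  finally show "(Hs_norm s \<Omega> (\<lambda>x. u x + v x))\<^sup>2 \<le> (1 + t) * (Hs_norm s \<Omega> u)\<^sup>2 + (1 + 1 / t) * (Hs_norm s \<Omega> v)\<^sup>2 + e" .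
qed

text \<open>
  Bounds by the norm of an arbitrary extension hold with the infimum as well. The degenerate case
  \<open>K = 0\<close> is separate because the proof divides by \<open>K\<close>.
\<close>

lemma le_Hs_norm_by_extensions:
  assumes u: "u \<in> Hs s \<Omega>" and K: "K \<ge> 0"
    and b: "\<And>a. a \<in> Hs_extensions s \<Omega> u \<Longrightarrow> y \<le> K * sqrt (bessel_sq_norm s a)"
  shows "y \<le> K * Hs_norm s \<Omega> u"
proof -
  have ne: "Hs_extensions s \<Omega> u \<noteq> {}" using u by (simp add: Hs_def)
  show ?thesis
  proof (cases "K = 0")
    case True then show ?thesis using b ne by fastforce
  next
    case False
    then have "K > 0" using K by linarith
    then have "y / K \<le> Hs_norm s \<Omega> u"
      unfolding Hs_norm_def using b ne
      by (intro cINF_greatest) (auto simp: pos_divide_le_eq mult.commute)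
    then show ?thesis using \<open>K > 0\<close> by (simp add: pos_divide_le_eq mult.commute)
  qed
qed

lemma Hs_sup_bound:
  fixes \<Omega> :: "'a::euclidean_space set"
  assumes u: "u \<in> Hs s \<Omega>" and s: "s > real DIM('a) / 2"
  shows "\<bar>u x\<bar> \<le> embedding_const TYPE('a) s 0 * Hs_norm s \<Omega> u"
proof (cases "x \<in> closure \<Omega>")
  case False
  then show ?thesis
    using u by (simp add: Hs_def embedding_const_nonneg Hs_norm_nonneg[OF u])
next
  case True
  show ?thesis
  proof (rule le_Hs_norm_by_extensions[OF u embedding_const_nonneg])
    fix a assume "a \<in> Hs_extensions s \<Omega> u"
    then show "\<bar>u x\<bar> \<le> embedding_const TYPE('a) s 0 * sqrt (bessel_sq_norm s a)"
      using True norm_inverse_fourier_le[of a s x, OF _ s] by (auto simp: Hs_extensions_eq)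
  qed
qed

section \<open>Completeness of \<open>H\<^sup>s\<close> and the embedding into \<open>C\<^sup>1\<close>\<close>

lemma sum_sq_le_weighted:
  fixes x :: "nat \<Rightarrow> real" and r :: real
  assumes "r > 0"
  shows "(\<Sum>j<m. x j)\<^sup>2 \<le> (\<Sum>j<m. r ^ (j + n)) * (\<Sum>j<m. (x j)\<^sup>2 / r ^ (j + n))"
proof -
  have p: "r ^ k > 0" for k using assms by simp
  have "(\<Sum>j<m. x j) = (\<Sum>j<m. sqrt (r ^ (j + n)) * (x j / sqrt (r ^ (j + n))))"
    using assms by (intro sum.cong) auto
  also have "\<dots>\<^sup>2 \<le> (\<Sum>j<m. (sqrt (r ^ (j + n)))\<^sup>2) * (\<Sum>j<m. (x j / sqrt (r ^ (j + n)))\<^sup>2)"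
    by (rule Cauchy_Schwarz_ineq_sum)
  also have "\<dots> = (\<Sum>j<m. r ^ (j + n)) * (\<Sum>j<m. (x j)\<^sup>2 / r ^ (j + n))"
    using p by (simp add: power_divide less_imp_le)
  finally show ?thesis .
qed

text \<open>
  A Riesz-Fischer theorem with a rate. The pointwise Cauchy-Schwarz inequality
  \<open>(\<Sum>\<^sub>j |d\<^sub>j|)\<^sup>2 \<le> (\<Sum>\<^sub>j r\<^sup>j) (\<Sum>\<^sub>j |d\<^sub>j|\<^sup>2 / r\<^sup>j)\<close> reduces everything to the single function
  \<open>h\<close>, the weighted sum on the right, whose integral is finite by monotone convergence. Where \<open>h\<close> is finite
  the series converges absolutely, and its tails are controlled by \<open>r\<^sup>n h\<close>.
\<close>

lemma weighted_L2_series: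
  fixes d :: "nat \<Rightarrow> 'a::euclidean_space \<Rightarrow> complex"
  assumes d: "\<And>k. d k \<in> weighted_L2 s" and B: "\<And>k. bessel_sq_norm s (d k) \<le> A * r ^ k * r ^ k"
    and r: "0 < r" "r < 1"
  shows "\<exists>c\<in>weighted_L2 s. \<exists>K. \<forall>n. bessel_sq_norm s (\<lambda>\<xi>. c \<xi> - (\<Sum>j<n. d j \<xi>)) \<le> K * r ^ n"
proof -
  define w where "w \<xi> = (1 + (norm \<xi>)\<^sup>2) powr s" for \<xi> :: 'a
  have w: "w \<xi> > 0" for \<xi> unfolding w_def by (smt (verit) powr_gt_zero zero_le_power2)
  have [measurable]: "w \<in> borel_measurable borel" unfolding w_def by measurable
  have [measurable]: "d k \<in> borel_measurable borel" for k using d[of k] by (simp add: weighted_L2_def)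
  have di: "integrable lborel (\<lambda>\<xi>. w \<xi> * (cmod (d k \<xi>))\<^sup>2)" for k
    using d[of k] by (simp add: weighted_L2_def w_def)
  define f where "f j \<xi> = w \<xi> * (cmod (d j \<xi>))\<^sup>2 / r ^ j" for j \<xi>
  have f0: "f j \<xi> \<ge> 0" for j \<xi> using w[of \<xi>] r by (simp add: f_def)
  have [measurable]: "f j \<in> borel_measurable borel" for j unfolding f_def by measurable
  define h where "h \<xi> = (\<Sum>j. ennreal (f j \<xi>))" for \<xi>
  have [measurable]: "h \<in> borel_measurable borel" unfolding h_def by measurable
  have A: "A \<ge> 0" using B[of 0] bessel_sq_norm_nonneg[of s "d 0"] by simp
  have "(\<integral>\<^sup>+\<xi>. h \<xi> \<partial>lborel) = (\<Sum>j. \<integral>\<^sup>+\<xi>. ennreal (f j \<xi>) \<partial>lborel)"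
    unfolding h_def by (rule nn_integral_suminf) simp
  also have "\<dots> \<le> (\<Sum>j. ennreal (A * r ^ j))"
  proof (intro suminf_le summableI)
    fix j
    have "(\<integral>\<^sup>+\<xi>. ennreal (f j \<xi>) \<partial>lborel) = ennreal (bessel_sq_norm s (d j) / r ^ j)"
      using di[of j] f0 unfolding f_def bessel_sq_norm_def w_def[symmetric]
      by (subst nn_integral_eq_integral) auto
    also have "\<dots> \<le> ennreal (A * r ^ j)"
      using B[of j] r by (intro ennreal_leI) (simp add: field_simps)
    finally show "(\<integral>\<^sup>+\<xi>. ennreal (f j \<xi>) \<partial>lborel) \<le> ennreal (A * r ^ j)" .
  qed
  also have "\<dots> = ennreal (\<Sum>j. A * r ^ j)"
    using A r by (intro suminf_ennreal2 summable_mult summable_geometric) auto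
  also have "(\<Sum>j. A * r ^ j) = A / (1 - r)"
    using r by (subst suminf_mult) (auto simp: suminf_geometric summable_geometric)
  finally have hint: "(\<integral>\<^sup>+\<xi>. h \<xi> \<partial>lborel) \<le> ennreal (A / (1 - r))" .
  then have "(\<integral>\<^sup>+\<xi>. h \<xi> \<partial>lborel) \<noteq> \<infinity>" by (auto simp: top_unique)
  then have AEh: "AE \<xi> in lborel. h \<xi> \<noteq> \<infinity>"
    by (intro nn_integral_noteq_infinite) auto
  define c where "c \<xi> = (\<Sum>j. d j \<xi>)" for \<xi>
  have [measurable]: "c \<in> borel_measurable borel" unfolding c_def by measurable
  have tail: "ennreal (w \<xi> * (cmod (c \<xi> - (\<Sum>j<n. d j \<xi>)))\<^sup>2) \<le> ennreal (r ^ n / (1 - r)) * h \<xi>"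
    if "h \<xi> \<noteq> \<infinity>" for \<xi> n
  proof -
    have sf: "summable (\<lambda>j. f j \<xi>)"
      using that f0 by (intro summable_suminf_not_top) (auto simp: h_def)
    have h: "h \<xi> = ennreal (\<Sum>j. f j \<xi>)"
      unfolding h_def by (rule suminf_ennreal2[OF f0 sf])
    have "cmod (d j \<xi>) \<le> r ^ j + f j \<xi> / w \<xi>" for j
    proof -
      have p: "r ^ j > 0" using r by simp
      have "x \<le> r ^ j + x\<^sup>2 / r ^ j" if "x \<ge> 0" for x
      proof (cases "x \<le> r ^ j")
        case True then show ?thesis using p by (smt (verit) divide_nonneg_pos zero_le_power2)
      next
        case False
        then have "r ^ j * x \<le> x * x" using that by (intro mult_right_mono) auto
        then have "x \<le> x\<^sup>2 / r ^ j" using p by (simp add: pos_le_divide_eq power2_eq_square mult.commute)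
        then show ?thesis using p by linarith
      qed
      then show ?thesis using w[of \<xi>] by (simp add: f_def)
    qed
    then have sd: "summable (\<lambda>j. cmod (d j \<xi>))"
      using r by (intro summable_comparison_test'[OF summable_add[OF summable_geometric[of r] summable_divide[OF sf, of "w \<xi>"]], of 0]) auto
    then have sm: "(\<lambda>m. \<Sum>j<m. d (j + n) \<xi>) \<longlonglongrightarrow> c \<xi> - (\<Sum>j<n. d j \<xi>)"
      using sums_split_initial_segment[OF summable_sums[OF summable_norm_cancel[OF sd]], of n]
      unfolding sums_def c_def by simp
    have "w \<xi> * (cmod (\<Sum>j<m. d (j + n) \<xi>))\<^sup>2 \<le> r ^ n / (1 - r) * (\<Sum>j. f j \<xi>)" for m
    proof -
      have "(cmod (\<Sum>j<m. d (j + n) \<xi>))\<^sup>2 \<le> (\<Sum>j<m. cmod (d (j + n) \<xi>))\<^sup>2"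
        by (intro power_mono norm_sum) auto
      also have "\<dots> \<le> (\<Sum>j<m. r ^ (j + n)) * (\<Sum>j<m. (cmod (d (j + n) \<xi>))\<^sup>2 / r ^ (j + n))"
        by (rule sum_sq_le_weighted[OF r(1)])
      finally have "w \<xi> * (cmod (\<Sum>j<m. d (j + n) \<xi>))\<^sup>2 \<le> w \<xi> * ((\<Sum>j<m. r ^ (j + n)) * (\<Sum>j<m. (cmod (d (j + n) \<xi>))\<^sup>2 / r ^ (j + n)))"
        using w[of \<xi>] by (intro mult_left_mono) auto
      also have "\<dots> = (\<Sum>j<m. r ^ (j + n)) * (\<Sum>j<m. f (j + n) \<xi>)"
        by (simp add: f_def sum_distrib_left mult_ac)
      also have "\<dots> \<le> r ^ n / (1 - r) * (\<Sum>j. f j \<xi>)"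
      proof (intro mult_mono)
        have "(\<Sum>j<m. r ^ (j + n)) = r ^ n * (\<Sum>j<m. r ^ j)" by (simp add: power_add sum_distrib_left mult.commute)
        also have "(\<Sum>j<m. r ^ j) \<le> (\<Sum>j. r ^ j)"
          using r by (intro sum_le_suminf summable_geometric) auto
        finally show "(\<Sum>j<m. r ^ (j + n)) \<le> r ^ n / (1 - r)"
          using r by (simp add: suminf_geometric)
        have "(\<Sum>j<m. f (j + n) \<xi>) = (\<Sum>j\<in>{n..<m+n}. f j \<xi>)"
          using sum.shift_bounds_nat_ivl[of "\<lambda>j. f j \<xi>" 0 n m] by (simp add: atLeast0LessThan)
        also have "\<dots> \<le> (\<Sum>j. f j \<xi>)"
          using sf f0 by (intro sum_le_suminf) auto
        finally show "(\<Sum>j<m. f (j + n) \<xi>) \<le> (\<Sum>j. f j \<xi>)" .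
      qed (use r f0 in \<open>auto intro!: sum_nonneg\<close>)
      finally show ?thesis .
    qed
    then have "w \<xi> * (cmod (c \<xi> - (\<Sum>j<n. d j \<xi>)))\<^sup>2 \<le> r ^ n / (1 - r) * (\<Sum>j. f j \<xi>)"
      by (intro LIMSEQ_le_const2[OF tendsto_mult[OF tendsto_const tendsto_power[OF tendsto_norm[OF sm]]]]) blast
    then have "ennreal (w \<xi> * (cmod (c \<xi> - (\<Sum>j<n. d j \<xi>)))\<^sup>2) \<le> ennreal (r ^ n / (1 - r) * (\<Sum>j. f j \<xi>))"
      by (rule ennreal_leI)
    also have "\<dots> = ennreal (r ^ n / (1 - r)) * h \<xi>"
      unfolding h using r suminf_nonneg[OF sf f0] by (intro ennreal_mult) auto
    finally show ?thesis .
  qed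
  have T: "(\<lambda>\<xi>. c \<xi> - (\<Sum>j<n. d j \<xi>)) \<in> weighted_L2 s \<and>
      bessel_sq_norm s (\<lambda>\<xi>. c \<xi> - (\<Sum>j<n. d j \<xi>)) \<le> A / (1 - r) / (1 - r) * r ^ n" for n
  proof -
    have "(\<integral>\<^sup>+\<xi>. ennreal (w \<xi> * (cmod (c \<xi> - (\<Sum>j<n. d j \<xi>)))\<^sup>2) \<partial>lborel) \<le> (\<integral>\<^sup>+\<xi>. ennreal (r ^ n / (1 - r)) * h \<xi> \<partial>lborel)"
      by (rule nn_integral_mono_AE, rule eventually_mono[OF AEh]) (rule tail)
    also have "\<dots> = ennreal (r ^ n / (1 - r)) * (\<integral>\<^sup>+\<xi>. h \<xi> \<partial>lborel)"
      by (rule nn_integral_cmult) simp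
    also have "\<dots> \<le> ennreal (r ^ n / (1 - r)) * ennreal (A / (1 - r))"
      by (rule mult_left_mono[OF hint]) simp
    also have "\<dots> = ennreal (A / (1 - r) / (1 - r) * r ^ n)"
      using r A by (subst ennreal_mult[symmetric]) (auto simp: mult_ac)
    finally have le: "(\<integral>\<^sup>+\<xi>. ennreal (w \<xi> * (cmod (c \<xi> - (\<Sum>j<n. d j \<xi>)))\<^sup>2) \<partial>lborel) \<le> ennreal (A / (1 - r) / (1 - r) * r ^ n)" .
    then have i: "integrable lborel (\<lambda>\<xi>. w \<xi> * (cmod (c \<xi> - (\<Sum>j<n. d j \<xi>)))\<^sup>2)"
      using w by (intro integrableI_bounded) (auto simp: less_imp_le abs_mult le_less_trans)
    have "ennreal (LINT \<xi>|lborel. w \<xi> * (cmod (c \<xi> - (\<Sum>j<n. d j \<xi>)))\<^sup>2) \<le> ennreal (A / (1 - r) / (1 - r) * r ^ n)"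
      using le i w by (subst nn_integral_eq_integral[symmetric]) (auto simp: less_imp_le)
    then have "bessel_sq_norm s (\<lambda>\<xi>. c \<xi> - (\<Sum>j<n. d j \<xi>)) \<le> A / (1 - r) / (1 - r) * r ^ n"
      unfolding bessel_sq_norm_def w_def[symmetric] using A r by (subst (asm) ennreal_le_iff) auto
    then show ?thesis using i unfolding weighted_L2_def w_def by simp
  qed
  show ?thesis
    using T[of 0] T by (intro bexI[of _ c] exI[of _ "A / (1 - r) / (1 - r)"]) auto
qed

text \<open>
  Lift the increments to nearly optimal extensions and sum these. The inverse Fourier integral of
  the limit is real on the closure of \<Omega> because it is a pointwise limit of the real functions
  \<open>u n\<close> there. Cauchy sequences enter in the form of geometrically decaying increments, which is how
  minimizing sequences and fixed point iterations provide them.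
\<close>

lemma Hs_complete:
  fixes \<Omega> :: "'a::euclidean_space set" and u :: "nat \<Rightarrow> 'a \<Rightarrow> real"
  assumes u: "\<And>k. u k \<in> Hs s \<Omega>" and s: "s > real DIM('a) / 2"
    and inc: "\<And>k. Hs_norm s \<Omega> (\<lambda>x. u (Suc k) x - u k x) \<le> A * q ^ k" and q: "0 < q" "q < 1"
  shows "\<exists>v\<in>Hs s \<Omega>. (\<lambda>k. Hs_norm s \<Omega> (\<lambda>x. u k x - v x)) \<longlonglongrightarrow> 0"
proof -
  \<comment> \<open>Enlarged to be positive, so that the extensions below can satisfy a strict bound.\<close>
  define A' where "A' = \<bar>A\<bar> + 1"
  have "\<exists>a\<in>Hs_extensions s \<Omega> (\<lambda>x. u (Suc k) x - u k x). bessel_sq_norm s a < (2 * A') ^ 2 * q ^ k * q ^ k" for k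
  proof -
    have "A * q ^ k \<le> A' * q ^ k" "0 < A' * q ^ k" using q by (auto simp: A'_def)
    then have "Hs_norm s \<Omega> (\<lambda>x. u (Suc k) x - u k x) < 2 * A' * q ^ k" using inc[of k] by linarith
    then have "(Hs_norm s \<Omega> (\<lambda>x. u (Suc k) x - u k x))\<^sup>2 < (2 * A' * q ^ k)\<^sup>2"
      by (intro power_strict_mono Hs_norm_nonneg Hs_diff u s) auto
    also have "(2 * A' * q ^ k)\<^sup>2 = (2 * A') ^ 2 * q ^ k * q ^ k" by (simp add: power2_eq_square)
    finally have less: "(Hs_norm s \<Omega> (\<lambda>x. u (Suc k) x - u k x))\<^sup>2 < (2 * A') ^ 2 * q ^ k * q ^ k" .
    show ?thesis by (rule Hs_extension_near[OF Hs_diff[OF u u s] less]) blast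
  qed
  then obtain d where d: "\<And>k. d k \<in> Hs_extensions s \<Omega> (\<lambda>x. u (Suc k) x - u k x)"
    "\<And>k. bessel_sq_norm s (d k) < (2 * A') ^ 2 * q ^ k * q ^ k" by metis
  have dL: "d k \<in> weighted_L2 s" for k using d(1)[of k] by (simp add: Hs_extensions_eq)
  obtain c K where c: "c \<in> weighted_L2 s" "\<And>n. bessel_sq_norm s (\<lambda>\<xi>. c \<xi> - (\<Sum>j<n. d j \<xi>)) \<le> K * q ^ n"
    using weighted_L2_series[of d s, OF dL less_imp_le[OF d(2)] q] by blast
  obtain a where a: "a \<in> Hs_extensions s \<Omega> (u 0)" using u[of 0] by (auto simp: Hs_def)
  have aL: "a \<in> weighted_L2 s" using a by (simp add: Hs_extensions_eq)
  have partial: "inverse_fourier (\<lambda>\<xi>. \<Sum>j<n. d j \<xi>) x = complex_of_real (u n x - u 0 x)" if "x \<in> closure \<Omega>" for x n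
  proof (induction n)
    case 0 show ?case by (simp add: inverse_fourier_def)
  next
    case (Suc n)
    have "inverse_fourier (\<lambda>\<xi>. \<Sum>j<Suc n. d j \<xi>) x = inverse_fourier (\<lambda>\<xi>. \<Sum>j<n. d j \<xi>) x + inverse_fourier (d n) x"
      using inverse_fourier_add[OF weighted_L2_sum[of d s n, OF dL] dL[of n] s] by simp
    then show ?case using Suc d(1)[of n] that by (simp add: Hs_extensions_eq)
  qed
  define b where "b = (\<lambda>\<xi>. a \<xi> + c \<xi>)"
  have bL: "b \<in> weighted_L2 s" unfolding b_def by (rule weighted_L2_add[OF aL c(1)])
  have tL: "(\<lambda>\<xi>. c \<xi> - (\<Sum>j<n. d j \<xi>)) \<in> weighted_L2 s" for n
    by (rule weighted_L2_diff[OF c(1) weighted_L2_sum[of d s n, OF dL]])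
  have tail: "inverse_fourier (\<lambda>\<xi>. c \<xi> - (\<Sum>j<n. d j \<xi>)) x = inverse_fourier b x - complex_of_real (u n x)"
    if "x \<in> closure \<Omega>" for x n
    using inverse_fourier_diff[OF c(1) weighted_L2_sum[of d s n, OF dL] s] partial[OF that, of n]
      inverse_fourier_add[OF aL c(1) s, of x] a that
    by (simp add: b_def Hs_extensions_eq)
  have K0: "(\<lambda>n. sqrt (K * q ^ n)) \<longlonglongrightarrow> 0"
    using tendsto_real_sqrt[OF tendsto_mult_right_zero[OF LIMSEQ_realpow_zero[OF less_imp_le[OF q(1)] q(2)], of K]] by simp
  have lim: "(\<lambda>n. complex_of_real (u n x)) \<longlonglongrightarrow> inverse_fourier b x" if x: "x \<in> closure \<Omega>" for x
  proof -
    let ?k = "embedding_const TYPE('a) s 0"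
    have "cmod (inverse_fourier b x - complex_of_real (u n x)) \<le> ?k * sqrt (K * q ^ n)" for n
    proof -
      have "cmod (inverse_fourier b x - complex_of_real (u n x)) \<le> ?k * sqrt (bessel_sq_norm s (\<lambda>\<xi>. c \<xi> - (\<Sum>j<n. d j \<xi>)))"
        using norm_inverse_fourier_le[OF tL s, of n x] unfolding tail[OF x] .
      also have "\<dots> \<le> ?k * sqrt (K * q ^ n)"
        using c(2)[of n] by (intro mult_left_mono embedding_const_nonneg) auto
      finally show ?thesis .
    qed
    then have "(\<lambda>n. inverse_fourier b x - complex_of_real (u n x)) \<longlonglongrightarrow> 0"
      by (intro Lim_null_comparison[OF always_eventually tendsto_mult_right_zero[OF K0, of ?k]] allI)
    then show ?thesis using tendsto_diff[OF tendsto_const[of "inverse_fourier b x"]] by fastforce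
  qed
  define v where "v x = (if x \<in> closure \<Omega> then Re (inverse_fourier b x) else 0)" for x
  have bv: "inverse_fourier b x = complex_of_real (v x)" if x: "x \<in> closure \<Omega>" for x
  proof -
    have "(\<lambda>n. Im (complex_of_real (u n x))) \<longlonglongrightarrow> Im (inverse_fourier b x)"
      by (rule tendsto_Im[OF lim[OF x]])
    then have "Im (inverse_fourier b x) = 0" by (simp add: LIMSEQ_const_iff)
    then show ?thesis using x by (simp add: v_def complex_eq_iff)
  qed
  have "b \<in> Hs_extensions s \<Omega> v" using bL bv by (simp add: Hs_extensions_eq)
  then have v: "v \<in> Hs s \<Omega>" by (auto simp: Hs_def v_def)
  have "Hs_norm s \<Omega> (\<lambda>x. u n x - v x) \<le> sqrt (K * q ^ n)" for n
  proof -
    have "(\<lambda>\<xi>. c \<xi> - (\<Sum>j<n. d j \<xi>)) \<in> Hs_extensions s \<Omega> (\<lambda>x. v x - u n x)"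
      using tL tail bv by (simp add: Hs_extensions_eq)
    then have "Hs_norm s \<Omega> (\<lambda>x. v x - u n x) \<le> sqrt (bessel_sq_norm s (\<lambda>\<xi>. c \<xi> - (\<Sum>j<n. d j \<xi>)))"
      by (rule Hs_norm_le)
    also have "\<dots> \<le> sqrt (K * q ^ n)" using c(2) by simp
    finally show ?thesis using Hs_norm_minus_commute[OF u v s] by simp
  qed
  moreover have "Hs_norm s \<Omega> (\<lambda>x. u n x - v x) \<ge> 0" for n by (rule Hs_norm_nonneg[OF Hs_diff[OF u v s]])
  ultimately have "(\<lambda>k. Hs_norm s \<Omega> (\<lambda>x. u k x - v x)) \<longlonglongrightarrow> 0"
    by (intro Lim_null_comparison[OF _ K0]) auto
  with v show ?thesis by blast
qed

lemma norm_cis_diff_le: "cmod (cis a - cis b) \<le> \<bar>a - b\<bar>"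
proof -
  have "cis a - cis b = cis ((a + b) / 2) * (2 * \<i> * complex_of_real (sin ((a - b) / 2)))"
  proof (rule complex_eqI)
    have "sin ((b - a) / 2) = - sin ((a - b) / 2)"
      using sin_minus[of "(a - b) / 2"] by (simp only: minus_divide_left minus_diff_eq)
    then show "Re (cis a - cis b) = Re (cis ((a + b) / 2) * (2 * \<i> * complex_of_real (sin ((a - b) / 2))))"
      by (simp add: cos_diff_cos[of a b])
    show "Im (cis a - cis b) = Im (cis ((a + b) / 2) * (2 * \<i> * complex_of_real (sin ((a - b) / 2))))"
      by (simp add: sin_diff_sin[of a b])
  qed
  then have "cmod (cis a - cis b) = 2 * \<bar>sin ((a - b) / 2)\<bar>"
    by (simp add: norm_mult)
  also have "\<dots> \<le> \<bar>a - b\<bar>" using abs_sin_x_le_abs_x[of "(a - b) / 2"] by simp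
  finally show ?thesis .
qed

text \<open>
  Differentiation under the integral sign. It requires \<open>|\<xi>| |a \<xi>|\<close> to be integrable, which is the
  first moment and the reason for \<open>s > d/2 + 1\<close>.
\<close>

lemma inverse_fourier_has_derivative:
  fixes a :: "'a::euclidean_space \<Rightarrow> complex"
  assumes a: "a \<in> weighted_L2 s" and s: "s > real DIM('a) / 2 + 1"
  shows "(inverse_fourier a has_derivative
    (\<lambda>h. of_real ((2 * pi) powr (- real DIM('a) / 2)) * (LINT \<xi>|lborel. \<i> * of_real (h \<bullet> \<xi>) * (cis (x \<bullet> \<xi>) * a \<xi>)))) (at x)"
proof -
  have [measurable]: "a \<in> borel_measurable borel" using a by (simp add: weighted_L2_def)
  have [measurable]: "(\<lambda>\<xi>. cis (x \<bullet> \<xi>)) \<in> borel_measurable borel" for x :: 'a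
    by (intro borel_measurable_continuous_onI continuous_intros)
  have D: "integrable lborel (\<lambda>\<xi>. norm \<xi> * cmod (a \<xi>))"
    using moment_bound(1)[OF a, of 1] s by simp
  have b: "cmod (\<i> * of_real (h \<bullet> \<xi>) * (cis (x \<bullet> \<xi>) * a \<xi>)) \<le> norm h * (norm \<xi> * cmod (a \<xi>))" for h \<xi>
    using mult_right_mono[OF Cauchy_Schwarz_ineq2[of h \<xi>], of "cmod (a \<xi>)"] by (simp add: norm_mult mult.assoc)
  have "((\<lambda>y. LINT \<xi>|lborel. cis (y \<bullet> \<xi>) * a \<xi>) has_derivative
      (\<lambda>h. LINT \<xi>|lborel. \<i> * of_real (h \<bullet> \<xi>) * (cis (x \<bullet> \<xi>) * a \<xi>))) (at x)"
  proof (rule has_derivative_lebesgue_integral[OF _ _ D])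
    show "integrable lborel (\<lambda>\<xi>. cis (y \<bullet> \<xi>) * a \<xi>)" for y
      using integrable_inverse_fourier[OF a] s by simp
    show "integrable lborel (\<lambda>\<xi>. \<i> * of_real (h \<bullet> \<xi>) * (cis (x \<bullet> \<xi>) * a \<xi>))" for h
    proof (rule Bochner_Integration.integrable_bound)
      show "integrable lborel (\<lambda>\<xi>. norm h * (norm \<xi> * cmod (a \<xi>)))" using D by simp
      show "AE \<xi> in lborel. norm (\<i> * of_real (h \<bullet> \<xi>) * (cis (x \<bullet> \<xi>) * a \<xi>)) \<le> norm (norm h * (norm \<xi> * cmod (a \<xi>)))"
        using b by simp
    qed simp
    show "((\<lambda>y. cis (y \<bullet> \<xi>) * a \<xi>) has_derivative (\<lambda>h. \<i> * of_real (h \<bullet> \<xi>) * (cis (x \<bullet> \<xi>) * a \<xi>))) (at x)" for \<xi>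
      by (auto intro!: derivative_eq_intros simp: scaleR_conv_of_real)
    show "cmod (cis (y \<bullet> \<xi>) * a \<xi> - cis (x \<bullet> \<xi>) * a \<xi>) \<le> norm (y - x) * (norm \<xi> * cmod (a \<xi>))" for y \<xi>
    proof -
      have "cmod (cis (y \<bullet> \<xi>) * a \<xi> - cis (x \<bullet> \<xi>) * a \<xi>) = cmod (cis (y \<bullet> \<xi>) - cis (x \<bullet> \<xi>)) * cmod (a \<xi>)"
        by (simp add: norm_mult[symmetric] left_diff_distrib)
      also have "\<dots> \<le> \<bar>y \<bullet> \<xi> - x \<bullet> \<xi>\<bar> * cmod (a \<xi>)" by (intro mult_right_mono norm_cis_diff_le) simp
      also have "\<dots> \<le> norm (y - x) * norm \<xi> * cmod (a \<xi>)"
        using Cauchy_Schwarz_ineq2[of "y - x" \<xi>] by (intro mult_right_mono) (auto simp: inner_diff_left)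
      finally show ?thesis by (simp add: mult.assoc)
    qed
  qed (use b in auto)
  then have "((\<lambda>y. complex_of_real ((2 * pi) powr (- real DIM('a) / 2)) * (LINT \<xi>|lborel. cis (y \<bullet> \<xi>) * a \<xi>)) has_derivative
    (\<lambda>h. of_real ((2 * pi) powr (- real DIM('a) / 2)) * (LINT \<xi>|lborel. \<i> * of_real (h \<bullet> \<xi>) * (cis (x \<bullet> \<xi>) * a \<xi>)))) (at x)"
    by (rule has_derivative_mult_right)
  then show ?thesis unfolding inverse_fourier_def[abs_def] .
qed

lemma Hs_frechet_derivative:
  fixes \<Omega> :: "'a::euclidean_space set"
  assumes a: "a \<in> Hs_extensions s \<Omega> u" and s: "s > real DIM('a) / 2 + 1" and x: "open \<Omega>" "x \<in> \<Omega>"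
  shows "u differentiable (at x)"
    and "frechet_derivative u (at x) h = (2 * pi) powr (- real DIM('a) / 2) * Re (LINT \<xi>|lborel. \<i> * of_real (h \<bullet> \<xi>) * (cis (x \<bullet> \<xi>) * a \<xi>))"
proof -
  have aL: "a \<in> weighted_L2 s" using a by (simp add: Hs_extensions_eq)
  let ?D = "\<lambda>h. (2 * pi) powr (- real DIM('a) / 2) * Re (LINT \<xi>|lborel. \<i> * of_real (h \<bullet> \<xi>) * (cis (x \<bullet> \<xi>) * a \<xi>))"
  have "((\<lambda>y. Re (inverse_fourier a y)) has_derivative ?D) (at x)"
    using bounded_linear.has_derivative[OF bounded_linear_Re inverse_fourier_has_derivative[OF aL s, of x]] by simp
  then have "(u has_derivative ?D) (at x)"
  proof (rule has_derivative_transform_within_open[OF _ x])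
    fix y assume "y \<in> \<Omega>"
    then have "inverse_fourier a y = complex_of_real (u y)"
      using a closure_subset by (auto simp: Hs_extensions_eq)
    then show "Re (inverse_fourier a y) = u y" by simp
  qed
  then show "u differentiable (at x)" "frechet_derivative u (at x) h = ?D h"
    by (auto intro: differentiableI simp: frechet_derivative_at[symmetric])
qed

lemma Hs_C1_bound:
  fixes \<Omega> :: "'a::euclidean_space set"
  assumes u: "u \<in> Hs s \<Omega>" and s: "s > real DIM('a) / 2 + 1" and x: "open \<Omega>" "x \<in> \<Omega>" and h: "norm h \<le> 1"
  shows "\<bar>frechet_derivative u (at x) h\<bar> \<le> embedding_const TYPE('a) s 1 * Hs_norm s \<Omega> u"
proof (rule le_Hs_norm_by_extensions[OF u embedding_const_nonneg])
  fix a assume a: "a \<in> Hs_extensions s \<Omega> u"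
  then have aL: "a \<in> weighted_L2 s" by (simp add: Hs_extensions_eq)
  note m = moment_bound[OF aL, of 1]
  have "\<bar>Re (LINT \<xi>|lborel. \<i> * of_real (h \<bullet> \<xi>) * (cis (x \<bullet> \<xi>) * a \<xi>))\<bar>
      \<le> cmod (LINT \<xi>|lborel. \<i> * of_real (h \<bullet> \<xi>) * (cis (x \<bullet> \<xi>) * a \<xi>))" by (rule abs_Re_le_cmod)
  also have "\<dots> \<le> (LINT \<xi>|lborel. cmod (\<i> * of_real (h \<bullet> \<xi>) * (cis (x \<bullet> \<xi>) * a \<xi>)))" by (rule integral_norm_bound)
  also have "\<dots> \<le> (LINT \<xi>|lborel. norm \<xi> ^ 1 * cmod (a \<xi>))"
  proof (rule integral_mono')
    show "integrable lborel (\<lambda>\<xi>. norm \<xi> ^ 1 * cmod (a \<xi>))" using m(1) s by simp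
    fix \<xi>
    have "\<bar>h \<bullet> \<xi>\<bar> \<le> 1 * norm \<xi>"
      using Cauchy_Schwarz_ineq2[of h \<xi>] mult_right_mono[OF h, of "norm \<xi>"] by simp
    then show "cmod (\<i> * of_real (h \<bullet> \<xi>) * (cis (x \<bullet> \<xi>) * a \<xi>)) \<le> norm \<xi> ^ 1 * cmod (a \<xi>)"
      by (simp add: norm_mult mult_right_mono)
  qed simp
  also have "\<dots> \<le> moment_const TYPE('a) s 1 * sqrt (bessel_sq_norm s a)" using m(2) s by simp
  finally show "\<bar>frechet_derivative u (at x) h\<bar> \<le> embedding_const TYPE('a) s 1 * sqrt (bessel_sq_norm s a)"
    unfolding Hs_frechet_derivative(2)[OF a s x] abs_mult embedding_const_def by (simp add: mult.assoc mult_left_mono)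
qed

text \<open>
  The inverse Fourier integral is a parameter integral of a jointly measurable integrand, so
  measurability follows from Fubini's theorem. The same holds for its derivative in
  \<open>Hs_frechet_measurable\<close>.
\<close>

lemma Hs_measurable:
  fixes \<Omega> :: "'a::euclidean_space set"
  assumes u: "u \<in> Hs s \<Omega>"
  shows "u \<in> borel_measurable borel"
proof -
  obtain a where a: "a \<in> Hs_extensions s \<Omega> u" using u by (auto simp: Hs_def)
  then have [measurable]: "a \<in> borel_measurable borel" by (simp add: Hs_extensions_def)
  have [measurable]: "cis \<in> borel_measurable borel"
    by (intro borel_measurable_continuous_onI continuous_intros)
  have [measurable]: "closure \<Omega> \<in> sets borel" by simp
  have "(\<lambda>x. LINT \<xi>|lborel. cis (x \<bullet> \<xi>) * a \<xi>) \<in> borel_measurable borel" by measurable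
  then have "(\<lambda>x. indicator (closure \<Omega>) x * Re (inverse_fourier a x)) \<in> borel_measurable borel"
    unfolding inverse_fourier_def by measurable
  moreover have "u = (\<lambda>x. indicator (closure \<Omega>) x * Re (inverse_fourier a x))"
    using a u by (auto simp: fun_eq_iff Hs_extensions_def Hs_def indicator_def)
  ultimately show ?thesis by simp
qed

lemma Hs_frechet_measurable:
  fixes \<Omega> :: "'a::euclidean_space set"
  assumes u: "u \<in> Hs s \<Omega>" and s: "s > real DIM('a) / 2 + 1" and \<Omega>: "open \<Omega>"
  shows "(\<lambda>x. indicator \<Omega> x * frechet_derivative u (at x) h) \<in> borel_measurable borel"
proof -
  obtain a where a: "a \<in> Hs_extensions s \<Omega> u" using u by (auto simp: Hs_def)
  then have [measurable]: "a \<in> borel_measurable borel" by (simp add: Hs_extensions_def)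
  have [measurable]: "cis \<in> borel_measurable borel"
    by (intro borel_measurable_continuous_onI continuous_intros)
  have [measurable]: "\<Omega> \<in> sets borel" using \<Omega> by simp
  have [measurable]: "(\<lambda>x. LINT \<xi>|lborel. \<i> * of_real (h \<bullet> \<xi>) * (cis (x \<bullet> \<xi>) * a \<xi>)) \<in> borel_measurable borel"
    by measurable
  have "(\<lambda>x. indicator \<Omega> x * ((2 * pi) powr (- real DIM('a) / 2) * Re (LINT \<xi>|lborel. \<i> * of_real (h \<bullet> \<xi>) * (cis (x \<bullet> \<xi>) * a \<xi>)))) \<in> borel_measurable borel"
    by measurable
  moreover have "(\<lambda>x. indicator \<Omega> x * frechet_derivative u (at x) h)
    = (\<lambda>x. indicator \<Omega> x * ((2 * pi) powr (- real DIM('a) / 2) * Re (LINT \<xi>|lborel. \<i> * of_real (h \<bullet> \<xi>) * (cis (x \<bullet> \<xi>) * a \<xi>))))"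
    using Hs_frechet_derivative(2)[OF a s \<Omega>] by (auto simp: fun_eq_iff indicator_def)
  ultimately show ?thesis by simp
qed

section \<open>Minimizers and fixed points in balls of \<open>H\<^sup>s\<close>\<close>

definition Hs_vec :: "nat \<Rightarrow> real \<Rightarrow> 'a::euclidean_space set \<Rightarrow> (nat \<Rightarrow> 'a \<Rightarrow> real) set" where
  "Hs_vec N s \<Omega> = {U. (\<forall>m\<le>N. U m \<in> Hs s \<Omega>) \<and> (\<forall>m>N. U m = (\<lambda>_. 0))}"

abbreviation Hs_dist ::
    "nat \<Rightarrow> real \<Rightarrow> 'a::euclidean_space set \<Rightarrow> (nat \<Rightarrow> 'a \<Rightarrow> real) \<Rightarrow> (nat \<Rightarrow> 'a \<Rightarrow> real) \<Rightarrow> real" where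
  "Hs_dist N s \<Omega> U V \<equiv> Hs_vec_norm N s \<Omega> (\<lambda>m x. U m x - V m x)"

lemma admissible_ball_eq: "admissible_ball N s \<Omega> M = {V \<in> Hs_vec N s \<Omega>. Hs_vec_norm N s \<Omega> V \<le> M}"
  by (auto simp: admissible_ball_def Hs_vec_def)

lemma Hs_vec_norm_nonneg: "Hs_vec_norm N s \<Omega> U \<ge> 0"
  by (simp add: Hs_vec_norm_def sum_nonneg)

lemma Hs_vec_norm_sq: "(Hs_vec_norm N s \<Omega> U)\<^sup>2 = (\<Sum>m\<le>N. (Hs_norm s \<Omega> (U m))\<^sup>2)"
  by (simp add: Hs_vec_norm_def sum_nonneg)

lemma Hs_norm_component_le:
  assumes "m \<le> N" shows "Hs_norm s \<Omega> (U m) \<le> Hs_vec_norm N s \<Omega> U"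
proof -
  have "(Hs_norm s \<Omega> (U m))\<^sup>2 \<le> (\<Sum>m\<le>N. (Hs_norm s \<Omega> (U m))\<^sup>2)"
    using assms by (intro member_le_sum) auto
  then show ?thesis unfolding Hs_vec_norm_def by (rule real_le_rsqrt)
qed

text \<open>
  The optimal choice is \<open>t = b / a\<close>. Both numbers are first enlarged by a small amount so that the
  quotient makes sense.
\<close>

lemma le_add_of_young:
  fixes x a b :: real
  assumes ab: "a \<ge> 0" "b \<ge> 0" and y: "\<And>t. t > 0 \<Longrightarrow> x\<^sup>2 \<le> (1 + t) * a\<^sup>2 + (1 + 1 / t) * b\<^sup>2"
  shows "x \<le> a + b"
proof (rule field_le_epsilon)
  fix e :: real assume e: "e > 0"
  define c where "c = a + e / 2"
  define d where "d = b + e / 2"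
  have cd: "c > 0" "d > 0" "a \<le> c" "b \<le> d" using ab e by (auto simp: c_def d_def)
  have "x\<^sup>2 \<le> (1 + d / c) * a\<^sup>2 + (1 + 1 / (d / c)) * b\<^sup>2" using y[of "d / c"] cd by simp
  also have "\<dots> \<le> (1 + d / c) * c\<^sup>2 + (1 + 1 / (d / c)) * d\<^sup>2"
    using cd ab by (intro add_mono mult_left_mono power_mono) auto
  also have "\<dots> = (c + d)\<^sup>2" using cd by (simp add: field_simps power2_eq_square)
  finally have "x \<le> c + d" by (rule power2_le_imp_le) (use cd in simp)
  then show "x \<le> a + b + e" by (simp add: c_def d_def)
qed

context
  fixes \<Omega> :: "'a::euclidean_space set" and s :: real and N :: nat
  assumes s: "s > real DIM('a) / 2"
begin

lemma Hs_vec_diff: "U \<in> Hs_vec N s \<Omega> \<Longrightarrow> V \<in> Hs_vec N s \<Omega> \<Longrightarrow> (\<lambda>m x. U m x - V m x) \<in> Hs_vec N s \<Omega>"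
  using s by (auto simp: Hs_vec_def intro: Hs_diff)

lemma Hs_vec_sup_bound:
  assumes Z: "Z \<in> Hs_vec N s \<Omega>" and m: "m \<le> N"
  shows "\<bar>Z m x\<bar> \<le> embedding_const TYPE('a) s 0 * Hs_vec_norm N s \<Omega> Z"
proof -
  have "\<bar>Z m x\<bar> \<le> embedding_const TYPE('a) s 0 * Hs_norm s \<Omega> (Z m)"
    using Z m by (intro Hs_sup_bound s) (simp add: Hs_vec_def)
  also have "\<dots> \<le> embedding_const TYPE('a) s 0 * Hs_vec_norm N s \<Omega> Z"
    by (rule mult_left_mono[OF Hs_norm_component_le[OF m] embedding_const_nonneg])
  finally show ?thesis .
qed

lemma Hs_vec_zero: "U \<in> Hs_vec N s \<Omega> \<Longrightarrow> (\<lambda>m x. 0) \<in> Hs_vec N s \<Omega>"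
  using Hs_vec_diff[of U U] by simp

lemma Hs_vec_midpoint:
  assumes U: "U \<in> Hs_vec N s \<Omega>" and V: "V \<in> Hs_vec N s \<Omega>"
  shows "(\<lambda>m x. (U m x + V m x) / 2) \<in> Hs_vec N s \<Omega>"
    and "(Hs_vec_norm N s \<Omega> (\<lambda>m x. (U m x + V m x) / 2))\<^sup>2 + (Hs_dist N s \<Omega> U V)\<^sup>2 / 4
      \<le> ((Hs_vec_norm N s \<Omega> U)\<^sup>2 + (Hs_vec_norm N s \<Omega> V)\<^sup>2) / 2"
proof -
  show "(\<lambda>m x. (U m x + V m x) / 2) \<in> Hs_vec N s \<Omega>"
    using U V s by (auto simp: Hs_vec_def intro: Hs_midpoint(1))
  have "(\<Sum>m\<le>N. (Hs_norm s \<Omega> (\<lambda>x. (U m x + V m x) / 2))\<^sup>2 + (Hs_norm s \<Omega> (\<lambda>x. U m x - V m x))\<^sup>2 / 4)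
      \<le> (\<Sum>m\<le>N. ((Hs_norm s \<Omega> (U m))\<^sup>2 + (Hs_norm s \<Omega> (V m))\<^sup>2) / 2)"
    using U V s by (intro sum_mono Hs_midpoint(2)) (auto simp: Hs_vec_def)
  then show "(Hs_vec_norm N s \<Omega> (\<lambda>m x. (U m x + V m x) / 2))\<^sup>2 + (Hs_dist N s \<Omega> U V)\<^sup>2 / 4
      \<le> ((Hs_vec_norm N s \<Omega> U)\<^sup>2 + (Hs_vec_norm N s \<Omega> V)\<^sup>2) / 2"
    by (simp add: Hs_vec_norm_sq sum.distrib sum_divide_distrib[symmetric])
qed

lemma Hs_vec_norm_minus_commute:
  assumes "U \<in> Hs_vec N s \<Omega>" "V \<in> Hs_vec N s \<Omega>"
  shows "Hs_dist N s \<Omega> U V = Hs_dist N s \<Omega> V U"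
proof -
  have "Hs_norm s \<Omega> (\<lambda>x. U m x - V m x) = Hs_norm s \<Omega> (\<lambda>x. V m x - U m x)" if "m \<le> N" for m
    using assms that by (intro Hs_norm_minus_commute s) (auto simp: Hs_vec_def)
  then show ?thesis by (simp add: Hs_vec_norm_def)
qed

text \<open>
  Young's inequality with the same parameter in all components is summed before the parameter is
  optimized, which yields the triangle inequality for the Euclidean combination of the norms.
\<close>

lemma Hs_vec_norm_triangle:
  assumes U: "U \<in> Hs_vec N s \<Omega>" and V: "V \<in> Hs_vec N s \<Omega>"
  shows "Hs_vec_norm N s \<Omega> U \<le> Hs_vec_norm N s \<Omega> V + Hs_dist N s \<Omega> U V"
proof (rule le_add_of_young[OF Hs_vec_norm_nonneg Hs_vec_norm_nonneg])
  fix t :: real assume t: "t > 0"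
  have "(Hs_norm s \<Omega> (U m))\<^sup>2 \<le> (1 + t) * (Hs_norm s \<Omega> (V m))\<^sup>2 + (1 + 1 / t) * (Hs_norm s \<Omega> (\<lambda>x. U m x - V m x))\<^sup>2"
    if "m \<le> N" for m
    using Hs_norm_young[of "V m" s \<Omega> "\<lambda>x. U m x - V m x" t, OF _ Hs_diff] that U V s t
    by (auto simp: Hs_vec_def)
  then have "(\<Sum>m\<le>N. (Hs_norm s \<Omega> (U m))\<^sup>2) \<le> (\<Sum>m\<le>N. (1 + t) * (Hs_norm s \<Omega> (V m))\<^sup>2 + (1 + 1 / t) * (Hs_norm s \<Omega> (\<lambda>x. U m x - V m x))\<^sup>2)"
    by (intro sum_mono) auto
  then show "(Hs_vec_norm N s \<Omega> U)\<^sup>2 \<le> (1 + t) * (Hs_vec_norm N s \<Omega> V)\<^sup>2 + (1 + 1 / t) * (Hs_dist N s \<Omega> U V)\<^sup>2"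
    by (simp add: Hs_vec_norm_sq sum.distrib sum_distrib_left)
qed

lemma Hs_vec_norm_tendsto:
  assumes X: "\<And>k. X k \<in> Hs_vec N s \<Omega>" and V: "V \<in> Hs_vec N s \<Omega>"
    and lim: "(\<lambda>k::nat. Hs_dist N s \<Omega> (X k) V) \<longlonglongrightarrow> 0"
  shows "(\<lambda>k. Hs_vec_norm N s \<Omega> (X k)) \<longlonglongrightarrow> Hs_vec_norm N s \<Omega> V"
proof -
  have "\<bar>Hs_vec_norm N s \<Omega> (X k) - Hs_vec_norm N s \<Omega> V\<bar> \<le> Hs_dist N s \<Omega> (X k) V" for k
    using Hs_vec_norm_triangle[OF X V, of k] Hs_vec_norm_triangle[OF V X, of k] Hs_vec_norm_minus_commute[OF X V, of k]
    by (simp add: abs_le_iff)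
  then have "(\<lambda>k. Hs_vec_norm N s \<Omega> (X k) - Hs_vec_norm N s \<Omega> V) \<longlonglongrightarrow> 0"
    by (intro Lim_null_comparison[OF always_eventually lim]) simp
  then show ?thesis by (simp add: LIM_zero_iff)
qed

lemma admissible_ball_complete:
  assumes X: "\<And>k. X k \<in> admissible_ball N s \<Omega> M"
    and inc: "\<And>k. Hs_dist N s \<Omega> (X (Suc k)) (X k) \<le> A * q ^ k" and q: "0 < q" "q < 1"
  shows "\<exists>V\<in>admissible_ball N s \<Omega> M. (\<lambda>k. Hs_dist N s \<Omega> (X k) V) \<longlonglongrightarrow> 0"
proof -
  have XV: "X k \<in> Hs_vec N s \<Omega>" "Hs_vec_norm N s \<Omega> (X k) \<le> M" for k
    using X[of k] by (auto simp: admissible_ball_eq)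
  have lim_m: "\<exists>v\<in>Hs s \<Omega>. (\<lambda>k. Hs_norm s \<Omega> (\<lambda>x. X k m x - v x)) \<longlonglongrightarrow> 0" if m: "m \<le> N" for m
  proof (rule Hs_complete[OF _ s _ q])
    show "X k m \<in> Hs s \<Omega>" for k using XV(1)[of k] m by (simp add: Hs_vec_def)
    show "Hs_norm s \<Omega> (\<lambda>x. X (Suc k) m x - X k m x) \<le> A * q ^ k" for k
      using Hs_norm_component_le[OF m, of s \<Omega> "\<lambda>m x. X (Suc k) m x - X k m x"] inc[of k] by linarith
  qed
  have "\<forall>m. \<exists>v. m \<le> N \<longrightarrow> v \<in> Hs s \<Omega> \<and> (\<lambda>k. Hs_norm s \<Omega> (\<lambda>x. X k m x - v x)) \<longlonglongrightarrow> 0"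
    using lim_m by blast
  from choice[OF this] obtain v where v: "\<And>m. m \<le> N \<Longrightarrow> v m \<in> Hs s \<Omega>"
    "\<And>m. m \<le> N \<Longrightarrow> (\<lambda>k. Hs_norm s \<Omega> (\<lambda>x. X k m x - v m x)) \<longlonglongrightarrow> 0"
    by auto
  define V where "V m = (if m \<le> N then v m else (\<lambda>_. 0))" for m
  have V: "V \<in> Hs_vec N s \<Omega>" using v(1) by (auto simp: Hs_vec_def V_def)
  have "(\<lambda>k. sqrt (\<Sum>m\<le>N. (Hs_norm s \<Omega> (\<lambda>x. X k m x - V m x))\<^sup>2)) \<longlonglongrightarrow> sqrt (\<Sum>m\<le>N. 0\<^sup>2)"
    using v(2) by (intro tendsto_intros) (auto simp: V_def)
  then have lim: "(\<lambda>k. Hs_dist N s \<Omega> (X k) V) \<longlonglongrightarrow> 0"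
    by (simp add: Hs_vec_norm_def)
  have "Hs_vec_norm N s \<Omega> V \<le> M"
    by (rule LIMSEQ_le_const2[OF Hs_vec_norm_tendsto[OF XV(1) V lim]]) (use XV(2) in auto)
  then show ?thesis using V lim by (auto simp: admissible_ball_eq)
qed

text \<open>
  A minimizing sequence whose values are within \<open>4\<^bsup>-k\<^esup>\<close> of the infimum has increments of order
  \<open>2\<^bsup>-k\<^esup>\<close>: the midpoint of two consecutive terms stays in the ball, so its value is at least the
  infimum, and uniform convexity bounds the distance of the two terms.
\<close>

lemma uniformly_midpoint_convex_minimizer:
  assumes B: "admissible_ball N s \<Omega> M \<noteq> {}" and M: "M \<ge> 0" and e: "e > 0"
    and J0: "\<And>U. J U \<ge> 0"
    and mid: "\<And>U V. U \<in> Hs_vec N s \<Omega> \<Longrightarrow> V \<in> Hs_vec N s \<Omega> \<Longrightarrow>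
      J (\<lambda>m x. (U m x + V m x) / 2) + e * (Hs_dist N s \<Omega> U V)\<^sup>2 \<le> (J U + J V) / 2"
    and cont: "\<And>X V. (\<And>k. X k \<in> Hs_vec N s \<Omega>) \<Longrightarrow> V \<in> Hs_vec N s \<Omega> \<Longrightarrow>
      (\<lambda>k::nat. Hs_dist N s \<Omega> (X k) V) \<longlonglongrightarrow> 0 \<Longrightarrow> (\<lambda>k. J (X k)) \<longlonglongrightarrow> J V"
  shows "\<exists>V\<in>admissible_ball N s \<Omega> M. \<forall>U\<in>admissible_ball N s \<Omega> M. J V \<le> (J U :: real)"
proof -
  let ?B = "admissible_ball N s \<Omega> M"
  define I where "I = (INF U\<in>?B. J U)"
  have bdd: "bdd_below (J ` ?B)" using J0 by (intro bdd_belowI[of _ 0]) auto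
  have I: "I \<le> J U" if "U \<in> ?B" for U unfolding I_def by (rule cINF_lower[OF bdd that])
  have midB: "(\<lambda>m x. (U m x + V m x) / 2) \<in> ?B" if U: "U \<in> ?B" and V: "V \<in> ?B" for U V
  proof -
    have v: "U \<in> Hs_vec N s \<Omega>" "V \<in> Hs_vec N s \<Omega>" "(Hs_vec_norm N s \<Omega> U)\<^sup>2 \<le> M\<^sup>2" "(Hs_vec_norm N s \<Omega> V)\<^sup>2 \<le> M\<^sup>2"
      using U V by (auto simp: admissible_ball_eq intro!: power_mono Hs_vec_norm_nonneg)
    have avg: "p \<le> M\<^sup>2" if "p + q / 4 \<le> (c + d) / 2" "c \<le> M\<^sup>2" "d \<le> M\<^sup>2" "0 \<le> q" for p q c d :: real
    proof -
      have "4 * p + q \<le> 2 * c + 2 * d" using that(1) by (simp add: field_simps)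
      then show ?thesis using that(2-4) by linarith
    qed
    have "(Hs_vec_norm N s \<Omega> (\<lambda>m x. (U m x + V m x) / 2))\<^sup>2 \<le> M\<^sup>2"
      by (rule avg[OF Hs_vec_midpoint(2)[OF v(1,2)] v(3,4)]) simp
    then show ?thesis using Hs_vec_midpoint(1)[OF v(1,2)] M by (auto simp: admissible_ball_eq intro: power2_le_imp_le)
  qed
  have "\<exists>U\<in>?B. J U < I + (1/4) ^ k" for k :: nat
    using cINF_less_iff[OF B bdd, of "I + (1/4) ^ k"] unfolding I_def by simp
  then obtain X where X: "\<And>k. X k \<in> ?B" "\<And>k. J (X k) < I + (1/4) ^ k" by metis
  have XV: "X k \<in> Hs_vec N s \<Omega>" for k using X(1)[of k] by (simp add: admissible_ball_eq)
  have "Hs_dist N s \<Omega> (X (Suc k)) (X k) \<le> sqrt (1 / e) * (1 / 2) ^ k" for k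
  proof -
    have "e * (Hs_dist N s \<Omega> (X (Suc k)) (X k))\<^sup>2 \<le> (J (X (Suc k)) + J (X k)) / 2 - I"
      using mid[OF XV XV, of "Suc k" k] I[OF midB[OF X(1) X(1), of "Suc k" k]] by linarith
    also have "\<dots> \<le> (1/4) ^ k"
    proof -
      have "(1/4::real) ^ Suc k \<le> (1/4) ^ k" by simp
      then have "J (X (Suc k)) + J (X k) \<le> 2 * (I + (1/4) ^ k)"
        using X(2)[of k] X(2)[of "Suc k"] zero_le_power[of "1/4::real" k] by (simp add: field_simps)
      then show ?thesis by (simp add: field_simps)
    qed
    finally have "(Hs_dist N s \<Omega> (X (Suc k)) (X k))\<^sup>2 \<le> 1 / e * (1/4) ^ k"
      using e by (simp add: field_simps)
    then have "Hs_dist N s \<Omega> (X (Suc k)) (X k) \<le> sqrt (1 / e * (1/4) ^ k)"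
      by (rule real_le_rsqrt)
    also have "\<dots> = sqrt (1 / e) * (1 / 2) ^ k"
      using real_sqrt_power[of "1/4" k] by (simp add: real_sqrt_mult real_sqrt_divide)
    finally show ?thesis .
  qed
  from admissible_ball_complete[OF X(1) this]
  obtain V where V: "V \<in> ?B" "(\<lambda>k. Hs_dist N s \<Omega> (X k) V) \<longlonglongrightarrow> 0" by auto
  have "(\<lambda>k. J (X k)) \<longlonglongrightarrow> J V" using cont[OF XV _ V(2)] V(1) by (simp add: admissible_ball_eq)
  moreover have "(\<lambda>k. I + (1/4) ^ k) \<longlonglongrightarrow> I + 0"
    by (intro tendsto_intros LIMSEQ_power_zero) simp
  ultimately have "J V \<le> I" using X(2) by (intro LIMSEQ_le) (auto intro: less_imp_le)
  then show ?thesis using V(1) I by force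
qed

text \<open>
  Banach's theorem for a functional \<open>w\<close> of differences that is comparable with the norm of
  \<open>H\<^sup>s\<close>. Completeness and uniqueness of limits are those of \<open>H\<^sup>s\<close>; the two comparisons carry the
  contraction property for \<open>w\<close> over to increments and limits there.
\<close>

lemma admissible_ball_fixed_point:
  assumes U0: "U 0 \<in> admissible_ball N s \<Omega> M" and U: "\<And>k. U (Suc k) = F (U k)"
    and F: "\<And>V. V \<in> admissible_ball N s \<Omega> M \<Longrightarrow> F V \<in> admissible_ball N s \<Omega> M"
    and contr: "\<And>V W. V \<in> admissible_ball N s \<Omega> M \<Longrightarrow> W \<in> admissible_ball N s \<Omega> M \<Longrightarrow>
      w (\<lambda>m x. F V m x - F W m x) \<le> \<mu> * w (\<lambda>m x. V m x - W m x)"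
    and \<mu>: "0 < \<mu>" "\<mu> < 1" and a: "a > 0"
    and lower: "\<And>Z. Z \<in> Hs_vec N s \<Omega> \<Longrightarrow> a * Hs_vec_norm N s \<Omega> Z \<le> w Z"
    and upper: "\<And>Z. Z \<in> Hs_vec N s \<Omega> \<Longrightarrow> w Z \<le> b * Hs_vec_norm N s \<Omega> Z"
  shows "\<exists>V\<in>admissible_ball N s \<Omega> M. F V = V \<and>
    (\<forall>W\<in>admissible_ball N s \<Omega> M. F W = W \<longrightarrow> W = V) \<and>
    (\<lambda>k. w (\<lambda>m x. U k m x - V m x)) \<longlonglongrightarrow> 0 \<and>
    (\<forall>k. w (\<lambda>m x. U k m x - V m x) \<le> \<mu> ^ k * w (\<lambda>m x. U 0 m x - V m x))"
proof -
  let ?B = "admissible_ball N s \<Omega> M"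
  have BV: "V \<in> Hs_vec N s \<Omega>" if "V \<in> ?B" for V using that by (simp add: admissible_ball_eq)
  have UB: "U k \<in> ?B" for k by (induction k) (auto simp: U0 U F)
  \<comment> \<open>Limits in \<open>H\<^sup>s\<close> are unique as functions, since convergence in \<open>H\<^sup>s\<close> implies pointwise
  convergence and elements of the ball vanish above index \<open>N\<close>.\<close>
  have eqI: "V = W" if V: "V \<in> ?B" and W: "W \<in> ?B"
    and lim: "(\<lambda>k. Hs_dist N s \<Omega> (X k) V) \<longlonglongrightarrow> 0"
      "(\<lambda>k. Hs_dist N s \<Omega> (X k) W) \<longlonglongrightarrow> 0" and X: "\<And>k::nat. X k \<in> ?B" for V W X
  proof (intro ext)
    fix m x
    let ?K = "embedding_const TYPE('a) s 0"
    have pt: "(\<lambda>k. X k m x) \<longlonglongrightarrow> V m x" if V: "V \<in> ?B" and m: "m \<le> N"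
      and lim: "(\<lambda>k. Hs_dist N s \<Omega> (X k) V) \<longlonglongrightarrow> 0" for V
    proof -
      have "\<bar>X k m x - V m x\<bar> \<le> ?K * Hs_dist N s \<Omega> (X k) V" for k
        by (rule Hs_vec_sup_bound[OF Hs_vec_diff[OF BV[OF X[of k]] BV[OF V]] m])
      then have "(\<lambda>k. X k m x - V m x) \<longlonglongrightarrow> 0"
        by (intro Lim_null_comparison[OF always_eventually tendsto_mult_right_zero[OF lim, of ?K]]) simp
      then show ?thesis by (simp add: LIM_zero_iff)
    qed
    show "V m x = W m x"
    proof (cases "m \<le> N")
      case True then show ?thesis using pt[OF V True lim(1)] pt[OF W True lim(2)] LIMSEQ_unique by blast
    next
      case False then show ?thesis using V W by (simp add: admissible_ball_def)
    qed
  qed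
  \<comment> \<open>Applied twice: with \<open>Y = U\<close> and \<open>j = 1\<close> it bounds the increments, with \<open>Y\<close> constantly the fixed
  point and \<open>j = 0\<close> it is the convergence rate.\<close>
  have rate: "w (\<lambda>m x. U (k + j) m x - Y k m x) \<le> \<mu> ^ k * w (\<lambda>m x. U j m x - Y 0 m x)"
    if Y: "\<And>k. Y k \<in> ?B" "\<And>k. Y (Suc k) = F (Y k)" for Y :: "nat \<Rightarrow> nat \<Rightarrow> 'a \<Rightarrow> real" and j k
  proof (induction k)
    case (Suc k)
    have "w (\<lambda>m x. U (Suc k + j) m x - Y (Suc k) m x) \<le> \<mu> * w (\<lambda>m x. U (k + j) m x - Y k m x)"
      using contr[OF UB[of "k + j"] Y(1)[of k]] by (simp add: U Y(2))
    also have "\<dots> \<le> \<mu> * (\<mu> ^ k * w (\<lambda>m x. U j m x - Y 0 m x))"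
      using Suc \<mu> by (intro mult_left_mono) auto
    finally show ?case by simp
  qed simp
  have "Hs_dist N s \<Omega> (U (Suc k)) (U k) \<le> (w (\<lambda>m x. U 1 m x - U 0 m x) / a) * \<mu> ^ k" for k
  proof -
    have "a * Hs_dist N s \<Omega> (U (Suc k)) (U k) \<le> \<mu> ^ k * w (\<lambda>m x. U 1 m x - U 0 m x)"
      using lower[OF Hs_vec_diff[OF BV[OF UB] BV[OF UB]], of "Suc k" k] rate[of U k 1, OF UB U] by simp
    then show ?thesis using a by (simp add: field_simps)
  qed
  from admissible_ball_complete[OF UB this \<mu>] obtain V where V: "V \<in> ?B"
    "(\<lambda>k. Hs_dist N s \<Omega> (U k) V) \<longlonglongrightarrow> 0" by auto
  have step: "a * Hs_dist N s \<Omega> (U (Suc k)) (F V) \<le> \<mu> * (b * Hs_dist N s \<Omega> (U k) V)" for k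
  proof -
    have "a * Hs_dist N s \<Omega> (U (Suc k)) (F V) \<le> w (\<lambda>m x. U (Suc k) m x - F V m x)"
      by (rule lower[OF Hs_vec_diff[OF BV[OF UB] BV[OF F[OF V(1)]]]])
    also have "\<dots> \<le> \<mu> * w (\<lambda>m x. U k m x - V m x)" unfolding U by (rule contr[OF UB V(1)])
    also have "\<dots> \<le> \<mu> * (b * Hs_dist N s \<Omega> (U k) V)"
      using \<mu> upper[OF Hs_vec_diff[OF BV[OF UB] BV[OF V(1)]]] by (intro mult_left_mono) auto
    finally show ?thesis .
  qed
  have "(\<lambda>k. Hs_dist N s \<Omega> (U (Suc k)) (F V)) \<longlonglongrightarrow> 0"
  proof (rule Lim_null_comparison[OF always_eventually])
    show "\<forall>k. norm (Hs_dist N s \<Omega> (U (Suc k)) (F V)) \<le> (\<mu> * b / a) * Hs_dist N s \<Omega> (U k) V"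
      using step a by (simp add: Hs_vec_norm_nonneg pos_le_divide_eq mult_ac)
    show "(\<lambda>k. (\<mu> * b / a) * Hs_dist N s \<Omega> (U k) V) \<longlonglongrightarrow> 0"
      by (rule tendsto_mult_right_zero[OF V(2)])
  qed
  then have fix_V: "F V = V"
    using eqI[OF F[OF V(1)] V(1), of "\<lambda>k. U (Suc k)"] LIMSEQ_Suc[OF V(2)] UB by simp
  have conv: "w (\<lambda>m x. U k m x - V m x) \<le> \<mu> ^ k * w (\<lambda>m x. U 0 m x - V m x)" for k
    using rate[of "\<lambda>_. V" k 0] V(1) fix_V by simp
  have "(\<lambda>k. w (\<lambda>m x. U k m x - V m x)) \<longlonglongrightarrow> 0"
  proof (rule Lim_null_comparison[OF always_eventually])
    have "w (\<lambda>m x. U k m x - V m x) \<ge> 0" for k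
      using lower[OF Hs_vec_diff[OF BV[OF UB] BV[OF V(1)]], of k] a Hs_vec_norm_nonneg[of N s \<Omega> "\<lambda>m x. U k m x - V m x"]
      by (meson less_imp_le mult_nonneg_nonneg order_trans)
    then show "\<forall>k. norm (w (\<lambda>m x. U k m x - V m x)) \<le> \<mu> ^ k * w (\<lambda>m x. U 0 m x - V m x)"
      using conv by simp
    show "(\<lambda>k. \<mu> ^ k * w (\<lambda>m x. U 0 m x - V m x)) \<longlonglongrightarrow> 0"
      using \<mu> by (intro tendsto_mult_left_zero LIMSEQ_power_zero) simp
  qed
  moreover have "W = V" if W: "W \<in> ?B" "F W = W" for W
  proof -
    let ?Z = "\<lambda>m x. W m x - V m x"
    have Z: "?Z \<in> Hs_vec N s \<Omega>" by (rule Hs_vec_diff[OF BV[OF W(1)] BV[OF V(1)]])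
    have "w ?Z \<le> \<mu> * w ?Z" using contr[OF W(1) V(1)] W(2) fix_V by simp
    then have "(1 - \<mu>) * w ?Z \<le> 0" by (simp add: algebra_simps)
    then have "w ?Z \<le> 0" using \<mu> by (simp add: mult_le_0_iff)
    then have "a * Hs_vec_norm N s \<Omega> ?Z \<le> 0" using lower[OF Z] by linarith
    then have "Hs_vec_norm N s \<Omega> ?Z = 0" using a Hs_vec_norm_nonneg[of N s \<Omega> ?Z] by (simp add: mult_le_0_iff)
    moreover have "Hs_dist N s \<Omega> W W = 0"
      using Hs_vec_midpoint(2)[OF BV[OF W(1)] BV[OF W(1)]] by simp
    ultimately show "W = V" using eqI[OF W(1) V(1), of "\<lambda>_. W"] W(1) by simp
  qed
  ultimately show ?thesis using V(1) fix_V conv by blast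
qed

end

section \<open>Area and normal of a smooth boundary\<close>

text \<open>
  Covers by finitely many sets are closed under unions without any interleaving of sequences,
  unlike the countable covers in the definition of the Hausdorff measure.
\<close>

definition fine_cover :: "nat \<Rightarrow> real \<Rightarrow> real \<Rightarrow> 'a::metric_space set \<Rightarrow> 'a set set \<Rightarrow> bool" where
  "fine_cover k \<delta> K A \<F> \<longleftrightarrow> finite \<F> \<and> A \<subseteq> \<Union>\<F> \<and>
     (\<forall>S\<in>\<F>. bounded S \<and> diameter S \<le> \<delta>) \<and> (\<Sum>S\<in>\<F>. diameter S ^ k) \<le> K"

definition finite_content :: "nat \<Rightarrow> 'a::metric_space set \<Rightarrow> bool" where
  "finite_content k A \<longleftrightarrow> (\<exists>K. \<forall>\<delta>>0. \<exists>\<F>. fine_cover k \<delta> K A \<F>)"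

lemma finite_content_empty: "finite_content k {}"
  unfolding finite_content_def fine_cover_def by (intro exI[of _ 0] allI impI exI[of _ "{}"]) auto

lemma finite_content_mono: "finite_content k B \<Longrightarrow> A \<subseteq> B \<Longrightarrow> finite_content k A"
  unfolding finite_content_def fine_cover_def by (meson order_trans)

lemma finite_content_Un:
  assumes "finite_content k A" "finite_content k B"
  shows "finite_content k (A \<union> B)"
proof -
  obtain K where K: "\<And>\<delta>. \<delta> > 0 \<Longrightarrow> \<exists>\<F>. fine_cover k \<delta> K A \<F>"
    using assms(1) unfolding finite_content_def by blast
  obtain L where L: "\<And>\<delta>. \<delta> > 0 \<Longrightarrow> \<exists>\<F>. fine_cover k \<delta> L B \<F>"
    using assms(2) unfolding finite_content_def by blast
  show ?thesis unfolding finite_content_def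
  proof (intro exI[of _ "K + L"] allI impI)
    fix \<delta> :: real assume \<delta>: "\<delta> > 0"
    obtain \<F> where F: "finite \<F>" "A \<subseteq> \<Union>\<F>" "\<forall>S\<in>\<F>. bounded S \<and> diameter S \<le> \<delta>" "(\<Sum>S\<in>\<F>. diameter S ^ k) \<le> K"
      using K[OF \<delta>] unfolding fine_cover_def by blast
    obtain \<G> where G: "finite \<G>" "B \<subseteq> \<Union>\<G>" "\<forall>S\<in>\<G>. bounded S \<and> diameter S \<le> \<delta>" "(\<Sum>S\<in>\<G>. diameter S ^ k) \<le> L"
      using L[OF \<delta>] unfolding fine_cover_def by blast
    have "(\<Sum>S\<in>\<F> \<inter> \<G>. diameter S ^ k) \<ge> 0"
      using F by (intro sum_nonneg zero_le_power diameter_ge_0) auto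
    then have "(\<Sum>S\<in>\<F> \<union> \<G>. diameter S ^ k) \<le> K + L"
      using F G sum.union_inter[of \<F> \<G> "\<lambda>S. diameter S ^ k"] by linarith
    then show "\<exists>\<F>. fine_cover k \<delta> (K + L) (A \<union> B) \<F>"
      using F G unfolding fine_cover_def by (intro exI[of _ "\<F> \<union> \<G>"]) auto
  qed
qed

lemma finite_content_UN: "finite I \<Longrightarrow> (\<And>i. i \<in> I \<Longrightarrow> finite_content k (A i)) \<Longrightarrow> finite_content k (\<Union>i\<in>I. A i)"
  by (induction I rule: finite_induct) (auto simp: finite_content_empty intro: finite_content_Un)

lemma hausdorff_finite:
  assumes "finite_content k A"
  shows "hausdorff k A < \<infinity>"
proof -
  obtain K where K: "\<And>\<delta>. \<delta> > 0 \<Longrightarrow> \<exists>\<F>. fine_cover k \<delta> K A \<F>"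
    using assms unfolding finite_content_def by blast
  let ?V = "unit_ball_vol (real k)"
  have "hausdorff_pre k \<delta> A \<le> ennreal (?V * K)" if \<delta>: "\<delta> > 0" for \<delta>
  proof -
    obtain \<F> where F: "finite \<F>" "A \<subseteq> \<Union>\<F>" "\<forall>S\<in>\<F>. bounded S \<and> diameter S \<le> \<delta>" "(\<Sum>S\<in>\<F>. diameter S ^ k) \<le> K"
      using K[OF \<delta>] unfolding fine_cover_def by blast
    obtain e where e: "bij_betw e {..<card \<F>} \<F>"
      using F(1) by (metis atLeast0LessThan bij_betw_from_nat_into_finite ex_bij_betw_nat_finite)
    define C where "C i = (if i < card \<F> then e i else {})" for i
    have "\<Union>\<F> \<subseteq> (\<Union>i. C i)"
    proof
      fix x assume "x \<in> \<Union>\<F>"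
      then obtain S where "S \<in> \<F>" "x \<in> S" by blast
      moreover obtain i where "i < card \<F>" "S = e i"
        using \<open>S \<in> \<F>\<close> bij_betw_imp_surj_on[OF e] by blast
      ultimately have "x \<in> C i" by (simp add: C_def)
      then show "x \<in> (\<Union>i. C i)" by blast
    qed
    then have "A \<subseteq> (\<Union>i. C i)" using F(2) by (rule order_trans[rotated])
    moreover have "bounded (C i) \<and> diameter (C i) \<le> \<delta>" for i
      using F(3) e \<delta> bij_betwE[OF e] by (auto simp: C_def)
    ultimately have "hausdorff_pre k \<delta> A \<le> (\<Sum>i. if C i = {} then 0 else ennreal (?V * (diameter (C i) / 2) ^ k))"
      unfolding hausdorff_pre_def by (intro INF_lower) auto
    also have "\<dots> = (\<Sum>i<card \<F>. if C i = {} then 0 else ennreal (?V * (diameter (C i) / 2) ^ k))"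
      by (intro suminf_finite) (auto simp: C_def)
    also have "\<dots> \<le> (\<Sum>i<card \<F>. ennreal (?V * diameter (e i) ^ k))"
    proof (rule sum_mono)
      fix i assume "i \<in> {..<card \<F>}"
      then have "C i = e i" "diameter (e i) \<ge> 0"
        using F(3) bij_betwE[OF e] by (auto simp: C_def intro: diameter_ge_0)
      then show "(if C i = {} then 0 else ennreal (?V * (diameter (C i) / 2) ^ k)) \<le> ennreal (?V * diameter (e i) ^ k)"
        by (auto intro!: ennreal_leI mult_left_mono power_mono)
    qed
    also have "\<dots> = ennreal (\<Sum>i<card \<F>. ?V * diameter (e i) ^ k)"
      using F(3) bij_betwE[OF e] by (intro sum_ennreal mult_nonneg_nonneg zero_le_power diameter_ge_0) auto
    also have "(\<Sum>i<card \<F>. ?V * diameter (e i) ^ k) = ?V * (\<Sum>S\<in>\<F>. diameter S ^ k)"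
      using sum.reindex_bij_betw[OF e, of "\<lambda>S. diameter S ^ k"] by (simp flip: sum_distrib_left)
    also have "ennreal \<dots> \<le> ennreal (?V * K)"
      using F(4) by (intro ennreal_leI mult_left_mono) auto
    finally show ?thesis .
  qed
  then have "hausdorff k A \<le> ennreal (?V * K)"
    unfolding hausdorff_def by (intro SUP_least) auto
  then show ?thesis by (simp add: le_less_trans)
qed

text \<open>
  The cone condition says that dropping the coordinate \<open>b\<close> has a Lipschitz inverse on \<open>A\<close>. A grid
  of \<open>m\<^bsup>d-1\<^esup>\<close> cells in the remaining coordinates therefore cuts \<open>A\<close> into pieces of diameter at
  most \<open>D / m\<close>, and the sum of the powers of the diameters is at most \<open>D\<^bsup>d-1\<^esup>\<close> for every \<open>m\<close>.
  The cover consists of pieces of \<open>A\<close> itself and so replaces a parametrization of the boundary.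
\<close>

lemma finite_content_graph:
  fixes A :: "'a::euclidean_space set"
  assumes b: "b \<in> Basis" and r: "r > 0" and A: "A \<subseteq> ball p r" and L: "L \<ge> 0"
    and cone: "\<And>x y. x \<in> A \<Longrightarrow> y \<in> A \<Longrightarrow> norm (x - y) \<le> L * (\<Sum>i\<in>Basis - {b}. \<bar>(x - y) \<bullet> i\<bar>)"
  shows "finite_content (DIM('a) - 1) A"
proof -
  let ?I = "Basis - {b} :: 'a set"
  let ?k = "DIM('a) - 1"
  have cardI: "card ?I = ?k" using b by (simp add: card_Diff_singleton)
  define D where "D = L * (real ?k * (2 * r))"
  have D: "D \<ge> 0" using L r by (simp add: D_def)
  show ?thesis unfolding finite_content_def
  proof (intro exI[of _ "D ^ ?k"] allI impI)
    fix \<delta> :: real assume \<delta>: "\<delta> > 0"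
    obtain m0 :: nat where m0: "D / \<delta> < real m0" using reals_Archimedean2 by blast
    define m where "m = Suc m0"
    have m: "m > 0" "D / real m \<le> \<delta>"
      using m0 \<delta> by (auto simp: m_def field_simps)
    \<comment> \<open>The index of the grid cell that contains the projection of \<open>x\<close>.\<close>
    define cell where "cell x = (\<lambda>i\<in>?I. nat \<lfloor>(x \<bullet> i - p \<bullet> i + r) * (real m / (2 * r))\<rfloor>)" for x
    define S where "S \<kappa> = {x\<in>A. cell x = \<kappa>}" for \<kappa>
    let ?P = "?I \<rightarrow>\<^sub>E {..<m}"
    have range: "0 \<le> (x \<bullet> i - p \<bullet> i + r) * (real m / (2 * r)) \<and> (x \<bullet> i - p \<bullet> i + r) * (real m / (2 * r)) < real m"
      if "x \<in> A" "i \<in> ?I" for x i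
    proof -
      have "\<bar>(x - p) \<bullet> i\<bar> < r"
        using Basis_le_norm[of i "x - p"] that A by (auto simp: dist_norm norm_minus_commute)
      then have *: "0 < x \<bullet> i - p \<bullet> i + r" "x \<bullet> i - p \<bullet> i + r < 2 * r"
        by (auto simp: inner_diff_left)
      have "(x \<bullet> i - p \<bullet> i + r) * (real m / (2 * r)) < 2 * r * (real m / (2 * r))"
        using * m r by (intro mult_strict_right_mono) auto
      then show ?thesis using * r by simp
    qed
    have cell: "cell x \<in> ?P" if "x \<in> A" for x
      using range[OF that] by (auto simp: cell_def PiE_iff nat_less_iff floor_less_iff)
    have close: "norm (x - y) \<le> D / real m" if "x \<in> S \<kappa>" "y \<in> S \<kappa>" for x y \<kappa>
    proof -
      have "\<bar>(x - y) \<bullet> i\<bar> \<le> 2 * r / real m" if i: "i \<in> ?I" for i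
      proof -
        let ?c = "real m / (2 * r)"
        have "cell x i = cell y i" using \<open>x \<in> S \<kappa>\<close> \<open>y \<in> S \<kappa>\<close> by (simp add: S_def)
        moreover have "x \<in> A" "y \<in> A" using \<open>x \<in> S \<kappa>\<close> \<open>y \<in> S \<kappa>\<close> by (auto simp: S_def)
        ultimately have "\<lfloor>(x \<bullet> i - p \<bullet> i + r) * ?c\<rfloor> = \<lfloor>(y \<bullet> i - p \<bullet> i + r) * ?c\<rfloor>"
          using i range[of x i] range[of y i] by (simp add: cell_def eq_nat_nat_iff del: times_divide_eq_right)
        then have "\<bar>(x \<bullet> i - p \<bullet> i + r) * ?c - (y \<bullet> i - p \<bullet> i + r) * ?c\<bar> \<le> 1" by linarith
        also have "(x \<bullet> i - p \<bullet> i + r) * ?c - (y \<bullet> i - p \<bullet> i + r) * ?c = (x - y) \<bullet> i * ?c"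
          unfolding left_diff_distrib[symmetric] by (simp add: inner_diff_left)
        finally have "\<bar>(x - y) \<bullet> i * ?c\<bar> \<le> 1" .
        then show ?thesis using r m by (simp add: abs_mult field_simps)
      qed
      then have "(\<Sum>i\<in>?I. \<bar>(x - y) \<bullet> i\<bar>) \<le> real (card ?I) * (2 * r / real m)"
        by (rule sum_bounded_above)
      then have "(\<Sum>i\<in>?I. \<bar>(x - y) \<bullet> i\<bar>) \<le> real ?k * (2 * r / real m)" unfolding cardI .
      then have "L * (\<Sum>i\<in>?I. \<bar>(x - y) \<bullet> i\<bar>) \<le> D / real m"
        using mult_left_mono[OF _ L, of _ "real ?k * (2 * r / real m)"] by (simp add: D_def)
      then show ?thesis using cone[of x y] that by (simp add: S_def)
    qed
    have diam: "bounded (S \<kappa>) \<and> diameter (S \<kappa>) \<le> D / real m" for \<kappa>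
    proof
      show "bounded (S \<kappa>)"
        by (rule bounded_subset[OF bounded_ball[of p r]]) (use A in \<open>auto simp: S_def\<close>)
      show "diameter (S \<kappa>) \<le> D / real m" using close D by (intro diameter_le) (auto simp: dist_norm)
    qed
    have finP: "finite ?P" by (simp add: finite_PiE)
    have "(\<Sum>T\<in>S ` ?P. diameter T ^ ?k) \<le> (\<Sum>T\<in>S ` ?P. (D / real m) ^ ?k)"
      using diam by (intro sum_mono power_mono) (auto intro: diameter_ge_0)
    also have "\<dots> = real (card (S ` ?P)) * (D / real m) ^ ?k" by simp
    also have "\<dots> \<le> real (card ?P) * (D / real m) ^ ?k"
      using D by (intro mult_right_mono) (auto intro!: card_image_le finP)
    also have "card ?P = m ^ ?k" using cardI by (simp add: card_PiE)
    also have "real (m ^ ?k) * (D / real m) ^ ?k = D ^ ?k" using m by (simp add: power_divide)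
    finally have "(\<Sum>T\<in>S ` ?P. diameter T ^ ?k) \<le> D ^ ?k" .
    moreover have "A \<subseteq> \<Union>(S ` ?P)" using cell by (auto simp: S_def)
    ultimately show "\<exists>\<F>. fine_cover ?k \<delta> (D ^ ?k) A \<F>"
      using finP diam m(2) unfolding fine_cover_def by (intro exI[of _ "S ` ?P"]) (auto intro: order_trans)
  qed
qed

lemma grad_inner:
  fixes f :: "'a::euclidean_space \<Rightarrow> real"
  assumes "f differentiable (at x)"
  shows "grad f x \<bullet> h = frechet_derivative f (at x) h"
proof -
  have l: "linear (frechet_derivative f (at x))" using assms by (rule linear_frechet_derivative)
  have "frechet_derivative f (at x) h = frechet_derivative f (at x) (\<Sum>b\<in>Basis. (h \<bullet> b) *\<^sub>R b)"
    by (simp add: euclidean_representation)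
  also have "\<dots> = (\<Sum>b\<in>Basis. (h \<bullet> b) * frechet_derivative f (at x) b)"
    by (simp add: linear_sum[OF l] linear_cmul[OF l])
  finally show ?thesis
    unfolding grad_def by (simp add: inner_sum_left inner_sum_right inner_commute mult.commute)
qed

lemma has_derivative_grad:
  fixes f :: "'a::euclidean_space \<Rightarrow> real"
  assumes "f differentiable (at x)"
  shows "(f has_derivative (\<lambda>h. grad f x \<bullet> h)) (at x)"
  using assms by (simp add: grad_inner frechet_derivative_works)

lemma C1_grad_continuous:
  fixes f :: "'a::euclidean_space \<Rightarrow> real"
  assumes "\<forall>k. Ck_on k W f"
  shows "\<And>x. x \<in> W \<Longrightarrow> f differentiable (at x)" "continuous_on W (grad f)"
proof -
  have c: "Ck_on (Suc 0) W f" using assms by blast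
  then show "\<And>x. x \<in> W \<Longrightarrow> f differentiable (at x)" by simp
  show "continuous_on W (grad f)"
    using c unfolding grad_def[abs_def] by (auto intro!: continuous_intros)
qed

lemma defining_function_zero:
  assumes \<Omega>: "open \<Omega>" and \<rho>: "local_defining_function \<Omega> q W \<rho>" and p: "p \<in> frontier \<Omega>" "p \<in> W"
  shows "\<rho> p = 0"
proof -
  have W: "open W" "\<Omega> \<inter> W = {x\<in>W. \<rho> x < 0}" and d: "\<rho> differentiable (at p)"
    using \<rho> C1_grad_continuous(1)[of W \<rho> p] p(2) by (auto simp: local_defining_function_def)
  have "p \<notin> \<Omega>" using p(1) \<Omega> by (simp add: frontier_def interior_open)
  then have "\<rho> p \<ge> 0" using W(2) p(2) by force
  moreover have "\<not> \<rho> p > 0"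
  proof
    assume "\<rho> p > 0"
    have "isCont \<rho> p" using d by (rule differentiable_imp_continuous_within)
    then have "(\<rho> \<longlongrightarrow> \<rho> p) (nhds p)" by (simp add: isCont_def tendsto_at_iff_tendsto_nhds)
    then have "\<forall>\<^sub>F x in nhds p. \<rho> x > 0" using \<open>\<rho> p > 0\<close> by (rule order_tendstoD(1))
    moreover have "\<forall>\<^sub>F x in nhds p. x \<in> W" using W(1) p(2) by (rule eventually_nhds_in_open)
    ultimately have "\<forall>\<^sub>F x in nhds p. \<rho> x > 0 \<and> x \<in> W" by (rule eventually_conj)
    then obtain U where U: "open U" "p \<in> U" "\<And>x. x \<in> U \<Longrightarrow> \<rho> x > 0 \<and> x \<in> W"
      unfolding eventually_nhds by blast
    have "p \<in> closure \<Omega>" using p(1) by (simp add: frontier_def)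
    then have "\<Omega> \<inter> U \<noteq> {}" using U(1,2) open_Int_closure_eq_empty[of U \<Omega>] by blast
    then show False using U(3) W(2) by force
  qed
  ultimately show ?thesis by simp
qed

text \<open>
  The mean value inequality for the difference of \<open>f\<close> and the linear function given by \<open>g\<close>.
\<close>

lemma strict_derivative_bound:
  fixes f :: "'a::euclidean_space \<Rightarrow> real"
  assumes "\<And>x. x \<in> ball p r \<Longrightarrow> f differentiable (at x)"
    and "\<And>x. x \<in> ball p r \<Longrightarrow> norm (grad f x - g) \<le> \<eta>"
    and "x \<in> ball p r" "y \<in> ball p r"
  shows "\<bar>f x - f y - g \<bullet> (x - y)\<bar> \<le> \<eta> * norm (x - y)"
proof -
  have "norm ((f x - g \<bullet> x) - (f y - g \<bullet> y)) \<le> \<eta> * norm (x - y)"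
  proof (rule differentiable_bound[of "ball p r" _ "\<lambda>z h. (grad f z - g) \<bullet> h"])
    fix z assume z: "z \<in> ball p r"
    show "((\<lambda>z. f z - g \<bullet> z) has_derivative (\<bullet>) (grad f z - g)) (at z within ball p r)"
      using has_derivative_grad[OF assms(1)[OF z]]
      by (auto intro!: derivative_eq_intros intro: has_derivative_at_withinI simp: inner_diff_left)
    show "onorm ((\<bullet>) (grad f z - g)) \<le> \<eta>"
    proof (rule onorm_le)
      fix h
      show "norm ((grad f z - g) \<bullet> h) \<le> \<eta> * norm h"
        using Cauchy_Schwarz_ineq2[of "grad f z - g" h] mult_right_mono[OF assms(2)[OF z], of "norm h"] by simp
    qed
  qed (use assms in auto)
  then show ?thesis by (simp add: inner_diff_right algebra_simps)
qed

text \<open>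
  Near \<open>p\<close> the gradient of \<rho> is almost constant and \<rho> vanishes on the boundary, so differences
  of boundary points are almost orthogonal to \<open>g\<close>, the gradient at \<open>p\<close>. A coordinate \<open>b\<close> in which
  \<open>g\<close> does not vanish is then controlled by the other coordinates.
\<close>

lemma frontier_finite_content_local:
  fixes \<Omega> :: "'a::euclidean_space set"
  assumes \<Omega>: "open \<Omega>" and p: "p \<in> frontier \<Omega>" and \<rho>: "local_defining_function \<Omega> p W \<rho>"
  shows "\<exists>r>0. finite_content (DIM('a) - 1) (frontier \<Omega> \<inter> ball p r)"
proof -
  have W: "open W" "p \<in> W" and C: "\<forall>k. Ck_on k W \<rho>" and g0: "grad \<rho> p \<noteq> 0"
    using \<rho> by (auto simp: local_defining_function_def)
  define g where "g = grad \<rho> p"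
  obtain b where b: "b \<in> Basis" "g \<bullet> b \<noteq> 0" using g0 euclidean_all_zero_iff[of g] unfolding g_def by blast
  \<comment> \<open>Half of the coefficient of coordinate \<open>b\<close>, so that the error term can be absorbed.\<close>
  define \<eta> where "\<eta> = \<bar>g \<bullet> b\<bar> / 2"
  have \<eta>: "\<eta> > 0" using b by (simp add: \<eta>_def)
  obtain r1 where r1: "r1 > 0" "ball p r1 \<subseteq> W" using W openE by blast
  obtain r2 where r2: "r2 > 0" "\<And>x. x \<in> W \<Longrightarrow> dist x p < r2 \<Longrightarrow> dist (grad \<rho> x) g < \<eta>"
    using C1_grad_continuous(2)[OF C] W(2) \<eta> unfolding continuous_on_iff g_def by blast
  define r where "r = min r1 r2"
  have r: "r > 0" using r1 r2 by (simp add: r_def)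
  have rW: "x \<in> W" if "x \<in> ball p r" for x using that r1 by (auto simp: r_def)
  have rg: "norm (grad \<rho> x - g) \<le> \<eta>" if "x \<in> ball p r" for x
    using r2(2)[OF rW[OF that]] that by (auto simp: r_def dist_norm norm_minus_commute)
  define L where "L = 2 + 2 * norm g / \<bar>g \<bullet> b\<bar>"
  have "norm (x - y) \<le> L * (\<Sum>i\<in>Basis - {b}. \<bar>(x - y) \<bullet> i\<bar>)"
    if x: "x \<in> frontier \<Omega> \<inter> ball p r" and y: "y \<in> frontier \<Omega> \<inter> ball p r" for x y
  proof -
    let ?z = "x - y" and ?Q = "\<Sum>i\<in>Basis - {b}. \<bar>(x - y) \<bullet> i\<bar>"
    have "\<rho> x = 0" "\<rho> y = 0" using defining_function_zero[OF \<Omega> \<rho>] x y rW by auto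
    then have 1: "\<bar>g \<bullet> ?z\<bar> \<le> \<eta> * norm ?z"
      using strict_derivative_bound[of p r \<rho> g \<eta> x y] C1_grad_continuous(1)[OF C] rW rg x y by auto
    have "norm ?z \<le> (\<Sum>i\<in>Basis. \<bar>?z \<bullet> i\<bar>)" by (rule norm_le_l1)
    also have "\<dots> = \<bar>?z \<bullet> b\<bar> + ?Q" using b by (simp add: sum.remove)
    finally have 2: "norm ?z \<le> \<bar>?z \<bullet> b\<bar> + ?Q" .
    have "g \<bullet> ?z = (\<Sum>i\<in>Basis. (g \<bullet> i) * (?z \<bullet> i))" by (rule euclidean_inner)
    also have "\<dots> = (g \<bullet> b) * (?z \<bullet> b) + (\<Sum>i\<in>Basis - {b}. (g \<bullet> i) * (?z \<bullet> i))"
      using b by (simp add: sum.remove)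
    finally have "\<bar>g \<bullet> b\<bar> * \<bar>?z \<bullet> b\<bar> \<le> \<bar>g \<bullet> ?z\<bar> + \<bar>\<Sum>i\<in>Basis - {b}. (g \<bullet> i) * (?z \<bullet> i)\<bar>"
      by (simp add: abs_mult[symmetric])
    also have "\<bar>\<Sum>i\<in>Basis - {b}. (g \<bullet> i) * (?z \<bullet> i)\<bar> \<le> (\<Sum>i\<in>Basis - {b}. norm g * \<bar>?z \<bullet> i\<bar>)"
      by (intro order_trans[OF sum_abs] sum_mono) (auto simp: abs_mult intro!: mult_right_mono Basis_le_norm)
    also have "\<dots> = norm g * ?Q" by (simp add: sum_distrib_left)
    finally have 3: "\<bar>g \<bullet> b\<bar> * \<bar>?z \<bullet> b\<bar> \<le> \<bar>g \<bullet> ?z\<bar> + norm g * ?Q" by simp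
    have "\<eta> * norm ?z \<le> \<eta> * (\<bar>?z \<bullet> b\<bar> + ?Q)" using 2 \<eta> by (intro mult_left_mono) auto
    then have "\<bar>g \<bullet> b\<bar> * \<bar>?z \<bullet> b\<bar> \<le> \<eta> * (\<bar>?z \<bullet> b\<bar> + ?Q) + norm g * ?Q" using 1 3 by linarith
    then have "\<eta> * \<bar>?z \<bullet> b\<bar> \<le> \<eta> * ?Q + norm g * ?Q" by (simp add: \<eta>_def algebra_simps)
    then have "\<bar>?z \<bullet> b\<bar> \<le> ?Q + norm g / \<eta> * ?Q" using \<eta> by (simp add: field_simps)
    moreover have "norm g / \<eta> = 2 * norm g / \<bar>g \<bullet> b\<bar>" by (simp add: \<eta>_def)
    ultimately show ?thesis using 2 unfolding L_def by (simp add: distrib_right)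
  qed
  then have "finite_content (DIM('a) - 1) (frontier \<Omega> \<inter> ball p r)"
    by (intro finite_content_graph[OF b(1) r, of _ p L]) (auto simp: L_def)
  then show ?thesis using r by blast
qed

lemma frontier_finite_content:
  fixes \<Omega> :: "'a::euclidean_space set"
  assumes "smooth_bounded_domain \<Omega>"
  shows "finite_content (DIM('a) - 1) (frontier \<Omega>)"
proof -
  have \<Omega>: "open \<Omega>" "bounded \<Omega>" and loc: "\<And>p. p \<in> frontier \<Omega> \<Longrightarrow> \<exists>W \<rho>. local_defining_function \<Omega> p W \<rho>"
    using assms by (auto simp: smooth_bounded_domain_def)
  have "\<exists>r>0. finite_content (DIM('a) - 1) (frontier \<Omega> \<inter> ball p r)" if "p \<in> frontier \<Omega>" for p
    using frontier_finite_content_local[OF \<Omega>(1) that] loc[OF that] by blast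
  then obtain r where r: "\<And>p. p \<in> frontier \<Omega> \<Longrightarrow> r p > 0 \<and> finite_content (DIM('a) - 1) (frontier \<Omega> \<inter> ball p (r p))"
    by metis
  obtain F where F: "F \<subseteq> frontier \<Omega>" "finite F" "frontier \<Omega> \<subseteq> (\<Union>p\<in>F. ball p (r p))"
    using compactE_image[OF compact_frontier_bounded[OF \<Omega>(2)], of "frontier \<Omega>" "\<lambda>p. ball p (r p)"] r by force
  have "finite_content (DIM('a) - 1) (\<Union>p\<in>F. frontier \<Omega> \<inter> ball p (r p))"
    using F r by (intro finite_content_UN) auto
  then show ?thesis by (rule finite_content_mono) (use F in auto)
qed

lemma sets_surface_measure [measurable_cong]: "sets (surface_measure \<Omega>) = sets borel"
  unfolding surface_measure_def by (metis sets.sets_measure_of_eq space_borel)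

lemma space_surface_measure [simp]: "space (surface_measure \<Omega>) = UNIV"
  unfolding surface_measure_def by (simp add: space_measure_of_conv)

text \<open>
  If the Hausdorff content is not a measure on the Borel sets, then the measure built from it is the
  null measure by convention. So finiteness follows in either case from the bound for the
  content.
\<close>

lemma finite_surface_measure:
  fixes \<Omega> :: "'a::euclidean_space set"
  assumes "smooth_bounded_domain \<Omega>"
  shows "finite_measure (surface_measure \<Omega>)"
proof (rule finite_measureI)
  have "hausdorff (DIM('a) - 1) (frontier \<Omega>) < \<infinity>"
    by (rule hausdorff_finite[OF frontier_finite_content[OF assms]])
  then show "emeasure (surface_measure \<Omega>) (space (surface_measure \<Omega>)) \<noteq> \<infinity>"
    unfolding space_surface_measure unfolding surface_measure_def emeasure_measure_of_conv by auto
qed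

lemma derivative_along_line:
  fixes f :: "'a::euclidean_space \<Rightarrow> real"
  assumes "f differentiable (at p)"
  shows "((\<lambda>t. f (p + t *\<^sub>R v)) has_real_derivative grad f p \<bullet> v) (at 0)"
proof -
  have "((\<lambda>t. p + t *\<^sub>R v) has_derivative (\<lambda>t. t *\<^sub>R v)) (at (0::real))"
    by (auto intro!: derivative_eq_intros)
  moreover have "(f has_derivative (\<lambda>h. grad f p \<bullet> h)) (at (p + 0 *\<^sub>R v))"
    using has_derivative_grad[OF assms] by simp
  ultimately have "(f \<circ> (\<lambda>t. p + t *\<^sub>R v) has_derivative (\<lambda>h. grad f p \<bullet> h) \<circ> (\<lambda>t. t *\<^sub>R v)) (at (0::real))"
    by (rule diff_chain_at)
  then show ?thesis
    by (simp add: comp_def has_field_derivative_def mult_commute_abs)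
qed

text \<open>
  If two defining functions had different unit normals \<open>n\<^sub>0\<close> and \<open>n\<close>, then the direction
  \<open>n - n\<^sub>0\<close> would point into \<Omega> according to the first and out of \<Omega> according to the second.
\<close>

lemma outward_normal_eq:
  fixes \<Omega> :: "'a::euclidean_space set"
  assumes \<Omega>: "open \<Omega>" and p: "p \<in> frontier \<Omega>" and \<rho>: "local_defining_function \<Omega> p W \<rho>"
  shows "outward_normal \<Omega> p = grad \<rho> p /\<^sub>R norm (grad \<rho> p)"
  unfolding outward_normal_def
proof (rule the_equality)
  show "\<exists>W \<rho>'. local_defining_function \<Omega> p W \<rho>' \<and> grad \<rho> p /\<^sub>R norm (grad \<rho> p) = grad \<rho>' p /\<^sub>R norm (grad \<rho>' p)"
    using \<rho> by blast
next
  fix n assume "\<exists>W \<rho>. local_defining_function \<Omega> p W \<rho> \<and> n = grad \<rho> p /\<^sub>R norm (grad \<rho> p)"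
  then obtain W' \<rho>' where \<rho>': "local_defining_function \<Omega> p W' \<rho>'" and n: "n = grad \<rho>' p /\<^sub>R norm (grad \<rho>' p)" by blast
  define n0 where "n0 = grad \<rho> p /\<^sub>R norm (grad \<rho> p)"
  have g: "grad \<rho> p \<noteq> 0" "grad \<rho>' p \<noteq> 0" and W: "open W" "open W'" "p \<in> W" "p \<in> W'"
    and neg: "\<Omega> \<inter> W = {x\<in>W. \<rho> x < 0}" "\<Omega> \<inter> W' = {x\<in>W'. \<rho>' x < 0}"
    and d: "\<rho> differentiable (at p)" "\<rho>' differentiable (at p)"
    using \<rho> \<rho>' C1_grad_continuous(1)[of W \<rho> p] C1_grad_continuous(1)[of W' \<rho>' p]
    by (auto simp: local_defining_function_def)
  have unit: "norm n = 1" "norm n0 = 1" using g by (auto simp: n n0_def)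
  show "n = grad \<rho> p /\<^sub>R norm (grad \<rho> p)"
  proof (rule ccontr)
    assume "n \<noteq> grad \<rho> p /\<^sub>R norm (grad \<rho> p)"
    then have "n \<noteq> n0" by (simp add: n0_def)
    define v where "v = n - n0"
    have nn: "n \<bullet> n = 1" "n0 \<bullet> n0 = 1" using unit by (simp_all add: dot_square_norm)
    have "v \<bullet> v > 0" using \<open>n \<noteq> n0\<close> by (simp add: v_def)
    then have lt: "n \<bullet> n0 < 1" using nn by (simp add: v_def inner_diff_left inner_diff_right inner_commute[of n0 n])
    have "grad \<rho> p = norm (grad \<rho> p) *\<^sub>R n0" "grad \<rho>' p = norm (grad \<rho>' p) *\<^sub>R n"
      using g by (auto simp: n n0_def)
    moreover have "n0 \<bullet> v < 0" "n \<bullet> v > 0" using lt nn by (simp_all add: v_def inner_diff_right inner_commute[of n0 n])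
    ultimately have s: "grad \<rho> p \<bullet> v < 0" "grad \<rho>' p \<bullet> v > 0"
      using g by (metis inner_scaleR_left mult_pos_neg zero_less_norm_iff, metis inner_scaleR_left mult_pos_pos zero_less_norm_iff)
    have z: "\<rho> p = 0" "\<rho>' p = 0" using defining_function_zero[OF \<Omega> _ p] \<rho> \<rho>' W by blast+
    obtain e1 where e1: "e1 > 0" "\<And>h. 0 < h \<Longrightarrow> h < e1 \<Longrightarrow> \<rho> (p + h *\<^sub>R v) < 0"
      using DERIV_neg_dec_right[OF derivative_along_line[OF d(1)] s(1)] z(1) by auto
    obtain e2 where e2: "e2 > 0" "\<And>h. 0 < h \<Longrightarrow> h < e2 \<Longrightarrow> \<rho>' (p + h *\<^sub>R v) > 0"
      using DERIV_pos_inc_right[OF derivative_along_line[OF d(2)] s(2)] z(2) by auto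
    have "open (W \<inter> W')" "p \<in> W \<inter> W'" using W by auto
    then obtain e3 where e3: "e3 > 0" "ball p e3 \<subseteq> W \<inter> W'" using openE by blast
    have v0: "norm v > 0" using \<open>v \<bullet> v > 0\<close> by auto
    define h where "h = min (min e1 e2) (e3 / norm v) / 2"
    have h: "0 < h" "h < e1" "h < e2" "h < e3 / norm v" 
    proof -
      have m: "0 < min (min e1 e2) (e3 / norm v)" using e1 e2 e3 v0 by simp
      then have "0 < h" unfolding h_def by (rule half_gt_zero)
      moreover have "h + h = min (min e1 e2) (e3 / norm v)" unfolding h_def by (rule field_sum_of_halves)
      ultimately have "0 < h" "h < min (min e1 e2) (e3 / norm v)" by linarith+
      then show "0 < h" "h < e1" "h < e2" "h < e3 / norm v" by auto
    qed
    then have "norm (h *\<^sub>R v) < e3" using v0 by (simp add: field_simps)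
    then have "p + h *\<^sub>R v \<in> W \<inter> W'" using e3(2) by (auto simp: dist_norm subset_iff)
    then show False using e1(2)[OF h(1,2)] e2(2)[OF h(1,3)] neg by force
  qed
qed

lemma continuous_on_outward_normal:
  fixes \<Omega> :: "'a::euclidean_space set"
  assumes "smooth_bounded_domain \<Omega>"
  shows "continuous_on (frontier \<Omega>) (outward_normal \<Omega>)"
  unfolding continuous_on_eq_continuous_within
proof
  fix p assume p: "p \<in> frontier \<Omega>"
  have \<Omega>: "open \<Omega>" using assms by (simp add: smooth_bounded_domain_def)
  obtain W \<rho> where \<rho>: "local_defining_function \<Omega> p W \<rho>"
    using assms p unfolding smooth_bounded_domain_def by blast
  have W: "open W" "p \<in> W" and C: "\<forall>k. Ck_on k W \<rho>" and g: "\<And>x. x \<in> W \<Longrightarrow> grad \<rho> x \<noteq> 0"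
    using \<rho> by (auto simp: local_defining_function_def)
  have "continuous_on W (\<lambda>x. grad \<rho> x /\<^sub>R norm (grad \<rho> x))"
    using C1_grad_continuous(2)[OF C] g by (intro continuous_intros) auto
  then have "continuous (at p within frontier \<Omega>) (\<lambda>x. grad \<rho> x /\<^sub>R norm (grad \<rho> x))"
    using W by (meson continuous_at_imp_continuous_at_within continuous_on_eq_continuous_at)
  moreover obtain e where e: "e > 0" "ball p e \<subseteq> W" using W openE by blast
  have "grad \<rho> x /\<^sub>R norm (grad \<rho> x) = outward_normal \<Omega> x" if "x \<in> frontier \<Omega>" "dist x p < e" for x
  proof -
    have "x \<in> W" using that(2) e(2) by (auto simp: dist_commute)
    then have "local_defining_function \<Omega> x W \<rho>" using \<rho> by (simp add: local_defining_function_def)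
    then show ?thesis using outward_normal_eq[OF \<Omega> that(1)] by simp
  qed
  ultimately show "continuous (at p within frontier \<Omega>) (outward_normal \<Omega>)"
    using continuous_transform_within[of p "frontier \<Omega>" "\<lambda>x. grad \<rho> x /\<^sub>R norm (grad \<rho> x)" e "outward_normal \<Omega>"] e(1) p by blast
qed

lemma Gamma_measurable:
  fixes \<Omega> :: "'a::euclidean_space set"
  assumes \<Omega>: "smooth_bounded_domain \<Omega>" and H: "continuous_on (closure \<Omega>) H"
  shows "Gamma_minus \<Omega> H \<in> sets borel" "Gamma_plus \<Omega> H \<in> sets borel"
proof -
  have "continuous_on (frontier \<Omega>) (\<lambda>x. H x \<bullet> outward_normal \<Omega> x)"
    using continuous_on_outward_normal[OF \<Omega>] continuous_on_subset[OF H]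
    by (intro continuous_intros) (auto simp: frontier_def)
  then have "closed (frontier \<Omega> \<inter> (\<lambda>x. H x \<bullet> outward_normal \<Omega> x) -` {..0})"
    by (rule continuous_closed_preimage) auto
  moreover have "Gamma_minus \<Omega> H = frontier \<Omega> \<inter> (\<lambda>x. H x \<bullet> outward_normal \<Omega> x) -` {..0}"
    by (auto simp: Gamma_minus_def)
  ultimately show m: "Gamma_minus \<Omega> H \<in> sets borel" by simp
  have "Gamma_plus \<Omega> H = frontier \<Omega> - Gamma_minus \<Omega> H"
    by (auto simp: Gamma_minus_def Gamma_plus_def)
  then show "Gamma_plus \<Omega> H \<in> sets borel" using m by (simp add: borel_closed sets.Diff)
qed

section \<open>Energies of affine residuals\<close>

text \<open>
  The three integrals of the Carleman functional are energies of maps \<open>p\<close> of this kind: affine in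
  the unknown, square integrable at 0, and Lipschitz from \<open>H\<^sup>s\<close> into \<open>L\<^sup>2\<close> with a pointwise
  bound. Affinity is recorded in the midpoint form, in which convexity uses it.
\<close>

definition affine_residual ::
    "nat \<Rightarrow> real \<Rightarrow> 'a::euclidean_space set \<Rightarrow> 'a measure \<Rightarrow> ((nat \<Rightarrow> 'a \<Rightarrow> real) \<Rightarrow> nat \<Rightarrow> 'a \<Rightarrow> real) \<Rightarrow> bool" where
  "affine_residual N s \<Omega> M p \<longleftrightarrow>
     (\<forall>U\<in>Hs_vec N s \<Omega>. \<forall>m\<le>N. p U m \<in> borel_measurable M) \<and>
     (\<forall>m\<le>N. integrable M (\<lambda>x. (p (\<lambda>_ _. 0) m x)\<^sup>2)) \<and>
     (\<forall>U\<in>Hs_vec N s \<Omega>. \<forall>W\<in>Hs_vec N s \<Omega>. \<forall>m\<le>N. \<forall>x.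
        p (\<lambda>m x. (U m x + W m x) / 2) m x = (p U m x + p W m x) / 2) \<and>
     (\<exists>D. integrable M (\<lambda>x. (D x)\<^sup>2) \<and>
        (\<forall>U\<in>Hs_vec N s \<Omega>. \<forall>W\<in>Hs_vec N s \<Omega>. \<forall>m\<le>N. AE x in M.
           \<bar>p U m x - p W m x\<bar> \<le> Hs_dist N s \<Omega> U W * D x))"

lemma affine_residual_dominated:
  assumes p: "affine_residual N s \<Omega> M p"
  shows "\<exists>D. integrable M (\<lambda>x. (D x)\<^sup>2) \<and>
      (\<forall>U\<in>Hs_vec N s \<Omega>. \<forall>W\<in>Hs_vec N s \<Omega>. \<forall>m\<le>N. AE x in M.
         \<bar>p U m x - p W m x\<bar> \<le> Hs_dist N s \<Omega> U W * D x)"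
  using p unfolding affine_residual_def by (elim conjE)

definition residual_energy ::
    "nat \<Rightarrow> 'a measure \<Rightarrow> ((nat \<Rightarrow> 'a \<Rightarrow> real) \<Rightarrow> nat \<Rightarrow> 'a \<Rightarrow> real) \<Rightarrow> (nat \<Rightarrow> 'a \<Rightarrow> real) \<Rightarrow> real" where
  "residual_energy N M p U = (LINT x|M. (\<Sum>m\<le>N. (p U m x)\<^sup>2))"

lemma residual_energy_nonneg: "residual_energy N M p U \<ge> 0"
  unfolding residual_energy_def by (intro Bochner_Integration.integral_nonneg sum_nonneg) auto

lemma sq_le_of_diff_bound:
  fixes a b d :: real
  assumes "\<bar>a - b\<bar> \<le> d" shows "a\<^sup>2 \<le> 2 * b\<^sup>2 + 2 * d\<^sup>2"
proof -
  have "(a - b)\<^sup>2 \<le> d\<^sup>2" using assms by (metis abs_ge_zero power2_abs power_mono)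
  moreover have "a\<^sup>2 + (2 * b - a)\<^sup>2 = 2 * b\<^sup>2 + 2 * (a - b)\<^sup>2" by (simp add: power2_eq_square algebra_simps)
  ultimately show ?thesis using zero_le_power2[of "2 * b - a"] by linarith
qed

lemma affine_residual_integrable:
  fixes \<Omega> :: "'a::euclidean_space set"
  assumes p: "affine_residual N s \<Omega> M p" and s: "s > real DIM('a) / 2" and U: "U \<in> Hs_vec N s \<Omega>" and m: "m \<le> N"
  shows "integrable M (\<lambda>x. (p U m x)\<^sup>2)"
proof -
  obtain D where D: "integrable M (\<lambda>x. (D x)\<^sup>2)"
    "\<forall>U\<in>Hs_vec N s \<Omega>. \<forall>W\<in>Hs_vec N s \<Omega>. \<forall>m\<le>N. AE x in M.
      \<bar>p U m x - p W m x\<bar> \<le> Hs_dist N s \<Omega> U W * D x"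
    using affine_residual_dominated[OF p] by (elim exE conjE)
  have Z: "(\<lambda>_ _. 0) \<in> Hs_vec N s \<Omega>" by (rule Hs_vec_zero[OF s U])
  let ?d = "Hs_vec_norm N s \<Omega> (\<lambda>m x. U m x - 0)"
  show ?thesis
  proof (rule Bochner_Integration.integrable_bound)
    show "integrable M (\<lambda>x. 2 * (p (\<lambda>_ _. 0) m x)\<^sup>2 + 2 * (?d * D x)\<^sup>2)"
      using p m D(1) unfolding affine_residual_def by (simp add: power_mult_distrib)
    show "(\<lambda>x. (p U m x)\<^sup>2) \<in> borel_measurable M"
      using p U m unfolding affine_residual_def by (intro borel_measurable_power) blast
    show "AE x in M. norm ((p U m x)\<^sup>2) \<le> norm (2 * (p (\<lambda>_ _. 0) m x)\<^sup>2 + 2 * (?d * D x)\<^sup>2)"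
      using D(2)[rule_format, OF U Z m] by (rule eventually_mono) (auto dest: sq_le_of_diff_bound)
  qed
qed

lemma residual_energy_midpoint:
  fixes \<Omega> :: "'a::euclidean_space set"
  assumes p: "affine_residual N s \<Omega> M p" and s: "s > real DIM('a) / 2"
    and U: "U \<in> Hs_vec N s \<Omega>" and W: "W \<in> Hs_vec N s \<Omega>"
  shows "residual_energy N M p (\<lambda>m x. (U m x + W m x) / 2) \<le> (residual_energy N M p U + residual_energy N M p W) / 2"
proof -
  let ?Q = "\<lambda>U x. \<Sum>m\<le>N. (p U m x)\<^sup>2"
  note i = affine_residual_integrable[OF p s]
  have Q: "integrable M (?Q V)" if "V \<in> Hs_vec N s \<Omega>" for V
    using i[OF that] by (intro Bochner_Integration.integrable_sum) auto
  have sq: "((a + b) / 2)\<^sup>2 \<le> (a\<^sup>2 + b\<^sup>2) / 2" for a b :: real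
  proof -
    have "0 \<le> (a - b)\<^sup>2 / 4" by simp
    also have "\<dots> = (a\<^sup>2 + b\<^sup>2) / 2 - ((a + b) / 2)\<^sup>2" by (simp add: power2_eq_square field_simps)
    finally show ?thesis by simp
  qed
  have "?Q (\<lambda>m x. (U m x + W m x) / 2) x \<le> (?Q U x + ?Q W x) / 2" for x
  proof -
    have mid: "p (\<lambda>m x. (U m x + W m x) / 2) m x = (p U m x + p W m x) / 2" if "m \<le> N" for m
      using p U W that unfolding affine_residual_def by blast
    have "?Q (\<lambda>m x. (U m x + W m x) / 2) x = (\<Sum>m\<le>N. ((p U m x + p W m x) / 2)\<^sup>2)"
      by (intro sum.cong refl) (simp only: mid atMost_iff)
    also have "\<dots> \<le> (\<Sum>m\<le>N. ((p U m x)\<^sup>2 + (p W m x)\<^sup>2) / 2)" by (intro sum_mono sq)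
    finally show ?thesis by (simp add: sum.distrib sum_divide_distrib[symmetric])
  qed
  then have "residual_energy N M p (\<lambda>m x. (U m x + W m x) / 2) \<le> (LINT x|M. (?Q U x + ?Q W x) / 2)"
    unfolding residual_energy_def using Q U W Hs_vec_midpoint(1)[OF s U W] by (intro integral_mono) auto
  then show ?thesis unfolding residual_energy_def using Q U W by simp
qed

text \<open>
  The pointwise Lipschitz bound yields almost everywhere convergence and, since convergent
  sequences of distances are bounded, a dominating function.
\<close>

lemma residual_energy_tendsto:
  fixes \<Omega> :: "'a::euclidean_space set" and X :: "nat \<Rightarrow> nat \<Rightarrow> 'a \<Rightarrow> real"
  assumes p: "affine_residual N s \<Omega> M p" and s: "s > real DIM('a) / 2"
    and X: "\<And>k. X k \<in> Hs_vec N s \<Omega>" and V: "V \<in> Hs_vec N s \<Omega>"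
    and lim: "(\<lambda>k. Hs_dist N s \<Omega> (X k) V) \<longlonglongrightarrow> 0"
  shows "(\<lambda>k. residual_energy N M p (X k)) \<longlonglongrightarrow> residual_energy N M p V"
proof -
  obtain D where D: "integrable M (\<lambda>x. (D x)\<^sup>2)"
    "\<forall>U\<in>Hs_vec N s \<Omega>. \<forall>W\<in>Hs_vec N s \<Omega>. \<forall>m\<le>N. AE x in M.
      \<bar>p U m x - p W m x\<bar> \<le> Hs_dist N s \<Omega> U W * D x"
    using affine_residual_dominated[OF p] by (elim exE conjE)
  define \<delta> where "\<delta> k = Hs_dist N s \<Omega> (X k) V" for k
  have \<delta>: "\<delta> \<longlonglongrightarrow> 0" "\<And>k. \<delta> k \<ge> 0" using lim by (simp_all add: \<delta>_def[abs_def] Hs_vec_norm_nonneg)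
  obtain C where C: "\<And>k. \<bar>\<delta> k\<bar> \<le> C"
    using convergent_imp_Bseq[of \<delta>] \<delta>(1) unfolding Bseq_def convergent_def by (metis real_norm_def)
  have AE: "AE x in M. \<forall>k. \<bar>p (X k) m x - p V m x\<bar> \<le> \<delta> k * D x" if "m \<le> N" for m
    unfolding AE_all_countable using D(2)[rule_format, OF X V that] by (simp add: \<delta>_def)
  have "(\<lambda>k. LINT x|M. (p (X k) m x)\<^sup>2) \<longlonglongrightarrow> (LINT x|M. (p V m x)\<^sup>2)" if m: "m \<le> N" for m
  proof (rule integral_dominated_convergence[where w = "\<lambda>x. 2 * (p V m x)\<^sup>2 + 2 * (C * D x)\<^sup>2"])
    show "(\<lambda>x. (p V m x)\<^sup>2) \<in> borel_measurable M" "\<And>k. (\<lambda>x. (p (X k) m x)\<^sup>2) \<in> borel_measurable M"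
      using affine_residual_integrable[OF p s _ m] V X by (auto intro!: borel_measurable_integrable)
    show "integrable M (\<lambda>x. 2 * (p V m x)\<^sup>2 + 2 * (C * D x)\<^sup>2)"
      using affine_residual_integrable[OF p s V m] D(1) by (simp add: power_mult_distrib)
    show "AE x in M. (\<lambda>k. (p (X k) m x)\<^sup>2) \<longlonglongrightarrow> (p V m x)\<^sup>2"
      using AE[OF m]
    proof (rule eventually_mono)
      fix x assume x: "\<forall>k. \<bar>p (X k) m x - p V m x\<bar> \<le> \<delta> k * D x"
      have "(\<lambda>k. p (X k) m x - p V m x) \<longlonglongrightarrow> 0"
        by (rule Lim_null_comparison[OF always_eventually tendsto_mult_left_zero[OF \<delta>(1)]]) (use x in simp)
      then show "(\<lambda>k. (p (X k) m x)\<^sup>2) \<longlonglongrightarrow> (p V m x)\<^sup>2"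
        by (intro tendsto_power) (simp add: LIM_zero_iff)
    qed
    show "AE x in M. norm ((p (X k) m x)\<^sup>2) \<le> 2 * (p V m x)\<^sup>2 + 2 * (C * D x)\<^sup>2" for k
      using AE[OF m]
    proof (rule eventually_mono)
      fix x assume "\<forall>k. \<bar>p (X k) m x - p V m x\<bar> \<le> \<delta> k * D x"
      then have "(p (X k) m x)\<^sup>2 \<le> 2 * (p V m x)\<^sup>2 + 2 * (\<delta> k * D x)\<^sup>2"
        by (intro sq_le_of_diff_bound) blast
      also have "(\<delta> k * D x)\<^sup>2 \<le> (C * D x)\<^sup>2"
        using power_mono[OF C[of k], of 2] by (simp add: power_mult_distrib mult_right_mono)
      finally show "norm ((p (X k) m x)\<^sup>2) \<le> 2 * (p V m x)\<^sup>2 + 2 * (C * D x)\<^sup>2" by simp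
    qed
  qed
  then have "(\<lambda>k. \<Sum>m\<le>N. LINT x|M. (p (X k) m x)\<^sup>2) \<longlonglongrightarrow> (\<Sum>m\<le>N. LINT x|M. (p V m x)\<^sup>2)"
    by (intro tendsto_sum) auto
  moreover have "residual_energy N M p U = (\<Sum>m\<le>N. LINT x|M. (p U m x)\<^sup>2)" if "U \<in> Hs_vec N s \<Omega>" for U
    unfolding residual_energy_def using affine_residual_integrable[OF p s that]
    by (intro Bochner_Integration.integral_sum) auto
  ultimately show ?thesis using X V by simp
qed

text \<open>
  One bound for all coefficients of the system.
\<close>

lemma uniform_AE_bound:
  fixes K :: "'i \<Rightarrow> 'a \<Rightarrow> real"
  assumes "finite I" "\<And>i. i \<in> I \<Longrightarrow> \<exists>B. AE x in M. x \<in> \<Omega> \<longrightarrow> \<bar>K i x\<bar> \<le> B"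
  shows "\<exists>B\<ge>0. \<forall>i\<in>I. AE x in M. x \<in> \<Omega> \<longrightarrow> \<bar>K i x\<bar> \<le> B"
proof -
  obtain b where b: "\<And>i. i \<in> I \<Longrightarrow> AE x in M. x \<in> \<Omega> \<longrightarrow> \<bar>K i x\<bar> \<le> b i" using assms(2) by metis
  have "AE x in M. x \<in> \<Omega> \<longrightarrow> \<bar>K i x\<bar> \<le> (\<Sum>i\<in>I. \<bar>b i\<bar>)" if "i \<in> I" for i
  proof -
    have "b i \<le> (\<Sum>i\<in>I. \<bar>b i\<bar>)"
      using member_le_sum[of i I "\<lambda>i. \<bar>b i\<bar>"] that assms(1) by force
    then show ?thesis using b[OF that] by (auto elim!: eventually_mono)
  qed
  then show ?thesis by (intro exI[of _ "\<Sum>i\<in>I. \<bar>b i\<bar>"]) (auto intro: sum_nonneg)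
qed

text \<open>
  The transport residual. The embedding into \<open>C\<^sup>1\<close> bounds the difference of two residuals by a
  constant multiple of the \<open>H\<^sup>s\<close> distance, and constants are square integrable on the bounded
  set \<Omega>. The bounds on the coefficients hold almost everywhere, as the memory term in \<open>K\<close> contains
  the essentially bounded kernel.
\<close>

lemma affine_residual_domain:
  fixes \<Omega> :: "'a::euclidean_space set" and H :: "'a \<Rightarrow> 'a" and K :: "nat \<Rightarrow> nat \<Rightarrow> 'a \<Rightarrow> real"
  assumes s: "s > real DIM('a) / 2 + 1" and \<Omega>: "open \<Omega>" "bounded \<Omega>"
    and w: "continuous_on (closure \<Omega>) w" and H: "continuous_on (closure \<Omega>) H"
    and K: "\<And>m n. m \<le> N \<Longrightarrow> n \<le> N \<Longrightarrow> (\<lambda>x. indicator \<Omega> x * K m n x) \<in> borel_measurable borel"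
      "\<And>m n. m \<le> N \<Longrightarrow> n \<le> N \<Longrightarrow> \<exists>B. AE x in lborel. x \<in> \<Omega> \<longrightarrow> \<bar>K m n x\<bar> \<le> B"
    and F: "\<And>m. m \<le> N \<Longrightarrow> (\<lambda>x. indicator \<Omega> x * F m x) \<in> borel_measurable borel"
      "\<And>m. m \<le> N \<Longrightarrow> \<exists>B. AE x in lborel. x \<in> \<Omega> \<longrightarrow> \<bar>F m x\<bar> \<le> B"
  shows "affine_residual N s \<Omega> lborel
    (\<lambda>U m x. indicator \<Omega> x * (w x * (H x \<bullet> grad (U m) x + ((\<Sum>n\<le>N. K m n x * U n x) + F m x))))"
proof -
  have s0: "s > real DIM('a) / 2" using s by simp
  let ?V = "Hs_vec N s \<Omega>"
  let ?p = "\<lambda>U m x. indicator \<Omega> x * (w x * (H x \<bullet> grad (U m) x + ((\<Sum>n\<le>N. K m n x * U n x) + F m x)))"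
  let ?d = "\<lambda>u b x. indicator \<Omega> x * frechet_derivative u (at x) b"
  have comp: "compact (closure \<Omega>)" using \<Omega>(2) by (simp add: compact_closure)
  have sub: "\<Omega> \<subseteq> closure \<Omega>" by (rule closure_subset)
  obtain Cw where Cw: "\<And>x. x \<in> \<Omega> \<Longrightarrow> \<bar>w x\<bar> \<le> Cw" "Cw \<ge> 0"
  proof -
    have "bounded (w ` closure \<Omega>)" by (rule compact_imp_bounded[OF compact_continuous_image[OF w comp]])
    then obtain a where "a > 0" "\<forall>y\<in>w ` closure \<Omega>. norm y \<le> a" unfolding bounded_pos by blast
    then show ?thesis using sub by (intro that[of a]) auto
  qed
  obtain CH where CH: "\<And>x. x \<in> \<Omega> \<Longrightarrow> norm (H x) \<le> CH" "CH \<ge> 0"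
  proof -
    have "bounded (H ` closure \<Omega>)" by (rule compact_imp_bounded[OF compact_continuous_image[OF H comp]])
    then obtain a where "a > 0" "\<forall>y\<in>H ` closure \<Omega>. norm y \<le> a" unfolding bounded_pos by blast
    then show ?thesis using sub by (intro that[of a]) auto
  qed
  have "\<exists>B\<ge>0. \<forall>i\<in>{..N} \<times> {..N}. AE x in lborel. x \<in> \<Omega> \<longrightarrow> \<bar>(\<lambda>(m, n). K m n) i x\<bar> \<le> B"
    by (rule uniform_AE_bound) (use K(2) in auto)
  then obtain CK where CK: "CK \<ge> 0" "\<And>m n. m \<le> N \<Longrightarrow> n \<le> N \<Longrightarrow> AE x in lborel. x \<in> \<Omega> \<longrightarrow> \<bar>K m n x\<bar> \<le> CK"
    by auto
  have "\<exists>B\<ge>0. \<forall>i\<in>{..N}. AE x in lborel. x \<in> \<Omega> \<longrightarrow> \<bar>F i x\<bar> \<le> B"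
    by (rule uniform_AE_bound) (use F(2) in auto)
  then obtain CF where CF: "CF \<ge> 0" "\<And>m. m \<le> N \<Longrightarrow> AE x in lborel. x \<in> \<Omega> \<longrightarrow> \<bar>F m x\<bar> \<le> CF"
    by auto
  have [measurable]: "\<Omega> \<in> sets borel" using \<Omega>(1) by simp
  have wm: "(\<lambda>x. indicator \<Omega> x * w x) \<in> borel_measurable borel"
    using borel_measurable_continuous_on_indicator[OF _ continuous_on_subset[OF w sub]] by simp
  have Hm: "(\<lambda>x. indicator \<Omega> x * (H x \<bullet> b)) \<in> borel_measurable borel" for b
    using borel_measurable_continuous_on_indicator[of \<Omega> "\<lambda>x. H x \<bullet> b"] continuous_on_subset[OF H sub]
    by (simp add: continuous_on_inner)
  have gradH: "H x \<bullet> grad u x = (\<Sum>b\<in>Basis. frechet_derivative u (at x) b * (H x \<bullet> b))" for u x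
    by (simp add: grad_def inner_sum_right)
  have diffble: "u differentiable (at x)" if "u \<in> Hs s \<Omega>" "x \<in> \<Omega>" for u x
    using Hs_frechet_derivative(1)[OF _ s \<Omega>(1) that(2)] that(1) by (auto simp: Hs_def)
  define L0 where "L0 = embedding_const TYPE('a) s 0"
  define L1 where "L1 = embedding_const TYPE('a) s 1"
  have L: "L0 \<ge> 0" "L1 \<ge> 0" by (simp_all add: L0_def L1_def embedding_const_nonneg)
  define D where "D = Cw * (real DIM('a) * (L1 * CH) + real (Suc N) * (CK * L0))"
  show ?thesis unfolding affine_residual_def
  proof (intro conjI ballI allI impI exI[of _ "\<lambda>x. indicator \<Omega> x * D"])
    fix U :: "nat \<Rightarrow> 'a \<Rightarrow> real" and m assume U: "U \<in> ?V" and m: "m \<le> N"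
    have [measurable]: "U n \<in> borel_measurable borel" if "n \<in> {..N}" for n
      using U that by (auto simp: Hs_vec_def intro: Hs_measurable)
    have [measurable]: "?d (U m) b \<in> borel_measurable borel" for b
      using Hs_frechet_measurable[OF _ s \<Omega>(1)] U m by (auto simp: Hs_vec_def)
    note [measurable] = wm Hm F(1)[OF m]
    have [measurable]: "(\<lambda>x. indicator \<Omega> x * K m n x) \<in> borel_measurable borel" if "n \<in> {..N}" for n
      using K(1) m that by simp
    have "(\<lambda>x. (indicator \<Omega> x * w x) * ((\<Sum>b\<in>Basis. ?d (U m) b x * (indicator \<Omega> x * (H x \<bullet> b)))
        + ((\<Sum>n\<le>N. (indicator \<Omega> x * K m n x) * U n x) + indicator \<Omega> x * F m x))) \<in> borel_measurable borel"
      by measurable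
    moreover have "?p U m = (\<lambda>x. (indicator \<Omega> x * w x) * ((\<Sum>b\<in>Basis. ?d (U m) b x * (indicator \<Omega> x * (H x \<bullet> b)))
        + ((\<Sum>n\<le>N. (indicator \<Omega> x * K m n x) * U n x) + indicator \<Omega> x * F m x)))"
      by (auto simp: fun_eq_iff indicator_def gradH)
    ultimately show "?p U m \<in> borel_measurable lborel" by simp
  next
    fix m assume m: "m \<le> N"
    have bd: "integrable lborel (\<lambda>x. indicator \<Omega> x *\<^sub>R (Cw * CF)\<^sup>2)"
      using \<Omega> by (intro integrable_real_indicator[THEN integrable_scaleR_left] emeasure_bounded_finite) auto
    show "integrable lborel (\<lambda>x. (?p (\<lambda>_ _. 0) m x)\<^sup>2)"
    proof (rule Bochner_Integration.integrable_bound[OF bd])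
      have e: "?p (\<lambda>_ _. 0) m x = (indicator \<Omega> x * w x) * (indicator \<Omega> x * F m x)" for x
        by (simp add: gradH indicator_def)
      note [measurable] = wm F(1)[OF m]
      show "(\<lambda>x. (?p (\<lambda>_ _. 0) m x)\<^sup>2) \<in> borel_measurable lborel" unfolding e by measurable
      show "AE x in lborel. norm ((?p (\<lambda>_ _. 0) m x)\<^sup>2) \<le> norm (indicator \<Omega> x *\<^sub>R (Cw * CF)\<^sup>2)"
        using CF(2)[OF m]
      proof (rule eventually_mono)
        fix x assume x: "x \<in> \<Omega> \<longrightarrow> \<bar>F m x\<bar> \<le> CF"
        show "norm ((?p (\<lambda>_ _. 0) m x)\<^sup>2) \<le> norm (indicator \<Omega> x *\<^sub>R (Cw * CF)\<^sup>2)"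
        proof (cases "x \<in> \<Omega>")
          case True
          then have "\<bar>w x * F m x\<bar> \<le> Cw * CF"
            using x Cw unfolding abs_mult by (intro mult_mono) auto
          then have "\<bar>w x * F m x\<bar>\<^sup>2 \<le> (Cw * CF)\<^sup>2" by (intro power_mono) auto
          then show ?thesis using True unfolding e by simp
        qed (simp add: e)
      qed
    qed
  next
    fix U W :: "nat \<Rightarrow> 'a \<Rightarrow> real" and m x assume U: "U \<in> ?V" and W: "W \<in> ?V" and m: "m \<le> N"
    show "?p (\<lambda>m x. (U m x + W m x) / 2) m x = (?p U m x + ?p W m x) / 2"
    proof (cases "x \<in> \<Omega>")
      case True
      have d: "(U m has_derivative frechet_derivative (U m) (at x)) (at x)" "(W m has_derivative frechet_derivative (W m) (at x)) (at x)"
        using diffble[OF _ True] U W m by (auto simp: Hs_vec_def frechet_derivative_works)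
      have "((\<lambda>x. (U m x + W m x) / 2) has_derivative (\<lambda>h. (frechet_derivative (U m) (at x) h + frechet_derivative (W m) (at x) h) / 2)) (at x)"
        by (rule bounded_linear.has_derivative[OF bounded_linear_divide has_derivative_add[OF d]])
      then have "frechet_derivative (\<lambda>x. (U m x + W m x) / 2) (at x) = (\<lambda>h. (frechet_derivative (U m) (at x) h + frechet_derivative (W m) (at x) h) / 2)"
        by (rule frechet_derivative_at[symmetric])
      then have g: "H x \<bullet> grad (\<lambda>x. (U m x + W m x) / 2) x = (H x \<bullet> grad (U m) x + H x \<bullet> grad (W m) x) / 2"
        by (simp add: gradH sum.distrib[symmetric] sum_divide_distrib distrib_right)
      have "(\<Sum>n\<le>N. K m n x * ((U n x + W n x) / 2)) = ((\<Sum>n\<le>N. K m n x * U n x) + (\<Sum>n\<le>N. K m n x * W n x)) / 2"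
        by (simp add: sum.distrib[symmetric] sum_divide_distrib distrib_left)
      then show ?thesis using True unfolding g by (simp add: field_simps)
    qed simp
  next
    have "integrable lborel (\<lambda>x. indicator \<Omega> x *\<^sub>R D\<^sup>2)"
      using \<Omega> by (intro integrable_real_indicator[THEN integrable_scaleR_left] emeasure_bounded_finite) auto
    moreover have "(indicator \<Omega> x * D)\<^sup>2 = indicator \<Omega> x *\<^sub>R D\<^sup>2" for x by (simp add: indicator_def)
    ultimately show "integrable lborel (\<lambda>x. (indicator \<Omega> x * D)\<^sup>2)" by simp
  next
    fix U W :: "nat \<Rightarrow> 'a \<Rightarrow> real" and m assume U: "U \<in> ?V" and W: "W \<in> ?V" and m: "m \<le> N"
    let ?Z = "\<lambda>m x. U m x - W m x"
    let ?n = "Hs_vec_norm N s \<Omega> ?Z"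
    have Z: "?Z \<in> ?V" by (rule Hs_vec_diff[OF s0 U W])
    have "AE x in lborel. \<forall>n\<in>{..N}. x \<in> \<Omega> \<longrightarrow> \<bar>K m n x\<bar> \<le> CK"
      by (rule AE_finite_allI) (use CK(2)[OF m] in auto)
    then show "AE x in lborel. \<bar>?p U m x - ?p W m x\<bar> \<le> ?n * (indicator \<Omega> x * D)"
    proof (rule eventually_mono)
      fix x assume x: "\<forall>n\<in>{..N}. x \<in> \<Omega> \<longrightarrow> \<bar>K m n x\<bar> \<le> CK"
      show "\<bar>?p U m x - ?p W m x\<bar> \<le> ?n * (indicator \<Omega> x * D)"
      proof (cases "x \<in> \<Omega>")
        case True
        have d: "(U m has_derivative frechet_derivative (U m) (at x)) (at x)" "(W m has_derivative frechet_derivative (W m) (at x)) (at x)"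
          using diffble[OF _ True] U W m by (auto simp: Hs_vec_def frechet_derivative_works)
        have fz: "frechet_derivative (?Z m) (at x) = (\<lambda>h. frechet_derivative (U m) (at x) h - frechet_derivative (W m) (at x) h)"
          by (rule frechet_derivative_at[symmetric]) (rule has_derivative_diff[OF d])
        have g: "H x \<bullet> grad (U m) x - H x \<bullet> grad (W m) x = H x \<bullet> grad (?Z m) x"
          unfolding gradH fz by (simp add: sum_subtractf left_diff_distrib)
        have "\<bar>frechet_derivative (?Z m) (at x) b * (H x \<bullet> b)\<bar> \<le> ?n * (L1 * CH)" if b: "b \<in> Basis" for b
        proof -
          have "\<bar>frechet_derivative (?Z m) (at x) b\<bar> \<le> L1 * Hs_norm s \<Omega> (?Z m)"
            unfolding L1_def by (rule Hs_C1_bound[OF _ s \<Omega>(1) True]) (use Z m b in \<open>auto simp: Hs_vec_def\<close>)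
          also have "\<dots> \<le> L1 * ?n" using L Hs_norm_component_le[OF m, of s \<Omega> ?Z] by (intro mult_left_mono) auto
          finally have 1: "\<bar>frechet_derivative (?Z m) (at x) b\<bar> \<le> L1 * ?n" .
          have "\<bar>H x \<bullet> b\<bar> \<le> CH" using Basis_le_norm[OF b, of "H x"] CH(1)[OF True] by linarith
          with 1 have "\<bar>frechet_derivative (?Z m) (at x) b\<bar> * \<bar>H x \<bullet> b\<bar> \<le> (L1 * ?n) * CH"
            using L Hs_vec_norm_nonneg by (intro mult_mono) auto
          then show ?thesis by (simp add: abs_mult mult_ac)
        qed
        then have "\<bar>H x \<bullet> grad (?Z m) x\<bar> \<le> real DIM('a) * (?n * (L1 * CH))"
          unfolding gradH by (intro order_trans[OF sum_abs] sum_bounded_above)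
        moreover have "\<bar>K m n x * ?Z n x\<bar> \<le> ?n * (CK * L0)" if n: "n \<in> {..N}" for n
        proof -
          have "\<bar>?Z n x\<bar> \<le> L0 * ?n"
            unfolding L0_def by (rule Hs_vec_sup_bound[OF s0 Z]) (use n in simp)
          then have "\<bar>K m n x\<bar> * \<bar>?Z n x\<bar> \<le> CK * (L0 * ?n)"
            using x n True CK(1) by (intro mult_mono) auto
          then show ?thesis by (simp add: abs_mult mult_ac)
        qed
        then have "\<bar>\<Sum>n\<le>N. K m n x * ?Z n x\<bar> \<le> real (Suc N) * (?n * (CK * L0))"
          using sum_bounded_above[of "{..N}" "\<lambda>n. \<bar>K m n x * ?Z n x\<bar>"] by (intro order_trans[OF sum_abs]) simp
        ultimately have "\<bar>H x \<bullet> grad (?Z m) x + (\<Sum>n\<le>N. K m n x * ?Z n x)\<bar>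
            \<le> real DIM('a) * (?n * (L1 * CH)) + real (Suc N) * (?n * (CK * L0))"
          by (intro order_trans[OF abs_triangle_ineq] add_mono)
        then have "\<bar>w x\<bar> * \<bar>H x \<bullet> grad (?Z m) x + (\<Sum>n\<le>N. K m n x * ?Z n x)\<bar>
            \<le> Cw * (real DIM('a) * (?n * (L1 * CH)) + real (Suc N) * (?n * (CK * L0)))"
          using Cw True by (intro mult_mono) auto
        also have "\<dots> = ?n * D" unfolding D_def by (simp add: algebra_simps)
        also have "\<bar>w x\<bar> * \<bar>H x \<bullet> grad (?Z m) x + (\<Sum>n\<le>N. K m n x * ?Z n x)\<bar> = \<bar>?p U m x - ?p W m x\<bar>"
        proof -
          have e: "(\<Sum>n\<le>N. K m n x * ?Z n x) = (\<Sum>n\<le>N. K m n x * U n x) - (\<Sum>n\<le>N. K m n x * W n x)"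
            by (simp add: sum_subtractf right_diff_distrib)
          show ?thesis using True unfolding e g[symmetric] abs_mult[symmetric] by (simp add: algebra_simps)
        qed
        finally show ?thesis using True by simp
      qed simp
    qed
  qed
qed

lemma affine_residual_boundary:
  fixes \<Omega> :: "'a::euclidean_space set"
  assumes s: "s > real DIM('a) / 2" and \<Omega>: "bounded \<Omega>" and w: "continuous_on (closure \<Omega>) w"
    and M: "finite_measure M" "sets M = sets borel" and \<Gamma>: "\<Gamma> \<in> sets borel" "\<Gamma> \<subseteq> closure \<Omega>"
    and G: "\<And>m. (\<lambda>x. indicator \<Gamma> x * G m x) \<in> borel_measurable M" "\<And>m. integrable M (\<lambda>x. (indicator \<Gamma> x * G m x)\<^sup>2)"
  shows "affine_residual N s \<Omega> M (\<lambda>U m x. indicator \<Gamma> x * (w x * (U m x - G m x)))"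
proof -
  interpret finite_measure M by (rule M(1))
  let ?V = "Hs_vec N s \<Omega>"
  let ?p = "\<lambda>U m x. indicator \<Gamma> x * (w x * (U m x - G m x))"
  have comp: "compact (closure \<Omega>)" using \<Omega> by (simp add: compact_closure)
  obtain Cw where Cw: "\<And>x. x \<in> \<Gamma> \<Longrightarrow> \<bar>w x\<bar> \<le> Cw" "Cw \<ge> 0"
  proof -
    have "bounded (w ` closure \<Omega>)" by (rule compact_imp_bounded[OF compact_continuous_image[OF w comp]])
    then obtain a where "a > 0" "\<forall>y\<in>w ` closure \<Omega>. norm y \<le> a" unfolding bounded_pos by blast
    then show ?thesis using \<Gamma>(2) by (intro that[of a]) auto
  qed
  have mb: "borel_measurable M = borel_measurable borel" by (rule measurable_cong_sets[OF M(2)]) simp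
  have wm: "(\<lambda>x. indicator \<Gamma> x * w x) \<in> borel_measurable M"
    using borel_measurable_continuous_on_indicator[OF \<Gamma>(1) continuous_on_subset[OF w \<Gamma>(2)]] unfolding mb by simp
  define L0 where "L0 = embedding_const TYPE('a) s 0"
  have L: "L0 \<ge> 0"
    by (simp add: L0_def embedding_const_nonneg)
  show ?thesis unfolding affine_residual_def
  proof (intro conjI ballI allI impI exI[of _ "\<lambda>x. Cw * L0"])
    fix U :: "nat \<Rightarrow> 'a \<Rightarrow> real" and m assume U: "U \<in> ?V" and m: "m \<le> N"
    have [measurable]: "U m \<in> borel_measurable M"
      using U m unfolding mb by (auto simp: Hs_vec_def intro: Hs_measurable)
    note [measurable] = wm G(1)[of m]
    have [measurable]: "\<Gamma> \<in> sets M" using \<Gamma>(1) M(2) by simp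
    have "(\<lambda>x. (indicator \<Gamma> x * w x) * (U m x - indicator \<Gamma> x * G m x)) \<in> borel_measurable M" by measurable
    moreover have "?p U m = (\<lambda>x. (indicator \<Gamma> x * w x) * (U m x - indicator \<Gamma> x * G m x))"
      by (auto simp: fun_eq_iff indicator_def)
    ultimately show "?p U m \<in> borel_measurable M" by simp
  next
    fix m assume m: "m \<le> N"
    show "integrable M (\<lambda>x. (?p (\<lambda>_ _. 0) m x)\<^sup>2)"
    proof (rule Bochner_Integration.integrable_bound)
      show "integrable M (\<lambda>x. Cw\<^sup>2 * (indicator \<Gamma> x * G m x)\<^sup>2)" using G(2) by simp
      have e: "?p (\<lambda>_ _. 0) m x = - ((indicator \<Gamma> x * w x) * (indicator \<Gamma> x * G m x))" for x
        by (simp add: indicator_def)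
      note [measurable] = wm G(1)[of m]
      show "(\<lambda>x. (?p (\<lambda>_ _. 0) m x)\<^sup>2) \<in> borel_measurable M" unfolding e by measurable
      show "AE x in M. norm ((?p (\<lambda>_ _. 0) m x)\<^sup>2) \<le> norm (Cw\<^sup>2 * (indicator \<Gamma> x * G m x)\<^sup>2)"
      proof (intro AE_I2)
        fix x
        have "(w x)\<^sup>2 \<le> Cw\<^sup>2" if "x \<in> \<Gamma>" using power_mono[OF Cw(1)[OF that], of 2] by simp
        then show "norm ((?p (\<lambda>_ _. 0) m x)\<^sup>2) \<le> norm (Cw\<^sup>2 * (indicator \<Gamma> x * G m x)\<^sup>2)"
          by (auto simp: indicator_def power_mult_distrib mult_right_mono)
      qed
    qed
  next
    fix U W :: "nat \<Rightarrow> 'a \<Rightarrow> real" and m x assume U: "U \<in> ?V" and W: "W \<in> ?V" and m: "m \<le> N"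
    show "?p (\<lambda>m x. (U m x + W m x) / 2) m x = (?p U m x + ?p W m x) / 2"
      by (simp add: field_simps)
  next
    fix U W :: "nat \<Rightarrow> 'a \<Rightarrow> real" and m assume U: "U \<in> ?V" and W: "W \<in> ?V" and m: "m \<le> N"
    let ?Z = "\<lambda>m x. U m x - W m x"
    let ?n = "Hs_vec_norm N s \<Omega> ?Z"
    have Z: "?Z \<in> ?V" by (rule Hs_vec_diff[OF s U W])
    show "AE x in M. \<bar>?p U m x - ?p W m x\<bar> \<le> ?n * (Cw * L0)"
    proof (intro AE_I2)
      fix x
      have b: "\<bar>?Z m x\<bar> \<le> L0 * ?n"
        unfolding L0_def by (rule Hs_vec_sup_bound[OF s Z m])
      show "\<bar>?p U m x - ?p W m x\<bar> \<le> ?n * (Cw * L0)"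
      proof (cases "x \<in> \<Gamma>")
        case True
        have "\<bar>w x\<bar> * \<bar>?Z m x\<bar> \<le> Cw * (L0 * ?n)" using b Cw(1)[OF True] Cw(2) by (intro mult_mono) auto
        moreover have "\<bar>?p U m x - ?p W m x\<bar> = \<bar>w x\<bar> * \<bar>?Z m x\<bar>"
          using True unfolding abs_mult[symmetric] by (simp add: algebra_simps)
        ultimately show ?thesis by (simp add: mult_ac)
      next
        case False
          have "0 \<le> ?n * (Cw * L0)" using L Cw(2) by (intro mult_nonneg_nonneg Hs_vec_norm_nonneg)
          then show ?thesis using False by simp
      qed
    qed
  qed auto
qed

section \<open>Coefficients of the frozen nonlinearity and boundary data\<close>

lemma Psi_has_derivative:
  "(Psi T n has_real_derivative sqrt ((2 * real n + 1) / T) *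
     (exp t * poly (legendre n) (2 * t / T - 1) + exp t * (poly (pderiv (legendre n)) (2 * t / T - 1) * (2 / T)))) (at t)"
proof -
  have p: "((\<lambda>t. poly (legendre n) (2 * t / T - 1)) has_real_derivative poly (pderiv (legendre n)) (2 * t / T - 1) * (2 / T)) (at t)"
  proof (rule DERIV_chain2[OF poly_DERIV])
    have "((\<lambda>t. (2 / T) * t - 1) has_real_derivative 2 / T) (at t)"
      by (rule DERIV_cong[OF DERIV_diff[OF DERIV_cmult_Id DERIV_const]]) simp
    then show "((\<lambda>t. 2 * t / T - 1) has_real_derivative 2 / T) (at t)" by simp
  qed
  show ?thesis
    unfolding Psi_def[abs_def]
    by (rule DERIV_cong[OF DERIV_mult[OF DERIV_cmult[OF DERIV_exp] p]]) (simp add: distrib_left mult_ac)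
qed

lemma continuous_Psi: "continuous_on UNIV (Psi T n)" "continuous_on UNIV (deriv (Psi T n))"
proof -
  show "continuous_on UNIV (Psi T n)" unfolding Psi_def[abs_def] divide_inverse by (intro continuous_intros)
  have "deriv (Psi T n) = (\<lambda>t. sqrt ((2 * real n + 1) / T) *
     (exp t * poly (legendre n) (2 * t / T - 1) + exp t * (poly (pderiv (legendre n)) (2 * t / T - 1) * (2 / T))))"
    using DERIV_imp_deriv[OF Psi_has_derivative] by blast
  then show "continuous_on UNIV (deriv (Psi T n))" by (simp add: divide_inverse) (intro continuous_intros)
qed

lemma Psi_measurable [measurable]:
  "Psi T n \<in> borel_measurable borel" "deriv (Psi T n) \<in> borel_measurable borel"
  by (simp_all add: borel_measurable_continuous_onI continuous_Psi)

lemma Psi_bound: "\<exists>P\<ge>0. \<forall>n\<le>N. \<forall>t\<in>{0..T}. \<bar>Psi T n t\<bar> \<le> P \<and> \<bar>deriv (Psi T n) t\<bar> \<le> P"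
proof -
  define b where "b t = (\<Sum>n\<le>N. \<bar>Psi T n t\<bar> + \<bar>deriv (Psi T n) t\<bar>)" for t
  have "continuous_on {0..T} b"
    unfolding b_def by (intro continuous_intros continuous_on_subset[OF continuous_Psi(1)] continuous_on_subset[OF continuous_Psi(2)]) auto
  then have "bounded (b ` {0..T})" by (intro compact_imp_bounded compact_continuous_image) auto
  then obtain P where P: "P > 0" "\<forall>y\<in>b ` {0..T}. norm y \<le> P" unfolding bounded_pos by blast
  have "\<bar>Psi T n t\<bar> \<le> P \<and> \<bar>deriv (Psi T n) t\<bar> \<le> P" if n: "n \<le> N" and t: "t \<in> {0..T}" for n t
  proof -
    have "\<bar>Psi T n t\<bar> + \<bar>deriv (Psi T n) t\<bar> \<le> b t"
      unfolding b_def using n by (intro member_le_sum) auto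
    moreover have "b t \<le> P" using P(2) t by force
    ultimately show ?thesis by linarith
  qed
  then show ?thesis using P(1) by (intro exI[of _ P]) auto
qed

lemma set_lint_abs_le:
  fixes q :: "real \<Rightarrow> real"
  assumes "AE t in lborel. t \<in> A \<longrightarrow> \<bar>q t\<bar> \<le> B" "B \<ge> 0" "A \<subseteq> {0..T}" "T \<ge> 0"
  shows "\<bar>LINT t:A|lborel. q t\<bar> \<le> B * T"
proof -
  have "\<bar>LINT t:A|lborel. q t\<bar> \<le> (LINT t|lborel. \<bar>indicator A t *\<^sub>R q t\<bar>)"
    unfolding set_lebesgue_integral_def using integral_norm_bound[of lborel "\<lambda>t. indicator A t *\<^sub>R q t"] by simp
  also have "\<dots> \<le> (LINT t|lborel. indicator {0..T} t *\<^sub>R B)"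
  proof (rule integral_mono_AE')
    show "integrable lborel (\<lambda>t. indicator {0..T} t *\<^sub>R B)"
      by (intro integrable_real_indicator[THEN integrable_scaleR_left] emeasure_bounded_finite) auto
    show "AE t in lborel. \<bar>indicator A t *\<^sub>R q t\<bar> \<le> indicator {0..T} t *\<^sub>R B"
      using assms(1) by (rule eventually_mono) (use assms(2,3) in \<open>auto simp: indicator_def\<close>)
  qed (use assms(2) in auto)
  also have "\<dots> = B * T" using assms(4) by simp
  finally show ?thesis .
qed

text \<open>
  A function that is continuous on a closed set becomes Borel measurable when extended by 0, and
  can then be composed with the measurable map \<open>(x, t) \<mapsto> (x, \<phi>(x, t))\<close>.
\<close>

lemma composition_measurable:
  fixes \<Omega> :: "'a::euclidean_space set"
  assumes \<Omega>: "open \<Omega>" and c: "continuous_on (closure \<Omega> \<times> (UNIV :: real set)) (\<lambda>(x, \<sigma>). c x \<sigma> :: real)"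
    and \<Phi>: "\<And>j. j \<le> N \<Longrightarrow> \<Phi> j \<in> borel_measurable borel"
  shows "(\<lambda>(x, t). indicator \<Omega> x * c x (synth N T \<Phi> x t)) \<in> borel_measurable (borel \<Otimes>\<^sub>M borel)"
proof -
  have [measurable]: "\<Omega> \<in> sets borel" using \<Omega> by simp
  have [measurable]: "\<Phi> j \<in> borel_measurable borel" if "j \<in> {..N}" for j using \<Phi> that by simp
  define g where "g p = indicator (closure \<Omega> \<times> (UNIV :: real set)) p *\<^sub>R (case p of (x, \<sigma>) \<Rightarrow> c x \<sigma>)" for p
  have "g \<in> borel_measurable borel"
    unfolding g_def by (rule borel_measurable_continuous_on_indicator[OF _ c]) (simp add: borel_closed closed_Times)
  then have [measurable]: "g \<in> borel_measurable (borel \<Otimes>\<^sub>M borel)" by (simp add: borel_prod)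
  have "(\<lambda>p. indicator \<Omega> (fst p) * g (fst p, \<Sum>j\<le>N. \<Phi> j (fst p) * Psi T j (snd p))) \<in> borel_measurable (borel \<Otimes>\<^sub>M borel)"
    by measurable
  moreover have "(\<lambda>(x, t). indicator \<Omega> x * c x (synth N T \<Phi> x t))
    = (\<lambda>p. indicator \<Omega> (fst p) * g (fst p, \<Sum>j\<le>N. \<Phi> j (fst p) * Psi T j (snd p)))"
    using closure_subset[of \<Omega>] by (auto simp: fun_eq_iff g_def synth_def indicator_def)
  ultimately show ?thesis by simp
qed

lemma Ck_closure_continuous:
  fixes \<Omega> :: "'a::euclidean_space set"
  assumes "Ck_closure k (\<Omega> \<times> (UNIV :: real set)) f"
  shows "continuous_on (closure \<Omega> \<times> (UNIV :: real set)) f"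
  using assms by (simp add: Ck_closure_def closure_Times)

context
  fixes \<Omega> :: "'a::euclidean_space set" and c f \<alpha> :: "'a \<Rightarrow> real \<Rightarrow> real" and \<Phi> :: "nat \<Rightarrow> 'a \<Rightarrow> real"
    and T s \<kappa> :: real and N :: nat
  assumes \<Omega>: "open \<Omega>" "bounded \<Omega>" and T: "T > 0"
    and c: "continuous_on (closure \<Omega> \<times> (UNIV :: real set)) (\<lambda>(x, \<sigma>). c x \<sigma>)"
    and f: "continuous_on (closure \<Omega> \<times> (UNIV :: real set)) (\<lambda>(x, \<sigma>). f x \<sigma>)"
    and \<kappa>: "\<kappa> > 0" "\<And>x \<sigma>. x \<in> closure \<Omega> \<Longrightarrow> c x \<sigma> \<ge> \<kappa>"
    and \<alpha>: "Linfty_space_time \<Omega> T \<alpha>"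
    and \<Phi>: "\<Phi> \<in> Hs_vec N s \<Omega>" and s: "s > real DIM('a) / 2"
begin

private lemma \<Phi>m: "j \<le> N \<Longrightarrow> \<Phi> j \<in> borel_measurable borel"
  using \<Phi> by (auto simp: Hs_vec_def intro: Hs_measurable)

private lemma \<Omega>m [measurable]: "\<Omega> \<in> sets borel"
  using \<Omega> by simp

private lemma cm [measurable]: "(\<lambda>(x, t). indicator \<Omega> x * c x (synth N T \<Phi> x t)) \<in> borel_measurable (borel \<Otimes>\<^sub>M borel)"
  by (rule composition_measurable[OF \<Omega>(1) c \<Phi>m])

private lemma fm [measurable]: "(\<lambda>(x, t). indicator \<Omega> x * f x (synth N T \<Phi> x t)) \<in> borel_measurable (borel \<Otimes>\<^sub>M borel)"
  by (rule composition_measurable[OF \<Omega>(1) f \<Phi>m])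

private lemma c_lower: "x \<in> \<Omega> \<Longrightarrow> c x \<sigma> \<ge> \<kappa>"
  using \<kappa>(2) closure_subset by blast

private lemma quotient_bound:
  assumes "x \<in> \<Omega>" "\<bar>y\<bar> \<le> B" shows "\<bar>y / c x \<sigma>\<bar> \<le> B / \<kappa>"
proof -
  have "\<bar>y / c x \<sigma>\<bar> = \<bar>y\<bar> / c x \<sigma>" using c_lower[OF assms(1), of \<sigma>] \<kappa>(1) by simp
  also have "\<dots> \<le> B / \<kappa>" using assms(2) \<kappa>(1) c_lower[OF assms(1), of \<sigma>] by (intro frac_le) auto
  finally show ?thesis .
qed

lemma coeff_S_measurable: "(\<lambda>x. indicator \<Omega> x * coeff_S N T c \<Phi> m n x) \<in> borel_measurable borel"
proof -
  have e: "indicator \<Omega> x * coeff_S N T c \<Phi> m n x = indicator \<Omega> x * (LINT t|lborel. indicator {0..T} t *\<^sub>R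
      (exp (-2 * t) * deriv (Psi T n) t * Psi T m t / (indicator \<Omega> x * c x (synth N T \<Phi> x t))))" for x
    by (simp add: indicator_def coeff_S_def set_lebesgue_integral_def)
  show ?thesis unfolding e by measurable
qed

lemma coeff_F_measurable: "(\<lambda>x. indicator \<Omega> x * coeff_F N T c f \<Phi> m x) \<in> borel_measurable borel"
proof -
  have e: "indicator \<Omega> x * coeff_F N T c f \<Phi> m x = indicator \<Omega> x * (LINT t|lborel. indicator {0..T} t *\<^sub>R
      (exp (-2 * t) * (indicator \<Omega> x * f x (synth N T \<Phi> x t)) / (indicator \<Omega> x * c x (synth N T \<Phi> x t)) * Psi T m t))" for x
    by (simp add: indicator_def coeff_F_def set_lebesgue_integral_def)
  show ?thesis unfolding e by measurable
qed

text \<open>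
  The values of \<alpha> outside the cylinder carry no information. For \<open>t \<in> [0, T]\<close> the memory
  integral only sees arguments in \<open>(0, T)\<close>, so this truncation, which is Borel measurable on the
  whole product space, may replace \<alpha>.
\<close>

private definition truncated_kernel :: "'a \<Rightarrow> real \<Rightarrow> real" where
  "truncated_kernel x t = indicator (\<Omega> \<times> {0<..<T}) (x, t) *\<^sub>R \<alpha> x t"

private lemma truncated_kernel_measurable [measurable]: "(\<lambda>(x, t). truncated_kernel x t) \<in> borel_measurable (borel \<Otimes>\<^sub>M borel)"
proof -
  have "(\<lambda>p. indicator (\<Omega> \<times> {0<..<T}) p *\<^sub>R (case p of (x, t) \<Rightarrow> \<alpha> x t)) \<in> borel_measurable borel"
    using \<alpha> by (simp add: Linfty_space_time_def set_borel_measurable_def)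
  moreover have "(\<lambda>p. indicator (\<Omega> \<times> {0<..<T}) p *\<^sub>R (case p of (x, t) \<Rightarrow> \<alpha> x t)) = (\<lambda>(x, t). truncated_kernel x t)"
    by (auto simp: fun_eq_iff truncated_kernel_def)
  ultimately show ?thesis by (simp add: borel_prod)
qed

private lemma truncated_kernel_bound: "\<exists>K\<ge>0. AE x in lborel. AE t in lborel. \<bar>truncated_kernel x t\<bar> \<le> K"
proof -
  obtain K where K: "AE p in lborel. p \<in> \<Omega> \<times> {0<..<T} \<longrightarrow> \<bar>\<alpha> (fst p) (snd p)\<bar> \<le> K"
    using \<alpha> unfolding Linfty_space_time_def by blast
  have "AE p in lborel \<Otimes>\<^sub>M lborel. \<bar>truncated_kernel (fst p) (snd p)\<bar> \<le> \<bar>K\<bar>"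
    using K unfolding lborel_prod by (rule eventually_mono) (auto simp: truncated_kernel_def indicator_def)
  then have "AE x in lborel. AE t in lborel. \<bar>truncated_kernel (fst (x, t)) (snd (x, t))\<bar> \<le> \<bar>K\<bar>"
    by (rule lborel_pair.AE_pair)
  then show ?thesis by (intro exI[of _ "\<bar>K\<bar>"]) simp
qed

private lemma memory_term_truncated:
  assumes "x \<in> \<Omega>" "t \<in> {0..T}"
  shows "(LINT t':{0<..<t}|lborel. \<alpha> x (t - t') * Psi T n t') = (LINT t':{0<..<t}|lborel. truncated_kernel x (t - t') * Psi T n t')"
  unfolding set_lebesgue_integral_def using assms
  by (intro Bochner_Integration.integral_cong) (auto simp: truncated_kernel_def indicator_def)

lemma coeff_M_measurable: "(\<lambda>x. indicator \<Omega> x * coeff_M N T c \<alpha> \<Phi> m n x) \<in> borel_measurable borel"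
proof -
  have e: "(LINT t':{0<..<t}|lborel. truncated_kernel x (t - t') * Psi T n t')
      = (LINT t'|lborel. (if 0 < t' \<and> t' < t then truncated_kernel x (t - t') * Psi T n t' else 0))" for x t
    unfolding set_lebesgue_integral_def by (intro Bochner_Integration.integral_cong) auto
  have [measurable]: "(\<lambda>(x, t). LINT t':{0<..<t}|lborel. truncated_kernel x (t - t') * Psi T n t') \<in> borel_measurable (borel \<Otimes>\<^sub>M borel)"
    unfolding e by measurable
  have M: "indicator \<Omega> x * coeff_M N T c \<alpha> \<Phi> m n x = indicator \<Omega> x * (LINT t|lborel. indicator {0..T} t *\<^sub>R (exp (-2 * t) * Psi T m t / (indicator \<Omega> x * c x (synth N T \<Phi> x t)) *
        (LINT t':{0<..<t}|lborel. truncated_kernel x (t - t') * Psi T n t')))" for x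
  proof (cases "x \<in> \<Omega>")
    case True
    have "coeff_M N T c \<alpha> \<Phi> m n x = (LINT t|lborel. indicator {0..T} t *\<^sub>R (exp (-2 * t) * Psi T m t / c x (synth N T \<Phi> x t) *
        (LINT t':{0<..<t}|lborel. truncated_kernel x (t - t') * Psi T n t')))"
      unfolding coeff_M_def set_lebesgue_integral_def[of lborel "{0..T}"]
      using memory_term_truncated[OF True] by (intro Bochner_Integration.integral_cong) (auto simp: indicator_def)
    then show ?thesis using True by simp
  qed simp
  show ?thesis unfolding M by measurable
qed

lemma coeff_S_bound:
  assumes "m \<le> N" "n \<le> N"
  shows "\<exists>B\<ge>0. \<forall>x\<in>\<Omega>. \<bar>coeff_S N T c \<Phi> m n x\<bar> \<le> B"
proof -
  obtain P where P: "P \<ge> 0" "\<forall>n\<le>N. \<forall>t\<in>{0..T}. \<bar>Psi T n t\<bar> \<le> P \<and> \<bar>deriv (Psi T n) t\<bar> \<le> P" using Psi_bound by blast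
  have "\<bar>coeff_S N T c \<Phi> m n x\<bar> \<le> (1 * P * P) / \<kappa> * T" if x: "x \<in> \<Omega>" for x
    unfolding coeff_S_def
  proof (rule set_lint_abs_le)
    have "\<bar>exp (-2 * t) * deriv (Psi T n) t * Psi T m t / c x (synth N T \<Phi> x t)\<bar> \<le> (1 * P * P) / \<kappa>" if "t \<in> {0..T}" for t
    proof (rule quotient_bound[OF x])
      show "\<bar>exp (-2 * t) * deriv (Psi T n) t * Psi T m t\<bar> \<le> 1 * P * P"
        unfolding abs_mult using P assms that by (intro mult_mono) auto
    qed
    then show "AE t in lborel. t \<in> {0..T} \<longrightarrow> \<bar>exp (-2 * t) * deriv (Psi T n) t * Psi T m t / c x (synth N T \<Phi> x t)\<bar> \<le> (1 * P * P) / \<kappa>"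
      by auto
  qed (use P \<kappa> T in auto)
  then show ?thesis using P \<kappa> T by (intro exI[of _ "(1 * P * P) / \<kappa> * T"]) auto
qed

lemma coeff_F_bound:
  assumes m: "m \<le> N"
  shows "\<exists>B. AE x in lborel. x \<in> \<Omega> \<longrightarrow> \<bar>coeff_F N T c f \<Phi> m x\<bar> \<le> B"
proof -
  obtain P where P: "P \<ge> 0" "\<forall>n\<le>N. \<forall>t\<in>{0..T}. \<bar>Psi T n t\<bar> \<le> P \<and> \<bar>deriv (Psi T n) t\<bar> \<le> P" using Psi_bound by blast
  define L where "L = embedding_const TYPE('a) s 0"
  define R where "R = (\<Sum>j\<le>N. L * Hs_norm s \<Omega> (\<Phi> j) * P)"
  have synth: "\<bar>synth N T \<Phi> x t\<bar> \<le> R" if "t \<in> {0..T}" for x t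
    unfolding synth_def R_def
  proof (rule order_trans[OF sum_abs sum_mono])
    fix j assume j: "j \<in> {..N}"
    have "\<bar>\<Phi> j x\<bar> \<le> L * Hs_norm s \<Omega> (\<Phi> j)"
      unfolding L_def by (rule Hs_sup_bound[OF _ s]) (use \<Phi> j in \<open>auto simp: Hs_vec_def\<close>)
    then show "\<bar>\<Phi> j x * Psi T j t\<bar> \<le> L * Hs_norm s \<Omega> (\<Phi> j) * P"
      unfolding abs_mult using P j that by (intro mult_mono) auto
  qed
  have "compact (closure \<Omega> \<times> cball (0::real) R)" using \<Omega> by (intro compact_Times) (auto simp: compact_closure)
  then have "bounded ((\<lambda>(x, \<sigma>). f x \<sigma>) ` (closure \<Omega> \<times> cball 0 R))"
    by (intro compact_imp_bounded compact_continuous_image continuous_on_subset[OF f]) auto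
  then obtain C where C: "C > 0" "\<forall>y\<in>(\<lambda>(x, \<sigma>). f x \<sigma>) ` (closure \<Omega> \<times> cball 0 R). norm y \<le> C" unfolding bounded_pos by blast
  have "\<bar>coeff_F N T c f \<Phi> m x\<bar> \<le> (1 * C) / \<kappa> * P * T" if x: "x \<in> \<Omega>" for x
    unfolding coeff_F_def
  proof (rule set_lint_abs_le)
    have "\<bar>exp (-2 * t) * f x (synth N T \<Phi> x t) / c x (synth N T \<Phi> x t) * Psi T m t\<bar> \<le> (1 * C) / \<kappa> * P" if t: "t \<in> {0..T}" for t
    proof -
      have "(x, synth N T \<Phi> x t) \<in> closure \<Omega> \<times> cball 0 R" using synth[OF t] x closure_subset by auto
      then have "\<bar>f x (synth N T \<Phi> x t)\<bar> \<le> C" using C(2) by force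
      then have "\<bar>exp (-2 * t) * f x (synth N T \<Phi> x t)\<bar> \<le> 1 * C"
        unfolding abs_mult using t by (intro mult_mono) auto
      then have "\<bar>exp (-2 * t) * f x (synth N T \<Phi> x t) / c x (synth N T \<Phi> x t)\<bar> \<le> (1 * C) / \<kappa>"
        by (rule quotient_bound[OF x])
      then show ?thesis
        unfolding abs_mult[of "exp (-2 * t) * f x (synth N T \<Phi> x t) / c x (synth N T \<Phi> x t)"] using P m t C \<kappa> by (intro mult_mono) auto
    qed
    then show "AE t in lborel. t \<in> {0..T} \<longrightarrow> \<bar>exp (-2 * t) * f x (synth N T \<Phi> x t) / c x (synth N T \<Phi> x t) * Psi T m t\<bar> \<le> (1 * C) / \<kappa> * P"
      by auto
  qed (use P \<kappa> T C in auto)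
  then show ?thesis by blast
qed

text \<open>
  By Fubini's theorem almost every section of the truncated kernel is essentially bounded by the
  same constant, and reflection and translation of the time variable preserve null sets.
\<close>

lemma coeff_M_bound:
  assumes m: "m \<le> N" and n: "n \<le> N"
  shows "\<exists>B. AE x in lborel. x \<in> \<Omega> \<longrightarrow> \<bar>coeff_M N T c \<alpha> \<Phi> m n x\<bar> \<le> B"
proof -
  obtain P where P: "P \<ge> 0" "\<forall>n\<le>N. \<forall>t\<in>{0..T}. \<bar>Psi T n t\<bar> \<le> P \<and> \<bar>deriv (Psi T n) t\<bar> \<le> P" using Psi_bound by blast
  obtain K where K: "K \<ge> 0" "AE x in lborel. AE t in lborel. \<bar>truncated_kernel x t\<bar> \<le> K" using truncated_kernel_bound by blast
  have "\<bar>coeff_M N T c \<alpha> \<Phi> m n x\<bar> \<le> (1 * P) / \<kappa> * (K * P * T) * T"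
    if x: "x \<in> \<Omega>" and ax: "AE t in lborel. \<bar>truncated_kernel x t\<bar> \<le> K" for x
    unfolding coeff_M_def
  proof (rule set_lint_abs_le)
    have inner: "\<bar>LINT t':{0<..<t}|lborel. \<alpha> x (t - t') * Psi T n t'\<bar> \<le> K * P * T" if t: "t \<in> {0..T}" for t
      unfolding memory_term_truncated[OF x t]
    proof (rule set_lint_abs_le)
      have "Measurable.pred borel (\<lambda>u. \<bar>truncated_kernel x u\<bar> \<le> K)" by measurable
      then have "AE t' in lborel. \<bar>truncated_kernel x (t + (-1) * t')\<bar> \<le> K"
        by (intro AE_borel_affine[OF _ _ ax]) auto
      then show "AE t' in lborel. t' \<in> {0<..<t} \<longrightarrow> \<bar>truncated_kernel x (t - t') * Psi T n t'\<bar> \<le> K * P"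
      proof (rule eventually_mono, intro impI)
        fix t' assume "\<bar>truncated_kernel x (t + (-1) * t')\<bar> \<le> K" "t' \<in> {0<..<t}"
        then show "\<bar>truncated_kernel x (t - t') * Psi T n t'\<bar> \<le> K * P"
          unfolding abs_mult using P n t K by (intro mult_mono) auto
      qed
    qed (use P K t T in auto)
    have "\<bar>exp (-2 * t) * Psi T m t / c x (synth N T \<Phi> x t) * (LINT t':{0<..<t}|lborel. \<alpha> x (t - t') * Psi T n t')\<bar>
        \<le> (1 * P) / \<kappa> * (K * P * T)" if t: "t \<in> {0..T}" for t
    proof -
      have "\<bar>exp (-2 * t) * Psi T m t / c x (synth N T \<Phi> x t)\<bar> \<le> (1 * P) / \<kappa>"
      proof (rule quotient_bound[OF x])
        show "\<bar>exp (-2 * t) * Psi T m t\<bar> \<le> 1 * P"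
          unfolding abs_mult using P m t by (intro mult_mono) auto
      qed
      then show ?thesis unfolding abs_mult[of "exp (-2 * t) * Psi T m t / c x (synth N T \<Phi> x t)"]
        using inner[OF t] P \<kappa> by (intro mult_mono) auto
    qed
    then show "AE t in lborel. t \<in> {0..T} \<longrightarrow> \<bar>exp (-2 * t) * Psi T m t / c x (synth N T \<Phi> x t) * (LINT t':{0<..<t}|lborel. \<alpha> x (t - t') * Psi T n t')\<bar>
        \<le> (1 * P) / \<kappa> * (K * P * T)"
      by auto
  qed (use P \<kappa> T K in auto)
  then show ?thesis using K(2) by (intro exI[of _ "(1 * P) / \<kappa> * (K * P * T) * T"]) (auto elim!: eventually_mono)
qed

lemma coeff_SM:
  assumes m: "m \<le> N" and n: "n \<le> N"
  shows "(\<lambda>x. indicator \<Omega> x * (coeff_S N T c \<Phi> m n x + coeff_M N T c \<alpha> \<Phi> m n x)) \<in> borel_measurable borel"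
    and "\<exists>B. AE x in lborel. x \<in> \<Omega> \<longrightarrow> \<bar>coeff_S N T c \<Phi> m n x + coeff_M N T c \<alpha> \<Phi> m n x\<bar> \<le> B"
proof -
  show "(\<lambda>x. indicator \<Omega> x * (coeff_S N T c \<Phi> m n x + coeff_M N T c \<alpha> \<Phi> m n x)) \<in> borel_measurable borel"
    unfolding distrib_left by (intro borel_measurable_add coeff_S_measurable coeff_M_measurable)
  obtain B1 where B1: "\<forall>x\<in>\<Omega>. \<bar>coeff_S N T c \<Phi> m n x\<bar> \<le> B1" using coeff_S_bound[OF m n] by blast
  obtain B2 where "AE x in lborel. x \<in> \<Omega> \<longrightarrow> \<bar>coeff_M N T c \<alpha> \<Phi> m n x\<bar> \<le> B2" using coeff_M_bound[OF m n] by blast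
  then have "AE x in lborel. x \<in> \<Omega> \<longrightarrow> \<bar>coeff_S N T c \<Phi> m n x + coeff_M N T c \<alpha> \<Phi> m n x\<bar> \<le> B1 + B2"
    by (rule eventually_mono) (use B1 in \<open>fastforce intro: order_trans[OF abs_triangle_ineq]\<close>)
  then show "\<exists>B. AE x in lborel. x \<in> \<Omega> \<longrightarrow> \<bar>coeff_S N T c \<Phi> m n x + coeff_M N T c \<alpha> \<Phi> m n x\<bar> \<le> B" ..
qed

end

text \<open>
  Cauchy-Schwarz in time for each boundary point, then Tonelli's theorem. The extended nonnegative
  integral is used because sections of the data may fail to be square integrable on a null set.
\<close>

lemma data_coeff_L2:
  fixes \<Omega> \<Gamma> :: "'a::euclidean_space set"
  assumes g: "L2_boundary_data \<Omega> T \<Gamma> g" and \<Gamma>: "\<Gamma> \<in> sets borel"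
  shows "(\<lambda>x. indicator \<Gamma> x * data_coeff T g m x) \<in> borel_measurable (surface_measure \<Omega>)"
    and "integrable (surface_measure \<Omega>) (\<lambda>x. (indicator \<Gamma> x * data_coeff T g m x)\<^sup>2)"
proof -
  let ?\<sigma> = "surface_measure \<Omega>"
  define g1 where "g1 x t = indicator (\<Gamma> \<times> {0<..<T}) (x, t) *\<^sub>R g x t" for x t
  define k where "k t = indicator {0<..<T} t * (exp (-2 * t) * Psi T m t)" for t
  have [measurable]: "k \<in> borel_measurable borel" unfolding k_def by measurable
  have "(\<lambda>p. indicator (\<Gamma> \<times> {0<..<T}) p *\<^sub>R (case p of (x, t) \<Rightarrow> g x t)) = (\<lambda>(x, t). g1 x t)"
    by (auto simp: fun_eq_iff g1_def)
  then have g1m [measurable]: "(\<lambda>(x, t). g1 x t) \<in> borel_measurable (?\<sigma> \<Otimes>\<^sub>M lborel)"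
    using g by (simp add: L2_boundary_data_def set_borel_measurable_def)
  have "(\<lambda>p. indicator (\<Gamma> \<times> {0<..<T}) p *\<^sub>R (case p of (x, t) \<Rightarrow> (g x t)\<^sup>2)) = (\<lambda>(x, t). (g1 x t)\<^sup>2)"
    by (auto simp: fun_eq_iff g1_def indicator_def)
  then have g1i: "integrable (?\<sigma> \<Otimes>\<^sub>M lborel) (\<lambda>(x, t). (g1 x t)\<^sup>2)"
    using g by (simp add: L2_boundary_data_def set_integrable_def)
  have e: "indicator \<Gamma> x * data_coeff T g m x = (LINT t|lborel. g1 x t * k t)" for x
    by (cases "x \<in> \<Gamma>")
       (auto simp: data_coeff_def set_lebesgue_integral_def g1_def k_def indicator_def intro!: Bochner_Integration.integral_cong)
  show m: "(\<lambda>x. indicator \<Gamma> x * data_coeff T g m x) \<in> borel_measurable ?\<sigma>" unfolding e by measurable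
  obtain P where P: "P \<ge> 0" "\<forall>n\<le>m. \<forall>t\<in>{0..T}. \<bar>Psi T n t\<bar> \<le> P \<and> \<bar>deriv (Psi T n) t\<bar> \<le> P" using Psi_bound by blast
  have kb: "\<bar>k t\<bar> \<le> P * indicator {0<..<T} t" for t
    using P mult_mono[of "exp (-2 * t)" 1 "\<bar>Psi T m t\<bar>" P] by (auto simp: k_def indicator_def abs_mult)
  have "(\<integral>\<^sup>+t. (ennreal \<bar>k t\<bar>)\<^sup>2 \<partial>lborel) \<le> (\<integral>\<^sup>+t. ennreal (P\<^sup>2) * indicator {0<..<T} t \<partial>lborel)"
  proof (rule nn_integral_mono)
    fix t
    have "\<bar>k t\<bar>\<^sup>2 \<le> (P * indicator {0<..<T} t)\<^sup>2" by (intro power_mono kb) simp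
    then show "(ennreal \<bar>k t\<bar>)\<^sup>2 \<le> ennreal (P\<^sup>2) * indicator {0<..<T} t"
      using ennreal_leI by (fastforce simp: ennreal_power indicator_def)
  qed
  also have "\<dots> < \<infinity>" using emeasure_bounded_finite[of "{0<..<T}"] by (simp add: nn_integral_cmult_indicator ennreal_mult_less_top)
  finally have kfin: "(\<integral>\<^sup>+t. (ennreal \<bar>k t\<bar>)\<^sup>2 \<partial>lborel) < \<infinity>" .
  have gfin: "(\<integral>\<^sup>+p. ennreal (case p of (x, t) \<Rightarrow> (g1 x t)\<^sup>2) \<partial>(?\<sigma> \<Otimes>\<^sub>M lborel)) < \<infinity>"
    using g1i unfolding integrable_iff_bounded by (simp add: case_prod_beta')
  have CS: "ennreal ((LINT t|lborel. g1 x t * k t)\<^sup>2) \<le> (\<integral>\<^sup>+t. ennreal ((g1 x t)\<^sup>2) \<partial>lborel) * (\<integral>\<^sup>+t. (ennreal \<bar>k t\<bar>)\<^sup>2 \<partial>lborel)" for x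
  proof (cases "integrable lborel (\<lambda>t. g1 x t * k t)")
    case True
    have [measurable]: "g1 x \<in> borel_measurable borel"
      using measurable_Pair2[OF g1m, of x] by simp
    have "ennreal \<bar>LINT t|lborel. g1 x t * k t\<bar> \<le> (\<integral>\<^sup>+t. ennreal \<bar>g1 x t\<bar> * ennreal \<bar>k t\<bar> \<partial>lborel)"
      using integral_norm_bound_ennreal[OF True] by (simp add: abs_mult ennreal_mult)
    then have "(ennreal \<bar>LINT t|lborel. g1 x t * k t\<bar>)\<^sup>2 \<le> (\<integral>\<^sup>+t. ennreal \<bar>g1 x t\<bar> * ennreal \<bar>k t\<bar> \<partial>lborel)\<^sup>2"
      by (rule power_mono) simp
    also have "\<dots> \<le> (\<integral>\<^sup>+t. (ennreal \<bar>g1 x t\<bar>)\<^sup>2 \<partial>lborel) * (\<integral>\<^sup>+t. (ennreal \<bar>k t\<bar>)\<^sup>2 \<partial>lborel)"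
      by (rule Cauchy_Schwarz_nn_integral) measurable
    finally show ?thesis by (simp add: ennreal_power)
  next
    case False then show ?thesis by (simp add: not_integrable_integral_eq)
  qed
  have "(\<integral>\<^sup>+x. ennreal ((indicator \<Gamma> x * data_coeff T g m x)\<^sup>2) \<partial>?\<sigma>)
      \<le> (\<integral>\<^sup>+x. (\<integral>\<^sup>+t. ennreal ((g1 x t)\<^sup>2) \<partial>lborel) * (\<integral>\<^sup>+t. (ennreal \<bar>k t\<bar>)\<^sup>2 \<partial>lborel) \<partial>?\<sigma>)"
    unfolding e by (intro nn_integral_mono CS)
  also have "\<dots> = (\<integral>\<^sup>+x. (\<integral>\<^sup>+t. ennreal ((g1 x t)\<^sup>2) \<partial>lborel) \<partial>?\<sigma>) * (\<integral>\<^sup>+t. (ennreal \<bar>k t\<bar>)\<^sup>2 \<partial>lborel)"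
    by (rule nn_integral_multc) measurable
  also have "(\<integral>\<^sup>+x. (\<integral>\<^sup>+t. ennreal ((g1 x t)\<^sup>2) \<partial>lborel) \<partial>?\<sigma>) = (\<integral>\<^sup>+p. ennreal (case p of (x, t) \<Rightarrow> (g1 x t)\<^sup>2) \<partial>(?\<sigma> \<Otimes>\<^sub>M lborel))"
    by (subst lborel.nn_integral_fst[symmetric]) auto
  also have "\<dots> * (\<integral>\<^sup>+t. (ennreal \<bar>k t\<bar>)\<^sup>2 \<partial>lborel) < \<infinity>"
    using kfin gfin by (simp add: ennreal_mult_less_top)
  finally show "integrable ?\<sigma> (\<lambda>x. (indicator \<Gamma> x * data_coeff T g m x)\<^sup>2)"
    using m by (intro integrableI_bounded) auto
qed

section \<open>The solution map and its fixed point\<close>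

lemma weighted_square_integral_le:
  fixes \<Omega> :: "'a::euclidean_space set"
  assumes s: "s > real DIM('a) / 2" and \<Omega>: "bounded \<Omega>" and \<phi>: "continuous_on (closure \<Omega>) \<phi>"
    and A: "A \<in> sets M" "emeasure M A < \<infinity>" "A \<subseteq> closure \<Omega>"
  shows "\<exists>b\<ge>0. \<forall>Z\<in>Hs_vec N s \<Omega>.
    (LINT x:A|M. exp (2 * lam * \<phi> x) * (\<Sum>m\<le>N. (Z m x)\<^sup>2)) \<le> b * (Hs_vec_norm N s \<Omega> Z)\<^sup>2"
proof -
  have "compact (closure \<Omega>)" using \<Omega> by (simp add: compact_closure)
  then have "bounded ((\<lambda>x. exp (2 * lam * \<phi> x)) ` closure \<Omega>)"
    by (intro compact_imp_bounded compact_continuous_image continuous_intros \<phi>)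
  then obtain C where C: "C > 0" "\<forall>y\<in>(\<lambda>x. exp (2 * lam * \<phi> x)) ` closure \<Omega>. norm y \<le> C"
    unfolding bounded_pos by blast
  define L where "L = embedding_const TYPE('a) s 0"
  define b where "b = measure M A * (C * (real (Suc N) * L\<^sup>2))"
  have "(LINT x:A|M. exp (2 * lam * \<phi> x) * (\<Sum>m\<le>N. (Z m x)\<^sup>2)) \<le> b * (Hs_vec_norm N s \<Omega> Z)\<^sup>2"
    if Z: "Z \<in> Hs_vec N s \<Omega>" for Z
  proof -
    let ?v = "Hs_vec_norm N s \<Omega> Z"
    have zb: "(Z m x)\<^sup>2 \<le> L\<^sup>2 * ?v\<^sup>2" if m: "m \<in> {..N}" for m x
    proof -
      have "\<bar>Z m x\<bar> \<le> L * ?v" unfolding L_def using Hs_vec_sup_bound[OF s Z] m by simp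
      then have "\<bar>Z m x\<bar>\<^sup>2 \<le> (L * ?v)\<^sup>2" by (rule power_mono) simp
      then show ?thesis by (simp add: power_mult_distrib)
    qed
    have "(LINT x:A|M. exp (2 * lam * \<phi> x) * (\<Sum>m\<le>N. (Z m x)\<^sup>2)) \<le> (LINT x|M. indicator A x *\<^sub>R (C * (real (Suc N) * (L\<^sup>2 * ?v\<^sup>2))))"
      unfolding set_lebesgue_integral_def
    proof (rule integral_mono')
      show "integrable M (\<lambda>x. indicator A x *\<^sub>R (C * (real (Suc N) * (L\<^sup>2 * ?v\<^sup>2))))"
        using A by (intro integrable_real_indicator[THEN integrable_scaleR_left]) auto
      fix x
      show "indicator A x *\<^sub>R (exp (2 * lam * \<phi> x) * (\<Sum>m\<le>N. (Z m x)\<^sup>2)) \<le> indicator A x *\<^sub>R (C * (real (Suc N) * (L\<^sup>2 * ?v\<^sup>2)))"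
      proof (cases "x \<in> A")
        case True
        have "(\<Sum>m\<le>N. (Z m x)\<^sup>2) \<le> real (Suc N) * (L\<^sup>2 * ?v\<^sup>2)"
          using sum_bounded_above[of "{..N}" "\<lambda>m. (Z m x)\<^sup>2", OF zb] by simp
        moreover have "exp (2 * lam * \<phi> x) \<le> C" using C(2) True A(3) by force
        ultimately show ?thesis using True C(1) by (simp add: mult_mono sum_nonneg)
      qed simp
      show "0 \<le> indicator A x *\<^sub>R (C * (real (Suc N) * (L\<^sup>2 * ?v\<^sup>2)))" using C(1) by simp
    qed
    also have "\<dots> = b * ?v\<^sup>2" using A(1) sets.sets_into_space[OF A(1)] by (simp add: b_def Int_absorb2)
    finally show ?thesis .
  qed
  moreover have "b \<ge> 0" using C(1) by (simp add: b_def)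
  ultimately show ?thesis by blast
qed

lemma weighted_integral_nonneg:
  fixes Z :: "nat \<Rightarrow> 'a \<Rightarrow> real"
  shows "(LINT x:A|M. exp (k x) * (\<Sum>m\<le>(N::nat). (Z m x)\<^sup>2)) \<ge> 0"
  unfolding set_lebesgue_integral_def
  by (intro Bochner_Integration.integral_nonneg) (simp add: sum_nonneg)

lemma weighted_norm_lower:
  assumes "eps > 0" "lam > 0"
  shows "sqrt (eps / lam) * Hs_vec_norm N s \<Omega> Z \<le> weighted_norm \<Omega> N s H \<phi> lam eps Z"
proof -
  have "sqrt (eps / lam) * Hs_vec_norm N s \<Omega> Z = sqrt (eps / lam * (Hs_vec_norm N s \<Omega> Z)\<^sup>2)"
    using Hs_vec_norm_nonneg[of N s \<Omega> Z] by (simp only: real_sqrt_mult real_sqrt_abs abs_of_nonneg)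
  also have "\<dots> \<le> weighted_norm \<Omega> N s H \<phi> lam eps Z"
    unfolding weighted_norm_def
    by (rule real_sqrt_le_mono) (simp add: weighted_integral_nonneg)
  finally show ?thesis .
qed

lemma weighted_norm_upper:
  fixes \<Omega> :: "'a::euclidean_space set"
  assumes s: "s > real DIM('a) / 2" and \<Omega>: "smooth_bounded_domain \<Omega>" and \<phi>: "continuous_on (closure \<Omega>) \<phi>"
    and H: "continuous_on (closure \<Omega>) H" and pos: "eps > 0" "lam > 0"
  shows "\<exists>b. \<forall>Z\<in>Hs_vec N s \<Omega>. weighted_norm \<Omega> N s H \<phi> lam eps Z \<le> b * Hs_vec_norm N s \<Omega> Z"
proof -
  have o: "open \<Omega>" "bounded \<Omega>" using \<Omega> by (auto simp: smooth_bounded_domain_def)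
  obtain b1 where b1: "b1 \<ge> 0" "\<forall>Z\<in>Hs_vec N s \<Omega>. (LINT x:\<Omega>|lborel. exp (2 * lam * \<phi> x) * (\<Sum>m\<le>N. (Z m x)\<^sup>2)) \<le> b1 * (Hs_vec_norm N s \<Omega> Z)\<^sup>2"
    using weighted_square_integral_le[OF s o(2) \<phi>, of \<Omega> lborel N lam] o emeasure_bounded_finite[of \<Omega>] closure_subset by auto
  interpret finite_measure "surface_measure \<Omega>" by (rule finite_surface_measure[OF \<Omega>])
  have "Gamma_plus \<Omega> H \<in> sets (surface_measure \<Omega>)"
    using Gamma_measurable(2)[OF \<Omega> H] by (simp add: sets_surface_measure)
  moreover have "Gamma_plus \<Omega> H \<subseteq> closure \<Omega>" by (auto simp: Gamma_plus_def frontier_def)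
  moreover have "emeasure (surface_measure \<Omega>) (Gamma_plus \<Omega> H) < \<infinity>"
    using emeasure_finite[of "Gamma_plus \<Omega> H"] by (simp only: less_top infinity_ennreal_def)
  ultimately have "\<exists>b\<ge>0. \<forall>Z\<in>Hs_vec N s \<Omega>. (LINT x:Gamma_plus \<Omega> H|surface_measure \<Omega>. exp (2 * lam * \<phi> x) * (\<Sum>m\<le>N. (Z m x)\<^sup>2)) \<le> b * (Hs_vec_norm N s \<Omega> Z)\<^sup>2"
    by (intro weighted_square_integral_le[OF s o(2) \<phi>])
  then obtain b2 where b2: "b2 \<ge> 0" "\<forall>Z\<in>Hs_vec N s \<Omega>. (LINT x:Gamma_plus \<Omega> H|surface_measure \<Omega>. exp (2 * lam * \<phi> x) * (\<Sum>m\<le>N. (Z m x)\<^sup>2)) \<le> b2 * (Hs_vec_norm N s \<Omega> Z)\<^sup>2"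
    by blast
  have "weighted_norm \<Omega> N s H \<phi> lam eps Z \<le> sqrt (b1 + b2 + eps / lam) * Hs_vec_norm N s \<Omega> Z" if Z: "Z \<in> Hs_vec N s \<Omega>" for Z
  proof -
    have "weighted_norm \<Omega> N s H \<phi> lam eps Z \<le> sqrt ((b1 + b2 + eps / lam) * (Hs_vec_norm N s \<Omega> Z)\<^sup>2)"
      unfolding weighted_norm_def distrib_right using b1(2) b2(2) Z
      by (intro real_sqrt_le_mono add_mono) auto
    also have "\<dots> = sqrt (b1 + b2 + eps / lam) * Hs_vec_norm N s \<Omega> Z"
      using Hs_vec_norm_nonneg[of N s \<Omega> Z] by (simp only: real_sqrt_mult real_sqrt_abs abs_of_nonneg)
    finally show ?thesis .
  qed
  then show ?thesis by blast
qed

text \<open>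
  Indicator and exponential weight are absorbed into the residual.
\<close>

lemma weighted_residual_energy:
  "(LINT x:A|M. exp (2 * lam * \<phi> x) * (\<Sum>m\<le>N. (q m x)\<^sup>2))
    = residual_energy N M (\<lambda>U m x. indicator A x * (exp (lam * \<phi> x) * q m x)) U"
proof -
  have "exp (2 * lam * \<phi> x) = (exp (lam * \<phi> x))\<^sup>2" for x
    by (simp add: power2_eq_square exp_add[symmetric])
  then show ?thesis
    unfolding residual_energy_def set_lebesgue_integral_def
    by (intro Bochner_Integration.integral_cong refl) (simp add: indicator_def power_mult_distrib sum_distrib_left)
qed

text \<open>
  The minimum over the ball is attained, and every value of \<open>arg_min\<close> is then a minimizer.
\<close>

lemma solution_map_in_ball:
  fixes \<Omega> :: "'a::euclidean_space set"
  assumes \<Omega>: "smooth_bounded_domain \<Omega>" and T: "T > 0"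
    and H: "continuous_on (closure \<Omega>) H" and \<phi>: "continuous_on (closure \<Omega>) \<phi>"
    and c: "continuous_on (closure \<Omega> \<times> (UNIV :: real set)) (\<lambda>(x, \<sigma>). c x \<sigma>)"
    and f: "continuous_on (closure \<Omega> \<times> (UNIV :: real set)) (\<lambda>(x, \<sigma>). f x \<sigma>)"
    and \<kappa>: "\<kappa> > 0" "\<And>x \<sigma>. x \<in> closure \<Omega> \<Longrightarrow> c x \<sigma> \<ge> \<kappa>"
    and \<alpha>: "Linfty_space_time \<Omega> T \<alpha>"
    and g: "L2_boundary_data \<Omega> T (Gamma_minus \<Omega> H) g" and h: "L2_boundary_data \<Omega> T (Gamma_plus \<Omega> H) h"
    and s: "s > real DIM('a) / 2 + 1" and M: "M \<ge> 0" and eps: "eps > 0"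
    and \<Phi>: "\<Phi> \<in> admissible_ball N s \<Omega> M"
  shows "solution_map \<Omega> T N s H \<phi> c f \<alpha> g h M lam eps \<Phi> \<in> admissible_ball N s \<Omega> M"
proof -
  let ?B = "admissible_ball N s \<Omega> M" and ?V = "Hs_vec N s \<Omega>" and ?\<sigma> = "surface_measure \<Omega>"
  have s0: "s > real DIM('a) / 2" using s by simp
  have o: "open \<Omega>" "bounded \<Omega>" using \<Omega> by (auto simp: smooth_bounded_domain_def)
  have \<Phi>V: "\<Phi> \<in> ?V" using \<Phi> by (simp add: admissible_ball_eq)
  let ?K = "\<lambda>m n x. coeff_S N T c \<Phi> m n x + coeff_M N T c \<alpha> \<Phi> m n x" and ?F = "coeff_F N T c f \<Phi>"
  let ?w = "\<lambda>x. exp (lam * \<phi> x)"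
  define p1 where "p1 = (\<lambda>(U :: nat \<Rightarrow> 'a \<Rightarrow> real) m x. indicator \<Omega> x * (?w x * (H x \<bullet> grad (U m) x + ((\<Sum>n\<le>N. ?K m n x * U n x) + ?F m x))))"
  define p2 where "p2 = (\<lambda>(U :: nat \<Rightarrow> 'a \<Rightarrow> real) m x. indicator (Gamma_minus \<Omega> H) x * (?w x * (U m x - data_coeff T g m x)))"
  define p3 where "p3 = (\<lambda>(U :: nat \<Rightarrow> 'a \<Rightarrow> real) m x. indicator (Gamma_plus \<Omega> H) x * (?w x * (U m x - data_coeff T h m x)))"
  have w: "continuous_on (closure \<Omega>) ?w" by (intro continuous_intros \<phi>)
  note co = o T c f \<kappa> \<alpha> \<Phi>V s0
  have r1: "affine_residual N s \<Omega> lborel p1"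
    unfolding p1_def
    by (rule affine_residual_domain[OF s o w H])
       (use coeff_SM[OF co] coeff_F_measurable[OF co] coeff_F_bound[OF co] in auto)
  note \<Gamma> = Gamma_measurable[OF \<Omega> H]
  have sub: "Gamma_minus \<Omega> H \<subseteq> closure \<Omega>" "Gamma_plus \<Omega> H \<subseteq> closure \<Omega>"
    by (auto simp: Gamma_minus_def Gamma_plus_def frontier_def)
  note fin = finite_surface_measure[OF \<Omega>]
  have r2: "affine_residual N s \<Omega> ?\<sigma> p2"
    unfolding p2_def
    by (rule affine_residual_boundary[OF s0 o(2) w fin sets_surface_measure \<Gamma>(1) sub(1) data_coeff_L2[OF g \<Gamma>(1)]])
  have r3: "affine_residual N s \<Omega> ?\<sigma> p3"
    unfolding p3_def
    by (rule affine_residual_boundary[OF s0 o(2) w fin sets_surface_measure \<Gamma>(2) sub(2) data_coeff_L2[OF h \<Gamma>(2)]])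
  define J where "J = carleman_functional \<Omega> T N s H \<phi> c f \<alpha> g h lam eps \<Phi>"
  have J: "J U = residual_energy N lborel p1 U + lam\<^sup>2 * residual_energy N ?\<sigma> p2 U + lam\<^sup>2 * residual_energy N ?\<sigma> p3 U
      + eps * (Hs_vec_norm N s \<Omega> U)\<^sup>2" for U
    unfolding J_def carleman_functional_def weighted_residual_energy[where U = U]
    by (simp add: residual_energy_def p1_def p2_def p3_def frozen_nonlinearity_def)
  have "\<exists>V\<in>?B. \<forall>U\<in>?B. J V \<le> J U"
  proof (rule uniformly_midpoint_convex_minimizer[OF s0 _ M])
    show "?B \<noteq> {}" using \<Phi> by blast
    show "eps / 4 > 0" using eps by simp
    show "J U \<ge> 0" for U unfolding J using eps by (simp add: residual_energy_nonneg)
  next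
    fix U V assume U: "U \<in> ?V" and V: "V \<in> ?V"
    let ?mid = "\<lambda>m x. (U m x + V m x) / 2"
    have 1: "residual_energy N lborel p1 ?mid \<le> (residual_energy N lborel p1 U + residual_energy N lborel p1 V) / 2"
      by (rule residual_energy_midpoint[OF r1 s0 U V])
    have 2: "lam\<^sup>2 * residual_energy N ?\<sigma> p2 ?mid \<le> lam\<^sup>2 * ((residual_energy N ?\<sigma> p2 U + residual_energy N ?\<sigma> p2 V) / 2)"
      by (rule mult_left_mono[OF residual_energy_midpoint[OF r2 s0 U V]]) simp
    have 3: "lam\<^sup>2 * residual_energy N ?\<sigma> p3 ?mid \<le> lam\<^sup>2 * ((residual_energy N ?\<sigma> p3 U + residual_energy N ?\<sigma> p3 V) / 2)"
      by (rule mult_left_mono[OF residual_energy_midpoint[OF r3 s0 U V]]) simp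
    have 4: "eps * ((Hs_vec_norm N s \<Omega> ?mid)\<^sup>2 + (Hs_dist N s \<Omega> U V)\<^sup>2 / 4)
        \<le> eps * (((Hs_vec_norm N s \<Omega> U)\<^sup>2 + (Hs_vec_norm N s \<Omega> V)\<^sup>2) / 2)"
      by (rule mult_left_mono[OF Hs_vec_midpoint(2)[OF s0 U V]]) (use eps in simp)
    have alg: "e1 + a2 * e2 + a2 * e3 + e * n + e / 4 * d \<le> (u1 + a2 * u2 + a2 * u3 + e * nu + (v1 + a2 * v2 + a2 * v3 + e * nv)) / 2"
      if "e1 \<le> (u1 + v1) / 2" "a2 * e2 \<le> a2 * ((u2 + v2) / 2)" "a2 * e3 \<le> a2 * ((u3 + v3) / 2)"
        "e * (n + d / 4) \<le> e * ((nu + nv) / 2)" for e1 u1 v1 a2 e2 u2 v2 e3 u3 v3 e n d nu nv :: real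
      using that by (simp add: field_simps)
    show "J ?mid + eps / 4 * (Hs_dist N s \<Omega> U V)\<^sup>2 \<le> (J U + J V) / 2"
      unfolding J by (rule alg[OF 1 2 3 4])
  next
    fix X :: "nat \<Rightarrow> nat \<Rightarrow> 'a \<Rightarrow> real" and V
    assume X: "\<And>k. X k \<in> ?V" and V: "V \<in> ?V" and lim: "(\<lambda>k. Hs_dist N s \<Omega> (X k) V) \<longlonglongrightarrow> 0"
    show "(\<lambda>k. J (X k)) \<longlonglongrightarrow> J V"
      unfolding J
      by (intro tendsto_intros residual_energy_tendsto[OF r1 s0 X V lim] residual_energy_tendsto[OF r2 s0 X V lim]
          residual_energy_tendsto[OF r3 s0 X V lim] Hs_vec_norm_tendsto[OF s0 X V lim])
  qed
  then obtain V where "V \<in> ?B" "\<forall>U\<in>?B. J V \<le> J U" by blast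
  then have "is_arg_min J (\<lambda>U. U \<in> ?B) V" by (auto simp: is_arg_min_linorder)
  then have "is_arg_min J (\<lambda>U. U \<in> ?B) (arg_min_on J ?B)"
    unfolding arg_min_on_def arg_min_def by (rule someI[of "is_arg_min J (\<lambda>U. U \<in> ?B)" V])
  then show ?thesis by (simp add: solution_map_def J_def is_arg_min_def)
qed

lemma continuous_on_componentwise_Ck:
  fixes H :: "'a::euclidean_space \<Rightarrow> 'a"
  assumes "\<forall>b\<in>Basis. Ck_closure k \<Omega> (\<lambda>x. H x \<bullet> b)"
  shows "continuous_on (closure \<Omega>) H"
  using assms continuous_on_componentwise[of "closure \<Omega>" H] by (simp add: Ck_closure_def)

theorem corollary4p1:
  fixes \<Omega> :: "'a::euclidean_space set"
    and H :: "'a \<Rightarrow> 'a"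
    and \<phi> :: "'a \<Rightarrow> real"
    and c f \<alpha> g h :: "'a \<Rightarrow> real \<Rightarrow> real"
    and T s M \<mu>\<^sub>0 \<kappa>\<^sub>0 lam1 C lam eps \<mu> :: real
    and N :: nat
    and U :: "nat \<Rightarrow> nat \<Rightarrow> 'a \<Rightarrow> real"
  defines "B \<equiv> admissible_ball N s \<Omega> M"
    and "\<T> \<equiv> solution_map \<Omega> T N s H \<phi> c f \<alpha> g h M"
    and "wnorm \<equiv> weighted_norm \<Omega> N s H \<phi>"
  assumes "smooth_bounded_domain \<Omega>"
    and "T > 0"
    and "\<forall>b\<in>Basis. Ck_closure 1 \<Omega> (\<lambda>x. H x \<bullet> b)"
    and "Ck_closure 2 \<Omega> \<phi>"
    and "\<mu>\<^sub>0 > 0"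
    and "\<forall>x\<in>closure \<Omega>. H x \<bullet> grad_closure \<Omega> \<phi> x \<ge> \<mu>\<^sub>0"
    and "Ck_closure 1 (\<Omega> \<times> (UNIV :: real set)) (\<lambda>(x, \<sigma>). c x \<sigma>)"
    and "Ck_closure 1 (\<Omega> \<times> (UNIV :: real set)) (\<lambda>(x, \<sigma>). f x \<sigma>)"
    and "\<kappa>\<^sub>0 > 0"
    and "\<forall>x\<in>closure \<Omega>. \<forall>\<sigma>. c x \<sigma> \<ge> \<kappa>\<^sub>0"
    and "Linfty_space_time \<Omega> T \<alpha>"
    and "L2_boundary_data \<Omega> T (Gamma_minus \<Omega> H) g"
    and "L2_boundary_data \<Omega> T (Gamma_plus \<Omega> H) h"
    and "s > real DIM('a) / 2 + 1"
    and "M > 0"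
    and "lam1 > 0"
    and "C > 0"
    and contraction: "\<forall>eps'>0. \<forall>lam'\<ge>lam1. \<forall>\<Phi>\<in>B. \<forall>\<Psi>\<in>B.
      wnorm lam' eps' (\<lambda>m x. \<T> lam' eps' \<Phi> m x - \<T> lam' eps' \<Psi> m x)
        \<le> sqrt (C / lam') * wnorm lam' eps' (\<lambda>m x. \<Phi> m x - \<Psi> m x)"
    and "eps > 0"
    and "lam \<ge> lam1"
    and "\<mu> = sqrt (C / lam)"
    and "\<mu> < 1"
    and "U 0 \<in> B"
    and "\<forall>k. U (Suc k) = \<T> lam eps (U k)"
  shows "\<exists>Us\<in>B. \<T> lam eps Us = Us \<and>
           (\<forall>V\<in>B. \<T> lam eps V = V \<longrightarrow> V = Us) \<and>
           (\<lambda>k. wnorm lam eps (\<lambda>m x. U k m x - Us m x)) \<longlonglongrightarrow> 0 \<and>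
           (\<forall>k. wnorm lam eps (\<lambda>m x. U k m x - Us m x)
                  \<le> \<mu> ^ k * wnorm lam eps (\<lambda>m x. U 0 m x - Us m x))"
proof -
  have s0: "s > real DIM('a) / 2" using \<open>s > real DIM('a) / 2 + 1\<close> by simp
  have H: "continuous_on (closure \<Omega>) H"
    by (rule continuous_on_componentwise_Ck) fact
  have \<phi>: "continuous_on (closure \<Omega>) \<phi>" using \<open>Ck_closure 2 \<Omega> \<phi>\<close> by (simp add: Ck_closure_def)
  have c: "continuous_on (closure \<Omega> \<times> (UNIV :: real set)) (\<lambda>(x, \<sigma>). c x \<sigma>)"
    by (rule Ck_closure_continuous) fact
  have f: "continuous_on (closure \<Omega> \<times> (UNIV :: real set)) (\<lambda>(x, \<sigma>). f x \<sigma>)"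
    by (rule Ck_closure_continuous) fact
  have lam: "lam > 0" using \<open>lam1 > 0\<close> \<open>lam \<ge> lam1\<close> by simp
  have \<mu>: "0 < \<mu>" using \<open>C > 0\<close> lam \<open>\<mu> = sqrt (C / lam)\<close> by simp
  have TB: "\<T> lam eps V \<in> B" if "V \<in> B" for V
    using that unfolding B_def \<T>_def
    by (intro solution_map_in_ball[where \<kappa> = \<kappa>\<^sub>0]) (use assms(4-) H \<phi> c f in auto)
  obtain b where b: "\<forall>Z\<in>Hs_vec N s \<Omega>. wnorm lam eps Z \<le> b * Hs_vec_norm N s \<Omega> Z"
    using weighted_norm_upper[OF s0 \<open>smooth_bounded_domain \<Omega>\<close> \<phi> H \<open>eps > 0\<close> lam] unfolding wnorm_def by blast
  show ?thesis
    unfolding B_def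
  proof (rule admissible_ball_fixed_point[OF s0, where a = "sqrt (eps / lam)" and b = b])
    show "U 0 \<in> admissible_ball N s \<Omega> M" using \<open>U 0 \<in> B\<close> by (simp add: B_def)
    show "U (Suc k) = \<T> lam eps (U k)" for k using \<open>\<forall>k. U (Suc k) = \<T> lam eps (U k)\<close> by blast
    show "\<T> lam eps V \<in> admissible_ball N s \<Omega> M" if "V \<in> admissible_ball N s \<Omega> M" for V
      using TB that by (simp add: B_def)
    show "wnorm lam eps (\<lambda>m x. \<T> lam eps V m x - \<T> lam eps W m x) \<le> \<mu> * wnorm lam eps (\<lambda>m x. V m x - W m x)"
      if "V \<in> admissible_ball N s \<Omega> M" "W \<in> admissible_ball N s \<Omega> M" for V W
      using contraction \<open>eps > 0\<close> \<open>lam \<ge> lam1\<close> that unfolding \<open>\<mu> = sqrt (C / lam)\<close> B_def by blast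
    show "0 < \<mu>" "\<mu> < 1" by fact+
    show "sqrt (eps / lam) > 0" using \<open>eps > 0\<close> lam by simp
    show "sqrt (eps / lam) * Hs_vec_norm N s \<Omega> Z \<le> wnorm lam eps Z" if "Z \<in> Hs_vec N s \<Omega>" for Z
      unfolding wnorm_def by (rule weighted_norm_lower[OF \<open>eps > 0\<close> lam])
    show "wnorm lam eps Z \<le> b * Hs_vec_norm N s \<Omega> Z" if "Z \<in> Hs_vec N s \<Omega>" for Z
      using b that by blast
  qed
qed

end
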